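(* Let $\mathcal C=\{x\in\mathbb T: b(x)=0\}$. As $\epsilon\to0$, $\epsilon\, I_\epsilon$ $\Gamma$-converges to the functional $J^{(-1)}:\mathcal P(\mathbb T)\to[0,+\infty)$ given by $$J^{(-1)}(\mu)=\frac14\int_{\mathbb T}\frac{b^2}{a}\,d\mu-\frac14\,\frac{B^2}{\int_{\mathbb T}\frac{1}{a(x)\,m_\mu(x)}\,dx}.$$ The $0$-level set $\{\mu: J^{(-1)}(\mu)=0\}$ consists of all convex combinations of Dirac measures supported on the elements of $\mathcal C$. Moreover, $\alpha_\epsilon I_\epsilon$ $\Gamma$-converges to $0$ for any positive sequence $\alpha_\epsilon$ such that $\alpha_\epsilon\,\epsilon^{-1}\to0$.
   Context: $\mathbb T=[0,1)$ is the one-dimensional torus of length $1$. Standing assumptions: $a,b:\mathbb T\to\mathbb R$ are of class $C^2(\mathbb T)$; $a(x)\ge c_0>0$ for all $x$; $b$ vanishes at exactly finitely many points $x_1,\dots,x_{2N}$ ($N\ge1$), and $b'(x_j)\ne0$ for each $j$. Put $B=\int_{\mathbb T} b(x)/a(x)\,dx$; it is assumed that $B\ge0$. For $\epsilon>0$, $L_\epsilon f=b f'+\epsilon\, a f''$, $f\in C^2(\mathbb T)$, is the generator of the diffusion $dX_\epsilon=b(X_\epsilon)dt+\sqrt{2\epsilon a(X_\epsilon)}\,dW_t$ on $\mathbb T$. $\mathcal P(\mathbb T)$ is the set of Borel probability measures on $\mathbb T$ with the weak topology. The level-two (Donsker–Varadhan) rate functional is $$I_\epsilon(\mu)=\sup_{u}\;-\int_{\mathbb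 T}\frac{L_\epsilon u}{u}\,d\mu,$$ the supremum being over all strictly positive $u\in C^2(\mathbb T)$ (the domain of the generator). For $\mu\in\mathcal P(\mathbb T)$, $m_\mu$ denotes the Radon–Nikodym derivative with respect to Lebesgue measure of the absolutely continuous part of $\mu$. If $1/m_\mu$ is not Lebesgue integrable, then $\int_{\mathbb T}1/(a m_\mu)\,dx=+\infty$ and the second term in $J^{(-1)}(\mu)$ is $0$. A family of functionals $F_\epsilon:\mathcal P(\mathbb T)\to[0,+\infty]$ $\Gamma$-converges to $F$ as $\epsilon\to0$ if for every $\mu$: (i) $\liminf_{\epsilon\to0}F_\epsilon(\mu_\epsilon)\ge F(\mu)$ for every $\mu_\epsilon\to\mu$ weakly; (ii) there exists $\mu_\epsilon\to\mu$ weakly with $\limsup_{\epsilon\to0}F_\epsilon(\mu_\epsilon)\le F(\mu)$. *)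

theory Defs
  imports "HOL-Probability.Probability"
begin

text \<open>Functions on the torus are represented by 1-periodic functions on the real line.  The torus as
  a measurable space is the interval \<open>[0,1)\<close>: its Borel sets are the same for the torus topology
  and for the topology inherited from the line.  The measure carried by \<open>torus\<close> is Lebesgue measure.\<close>

definition torus :: "real measure" where
  "torus = restrict_space lborel {0..<1}"

definition periodic1 :: "(real \<Rightarrow> real) \<Rightarrow> bool" where
  "periodic1 f \<longleftrightarrow> (\<forall>x. f (x + 1) = f x)"

definition C2_torus :: "(real \<Rightarrow> real) set" where
  "C2_torus = {f. periodic1 f \<and> f C1_differentiable_on UNIV \<and> deriv f C1_differentiable_on UNIV}"

definition prob_torus :: "real measure set" where
  "prob_torus = {\<mu>. prob_space \<mu> \<and> sets \<mu> = sets torus}"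

text \<open>The test functions are the continuous functions of the torus; periodicity matters here, since
  mass approaching 1 from the left converges to mass at 0.\<close>

definition weak_conv_torus :: "('i \<Rightarrow> real measure) \<Rightarrow> 'i filter \<Rightarrow> real measure \<Rightarrow> bool" where
  "weak_conv_torus \<mu>s F \<mu> \<longleftrightarrow>
     (\<forall>f. periodic1 f \<and> continuous_on UNIV f \<longrightarrow>
        ((\<lambda>i. LINT x|\<mu>s i. f x) \<longlongrightarrow> (LINT x|\<mu>. f x)) F)"

definition Gamma_converges ::
    "(real \<Rightarrow> real measure \<Rightarrow> ereal) \<Rightarrow> (real measure \<Rightarrow> ereal) \<Rightarrow> bool" where
  "Gamma_converges Fs F \<longleftrightarrow>
     (\<forall>\<mu>\<in>prob_torus.
        (\<forall>\<mu>s. (\<forall>\<epsilon>>0. \<mu>s \<epsilon> \<in> prob_torus) \<and> weak_conv_torus \<mu>s (at_right 0) \<mu> \<longrightarrow>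
           F \<mu> \<le> Liminf (at_right 0) (\<lambda>\<epsilon>. Fs \<epsilon> (\<mu>s \<epsilon>))) \<and>
        (\<exists>\<mu>s. (\<forall>\<epsilon>>0. \<mu>s \<epsilon> \<in> prob_torus) \<and> weak_conv_torus \<mu>s (at_right 0) \<mu> \<and>
           Limsup (at_right 0) (\<lambda>\<epsilon>. Fs \<epsilon> (\<mu>s \<epsilon>)) \<le> F \<mu>))"

definition generator ::
    "(real \<Rightarrow> real) \<Rightarrow> (real \<Rightarrow> real) \<Rightarrow> real \<Rightarrow> (real \<Rightarrow> real) \<Rightarrow> real \<Rightarrow> real" where
  "generator a b \<epsilon> f x = b x * deriv f x + \<epsilon> * a x * deriv (deriv f) x"

definition DV_rate ::
    "(real \<Rightarrow> real) \<Rightarrow> (real \<Rightarrow> real) \<Rightarrow> real \<Rightarrow> real measure \<Rightarrow> ereal" where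
  "DV_rate a b \<epsilon> \<mu> =
     (SUP u\<in>{u \<in> C2_torus. \<forall>x. u x > 0}. ereal (- (LINT x|\<mu>. generator a b \<epsilon> u x / u x)))"

text \<open>The absolutely continuous part in the Lebesgue decomposition.  It exists and is unique: if the
  singular part is concentrated on the null set \<open>Z\<close>, then \<open>\<nu> A = \<mu> (A - Z)\<close>.\<close>

definition ac_part :: "real measure \<Rightarrow> real measure" where
  "ac_part \<mu> = (THE \<nu>. sets \<nu> = sets torus \<and> absolutely_continuous torus \<nu> \<and>
     (\<exists>\<sigma>. sets \<sigma> = sets torus \<and>
        (\<exists>Z\<in>null_sets torus. emeasure \<sigma> (space torus - Z) = 0) \<and>
        (\<forall>A\<in>sets torus. emeasure \<mu> A = emeasure \<nu> A + emeasure \<sigma> A)))"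

definition ac_density :: "real measure \<Rightarrow> real \<Rightarrow> ennreal" where
  "ac_density \<mu> = RN_deriv torus (ac_part \<mu>)"

definition total_drift :: "(real \<Rightarrow> real) \<Rightarrow> (real \<Rightarrow> real) \<Rightarrow> real" where
  "total_drift a b = (LINT x|torus. b x / a x)"

text \<open>In \<open>ennreal\<close> we have \<open>1 / 0 = \<infinity>\<close> and \<open>r / \<infinity> = 0\<close>, so the second term vanishes when
  the integral of \<open>1 / (a m)\<close> is infinite.\<close>

definition J_minus1 :: "(real \<Rightarrow> real) \<Rightarrow> (real \<Rightarrow> real) \<Rightarrow> real measure \<Rightarrow> ereal" where
  "J_minus1 a b \<mu> =
     ereal (1 / 4 * (LINT x|\<mu>. (b x)\<^sup>2 / a x))
     - ereal (1 / 4) * enn2ereal (ennreal ((total_drift a b)\<^sup>2)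
         / (\<integral>\<^sup>+ x. 1 / (ennreal (a x) * ac_density \<mu> x) \<partial>torus))"

definition dirac_combinations :: "real set \<Rightarrow> real measure set" where
  "dirac_combinations C =
     {\<mu> \<in> prob_torus. \<exists>w. (\<forall>x\<in>C. 0 \<le> w x) \<and> (\<Sum>x\<in>C. w x) = 1 \<and>
        (\<forall>A\<in>sets torus. measure \<mu> A = (\<Sum>x\<in>C. w x * measure (return torus x) A))}"

end

theory Submission
  imports Defs
begin

text \<open>Write a test function as \<open>u = exp (\<phi> / \<epsilon>)\<close> and put \<open>\<psi> = \<phi>'\<close>.  Then \<open>\<epsilon> I\<^sub>\<epsilon>(\<mu>)\<close> is the supremum of
  \<open>- \<integral> (b \<psi> + a \<psi>\<^sup>2 + \<epsilon> a \<psi>') d\<mu>\<close> over the periodic \<open>C\<^sup>1\<close> functions \<open>\<psi>\<close> of mean zero, and as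
  \<open>\<epsilon> \<rightarrow> 0\<close> only the \<open>energy\<close> \<open>- \<integral> (b \<psi> + a \<psi>\<^sup>2) d\<mu>\<close> should survive.  With \<open>\<psi> = g - b / (2 a)\<close> this
  energy is \<open>1/4 \<integral> b\<^sup>2 / a d\<mu> - \<integral> a g\<^sup>2 d\<mu>\<close>, and the mean of \<open>g\<close> is \<open>B / 2\<close>.  The least value of
  \<open>\<integral> a g\<^sup>2 d\<mu>\<close> for a given mean is given by Dirichlet's principle for resistors in series: the optimal
  \<open>g\<close> is proportional to \<open>1 / (a m)\<close> off a Lebesgue null set that carries the singular part of \<open>\<mu>\<close>,
  and vanishes on that null set.  So the supremum of the energies is the functional \<open>J_minus1\<close>.
  Only two halves of this are used: every energy is at most \<open>J_minus1\<close> (\<open>energy_le_J_minus1\<close>, by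
  Cauchy-Schwarz), even for \<open>\<psi>\<close> merely bounded and measurable, and smooth \<open>\<psi>\<close> come arbitrarily close
  (\<open>J_minus1_approximated\<close>, by density of smooth functions in \<open>L\<^sup>2\<close>).

  For a fixed smooth \<open>\<psi>\<close> the energy is weakly continuous in \<open>\<mu>\<close>; this gives the lower bound
  (\<open>Gamma_liminf\<close>).

  For the upper bound, \<open>\<mu>\<close> is smoothed by convolution with a kernel of width about \<open>\<sigma>\<close> whose
  logarithmic derivative is at most \<open>2 \<pi> / \<sigma>\<^sup>2\<close>.  Integrating by parts moves the derivative in
  \<open>\<epsilon> a \<psi>'\<close> from \<open>\<psi>\<close> to the kernel, so this term costs at most a multiple of \<open>\<epsilon> / \<sigma>\<^sup>2\<close> times the average of
  \<open>\<bar>\<psi>\<bar>\<close>, uniformly in \<open>\<psi>\<close>; with \<open>\<sigma>\<^sup>2 = sqrt \<epsilon>\<close> the factor vanishes.  The energy is concave in \<open>\<psi>\<close>, so by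
  Jensen's inequality the energy of \<open>\<psi>\<close> under the smoothed measure is, up to errors absorbed by
  \<open>a \<psi>\<^sup>2\<close>, at most the energy under \<open>\<mu>\<close> itself of the local average of \<open>\<psi>\<close> (\<open>local_energy_bound\<close>),
  which again has mean zero.  Hence \<open>\<epsilon> I\<^sub>\<epsilon>\<close> of the smoothed measure is at most \<open>J_minus1 \<mu> + o(1)\<close>
  (\<open>smoothing_recovery\<close>), with no knowledge of the optimal \<open>\<psi>\<close>.  The same family of measures serves
  for every scale \<open>\<alpha>\<^sub>\<epsilon>\<close> with \<open>\<alpha>\<^sub>\<epsilon> / \<epsilon> \<rightarrow> 0\<close>.

  If \<open>J_minus1 \<mu> = 0\<close>, no multiple of any \<open>\<psi>\<close> has positive energy, so to first order
  \<open>\<integral> b \<psi> d\<mu> = 0\<close> for all \<open>\<psi>\<close> of mean zero.  As \<open>b\<close> has a simple zero it takes both signs, so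
  there is a \<open>\<psi>\<close> of mean zero with the sign of \<open>b\<close> everywhere; therefore \<open>b = 0\<close> almost
  everywhere for \<open>\<mu>\<close>.\<close>

section \<open>The torus and its functions\<close>

lemma space_torus [simp]: "space torus = {0..<1}"
  by (simp add: torus_def space_restrict_space)

lemma sets_torus: "sets torus = sets (restrict_space borel {0..<1})"
  by (simp add: torus_def sets_restrict_space)

lemma borel_measurable_torusI:
  assumes "sets \<mu> = sets torus" "f \<in> borel_measurable borel"
  shows "f \<in> borel_measurable \<mu>"
  using measurable_cong_sets[OF assms(1) refl] assms(2)
  by (metis measurable_cong_sets measurable_restrict_space1 sets_torus)

lemma continuous_borel_measurable_torus: "continuous_on UNIV f \<Longrightarrow> f \<in> borel_measurable torus"
  by (rule borel_measurable_torusI[OF refl borel_measurable_continuous_onI])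

interpretation torus: prob_space torus
  by (rule prob_spaceI) (simp add: torus_def emeasure_restrict_space space_restrict_space)

lemma measure_torus [simp]: "measure torus {0..<1} = 1"
  using torus.prob_space by simp

lemma torus_FTC:
  fixes F f :: "real \<Rightarrow> real"
  assumes "\<And>x. (F has_real_derivative f x) (at x)" and "continuous_on UNIV f"
  shows "(LINT x|torus. f x) = F 1 - F 0"
proof -
  have "(LINT x|torus. f x) = (LINT x|lborel. indicator {0..<1} x *\<^sub>R f x)"
    unfolding torus_def by (rule integral_restrict_space) simp
  also have "\<dots> = (LINT x|lborel. f x * indicator {0..1} x)"
    using assms(2)[THEN borel_measurable_continuous_onI]
    by (intro integral_cong_AE eventually_mono[OF AE_lborel_singleton[of 1]])
       (auto simp: indicator_def)
  also have "\<dots> = F 1 - F 0"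
    using assms by (intro integral_FTC_Icc_real) (auto simp: continuous_on_eq_continuous_at)
  finally show ?thesis .
qed

lemma continuous_antiderivative:
  fixes f :: "real \<Rightarrow> real"
  assumes "continuous_on UNIV f"
  obtains F where "\<And>x. (F has_real_derivative f x) (at x)"
proof -
  have "\<exists>F. \<forall>x::real. -\<infinity> < ereal x \<longrightarrow> ereal x < \<infinity> \<longrightarrow> (F has_vector_derivative f x) (at x)"
    using assms by (intro einterval_antiderivative) (auto simp: continuous_on_eq_continuous_at)
  then show thesis using that by (auto simp: has_real_derivative_iff_has_vector_derivative)
qed

lemma periodic1_int:
  assumes "periodic1 f" shows "f (x + of_int k) = f x"
proof -
  have nat: "f (y + real n) = f y" for y n
  proof (induction n)
    case (Suc n)
    then show ?case using assms unfolding periodic1_def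
      by (metis add.assoc of_nat_Suc add.commute)
  qed simp
  show ?thesis
  proof (cases "k \<ge> 0")
    case True then show ?thesis using nat[of x "nat k"] by simp
  next
    case False then show ?thesis using nat[of "x + of_int k" "nat (- k)"] by simp
  qed
qed

lemma periodic1_frac: "periodic1 f \<Longrightarrow> f (frac x) = f x"
  using periodic1_int[of f x "- \<lfloor>x\<rfloor>"] by (simp add: frac_def)

lemma periodic1_bounded:
  assumes "periodic1 f" "continuous_on UNIV f"
  obtains M where "M > 0" "\<And>x. \<bar>f x\<bar> \<le> M"
proof -
  have "compact (f ` {0..1})"
    using assms(2) by (intro compact_continuous_image) (auto intro: continuous_on_subset)
  then obtain M where "M > 0" "\<forall>y\<in>f ` {0..1}. norm y \<le> M"
    using bounded_pos compact_imp_bounded by blast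
  moreover have "frac x \<in> {0..1}" for x :: real by (simp add: frac_lt_1 less_imp_le)
  ultimately show ?thesis using that[of M] periodic1_frac[OF assms(1)] by (metis image_eqI real_norm_def)
qed

lemma prob_torusD:
  assumes "\<mu> \<in> prob_torus"
  shows "prob_space \<mu>" "sets \<mu> = sets torus" "space \<mu> = {0..<1}"
  using assms sets_eq_imp_space_eq[of \<mu> torus] by (auto simp: prob_torus_def)

lemma integrable_torus_bounded:
  fixes f :: "real \<Rightarrow> real"
  assumes "\<mu> \<in> prob_torus" "f \<in> borel_measurable torus" "\<And>x. \<bar>f x\<bar> \<le> M"
  shows "integrable \<mu> f"
proof -
  interpret prob_space \<mu> using assms prob_torusD by blast
  show ?thesis using assms measurable_cong_sets[OF prob_torusD(2)[OF assms(1)] refl]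
    by (intro integrable_const_bound[where B = M]) auto
qed

lemma torus_in_prob_torus: "torus \<in> prob_torus"
  by (simp add: prob_torus_def torus.prob_space_axioms)

text \<open>The space of the drifts and of the logarithmic derivatives of test functions.\<close>

text \<open>The functions \<open>\<psi> = \<epsilon> u' / u\<close> obtained from \<open>C\<^sup>2\<close> test functions \<open>u\<close> are exactly the members of
  this space of mean zero.\<close>

definition C1_torus :: "(real \<Rightarrow> real) set" where
  "C1_torus = {f. periodic1 f \<and> (\<exists>f'. (\<forall>x. (f has_real_derivative f' x) (at x)) \<and> continuous_on UNIV f')}"

lemma C1_torusI:
  assumes "\<And>x. f (x + 1) = f x" "\<And>x. (f has_real_derivative f' x) (at x)" "continuous_on UNIV f'"
  shows "f \<in> C1_torus"
  using assms by (auto simp: C1_torus_def periodic1_def)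

lemma periodic1_deriv:
  assumes "periodic1 f" "\<And>x. (f has_real_derivative f' x) (at x)"
  shows "periodic1 f'"
proof -
  have "f' (x + 1) = f' x" for x
  proof -
    have "((\<lambda>y. f (y + 1)) has_real_derivative f' (x + 1)) (at x)"
      using assms(2)[of "x + 1"] by (simp add: DERIV_shift)
    moreover have "(\<lambda>y. f (y + 1)) = f" using assms(1) by (auto simp: periodic1_def)
    ultimately show ?thesis using assms(2)[of x] DERIV_unique by fastforce
  qed
  then show ?thesis by (simp add: periodic1_def)
qed

lemma C1_torusE:
  assumes "f \<in> C1_torus"
  obtains f' where "periodic1 f" "\<And>x. (f has_real_derivative f' x) (at x)"
    "continuous_on UNIV f'" "periodic1 f'"
  using assms periodic1_deriv unfolding C1_torus_def by blast

lemma C1_torus_continuous: "f \<in> C1_torus \<Longrightarrow> continuous_on UNIV f"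
  by (metis C1_torusE DERIV_isCont continuous_at_imp_continuous_on)

lemma C1_torus_periodic1: "f \<in> C1_torus \<Longrightarrow> periodic1 f"
  by (auto simp: C1_torus_def)

lemma continuous_torus_integrable:
  fixes f :: "real \<Rightarrow> real"
  assumes "\<mu> \<in> prob_torus" "periodic1 f" "continuous_on UNIV f"
  shows "integrable \<mu> f"
proof -
  obtain M where "\<And>x. \<bar>f x\<bar> \<le> M" using periodic1_bounded assms by metis
  then show ?thesis
    using assms by (intro integrable_torus_bounded continuous_borel_measurable_torus) auto
qed

lemma C1_differentiable_on_UNIV_real:
  fixes f :: "real \<Rightarrow> real"
  shows "f C1_differentiable_on UNIV \<longleftrightarrow>
    (\<forall>x. (f has_real_derivative deriv f x) (at x)) \<and> continuous_on UNIV (deriv f)"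
proof -
  have "(\<forall>x. (f has_real_derivative D x) (at x)) \<Longrightarrow> deriv f = D" for D
    by (auto simp: DERIV_imp_deriv)
  then show ?thesis
    unfolding C1_differentiable_on_def has_real_derivative_iff_has_vector_derivative[symmetric]
    by auto
qed

lemma C2_torusI:
  assumes "periodic1 f" "\<And>x. (f has_real_derivative f' x) (at x)"
    "\<And>x. (f' has_real_derivative f'' x) (at x)" "continuous_on UNIV f''"
  shows "f \<in> C2_torus" "deriv f = f'" "deriv (deriv f) = f''"
proof -
  show 1: "deriv f = f'" using assms(2) by (auto simp: DERIV_imp_deriv)
  show 2: "deriv (deriv f) = f''" unfolding 1 using assms(3) by (auto simp: DERIV_imp_deriv)
  have "continuous_on UNIV f'" using assms(3) by (metis DERIV_isCont continuous_at_imp_continuous_on)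
  then show "f \<in> C2_torus"
    using assms 2 unfolding C2_torus_def C1_differentiable_on_UNIV_real by (simp add: 1)
qed

lemma C2_torusD:
  assumes "f \<in> C2_torus"
  shows "(f has_real_derivative deriv f x) (at x)"
    "(deriv f has_real_derivative deriv (deriv f) x) (at x)"
    "continuous_on UNIV (deriv (deriv f))" "f \<in> C1_torus" "deriv f \<in> C1_torus"
proof -
  show "(f has_real_derivative deriv f x) (at x)"
    "(deriv f has_real_derivative deriv (deriv f) x) (at x)"
    "continuous_on UNIV (deriv (deriv f))" "f \<in> C1_torus"
    using assms unfolding C2_torus_def C1_differentiable_on_UNIV_real C1_torus_def by auto
  have "periodic1 (deriv f)"
    using assms periodic1_deriv[of f "deriv f"] 
    unfolding C2_torus_def C1_differentiable_on_UNIV_real by blast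
  then show "deriv f \<in> C1_torus"
    using assms unfolding C2_torus_def C1_differentiable_on_UNIV_real C1_torus_def by auto
qed

section \<open>Lebesgue decomposition\<close>

text \<open>A countable union of null sets is null, so the supremum of the mass that \<open>\<mu>\<close> puts on a null
  set is attained.  Such a maximal \<open>Z\<close> carries the whole singular part.\<close>

lemma max_null_set_exists:
  assumes "prob_space \<mu>" "sets \<mu> = sets M"
  obtains Z where "Z \<in> null_sets M" "\<And>A. A \<in> null_sets M \<Longrightarrow> measure \<mu> A \<le> measure \<mu> Z"
proof -
  interpret prob_space \<mu> by fact
  define S where "S = measure \<mu> ` null_sets M"
  have bdd: "bdd_above S" unfolding S_def by (rule bdd_aboveI2[where M = 1]) simp
  have ne: "S \<noteq> {}" unfolding S_def by auto
  have "\<exists>A\<in>null_sets M. measure \<mu> A > Sup S - 1 / real (Suc n)" for n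
    using less_cSupD[OF ne, of "Sup S - 1 / real (Suc n)"] unfolding S_def by auto
  then obtain A where A: "\<And>n. A n \<in> null_sets M" "\<And>n. measure \<mu> (A n) > Sup S - 1 / real (Suc n)"
    by metis
  define Z where "Z = (\<Union>n. A n)"
  have Z: "Z \<in> null_sets M" unfolding Z_def using A(1) by (intro null_sets_UN) auto
  have "measure \<mu> (A n) \<le> measure \<mu> Z" for n
    using Z A(1) assms(2) by (intro finite_measure_mono) (auto simp: Z_def null_sets_def)
  then have "Sup S - 1 / real (Suc n) \<le> measure \<mu> Z" for n using A(2)[of n] by (meson less_le_trans less_imp_le)
  moreover have "(\<lambda>n. Sup S - 1 / real (Suc n)) \<longlonglongrightarrow> Sup S - 0"
    using LIMSEQ_inverse_real_of_nat by (intro tendsto_intros) (simp add: inverse_eq_divide)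
  ultimately have "Sup S \<le> measure \<mu> Z" using LIMSEQ_le_const2[of _ "Sup S"] by auto
  then have "measure \<mu> A \<le> measure \<mu> Z" if "A \<in> null_sets M" for A
    using that cSup_upper[OF _ bdd, of "measure \<mu> A"] unfolding S_def by auto
  then show ?thesis using that Z by blast
qed

text \<open>With \<open>Z\<close> a null set of maximal mass, a further null set of positive mass outside \<open>Z\<close> would
  contradict maximality, so the restriction of \<open>\<mu>\<close> to the complement of \<open>Z\<close> is absolutely continuous.
  It is the only candidate: two decompositions, with singular sets \<open>Z\<close> and \<open>Z'\<close>, agree with \<open>\<mu>\<close> off
  the null set \<open>Z \<union> Z'\<close>.\<close>

lemma ac_part_eq:
  assumes "\<mu> \<in> prob_torus"
  obtains Z where "Z \<in> null_sets torus"
    "ac_part \<mu> = density \<mu> (indicator (space torus - Z))" "absolutely_continuous torus (ac_part \<mu>)"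
proof -
  note \<mu> = prob_torusD[OF assms]
  interpret prob_space \<mu> by fact
  obtain Z where Z: "Z \<in> null_sets torus" "\<And>A. A \<in> null_sets torus \<Longrightarrow> measure \<mu> A \<le> measure \<mu> Z"
    using max_null_set_exists[OF \<mu>(1,2)] by metis
  have Zs: "Z \<in> sets torus" using Z(1) by auto
  then have Zc: "space torus - Z \<in> sets torus" by (rule sets.compl_sets)
  define \<nu> where "\<nu> = density \<mu> (indicator (space torus - Z))"
  have em: "emeasure \<nu> A = emeasure \<mu> (A - Z)" if "A \<in> sets torus" for A
  proof -
    have "emeasure \<nu> A = emeasure \<mu> ((space torus - Z) \<inter> A)"
      unfolding \<nu>_def using that Zc \<mu>(2) by (intro emeasure_restricted) simp_all
    moreover have "(space torus - Z) \<inter> A = A - Z" using sets.sets_into_space[OF that] by auto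
    ultimately show ?thesis by simp
  qed
  have sets\<nu>: "sets \<nu> = sets torus" by (simp add: \<nu>_def \<mu>(2))
  have ac: "absolutely_continuous torus \<nu>"
    unfolding absolutely_continuous_def
  proof
    fix A assume A: "A \<in> null_sets torus"
    then have As: "A \<in> sets torus" by auto
    have "measure \<mu> (Z \<union> A) \<le> measure \<mu> Z" using Z A by blast
    moreover have "measure \<mu> (Z \<union> A) = measure \<mu> Z + measure \<mu> (A - Z)"
      using As Zs \<mu>(2) finite_measure_Union[of Z "A - Z"] by (simp add: Un_Diff_cancel)
    ultimately have "measure \<mu> (A - Z) = 0"
      using measure_nonneg[of \<mu> "A - Z"] by linarith
    then show "A \<in> null_sets \<nu>" using As em[OF As] sets\<nu> by (auto simp: emeasure_eq_measure)
  qed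
  have "ac_part \<mu> = \<nu>"
    unfolding ac_part_def
  proof (rule the_equality)
    define \<sigma> where "\<sigma> = density \<mu> (indicator Z)"
    have em\<sigma>: "emeasure \<sigma> A = emeasure \<mu> (Z \<inter> A)" if "A \<in> sets torus" for A
      unfolding \<sigma>_def using that Zs \<mu>(2) by (intro emeasure_restricted) auto
    have "emeasure \<mu> A = emeasure \<nu> A + emeasure \<sigma> A" if A: "A \<in> sets torus" for A
      unfolding em[OF A] em\<sigma>[OF A]
      using plus_emeasure[of "A - Z" \<mu> "Z \<inter> A"] A Zs \<mu>(2)
      by (auto simp: Diff_Int_distrib2 Int_commute Un_commute) (metis Int_Diff_Un Un_commute)
    moreover have "emeasure \<sigma> (space torus - Z) = 0"
      unfolding em\<sigma>[OF Zc] by (simp add: Diff_Int_distrib)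
    ultimately show "sets \<nu> = sets torus \<and> absolutely_continuous torus \<nu> \<and>
      (\<exists>\<sigma>. sets \<sigma> = sets torus \<and> (\<exists>Z\<in>null_sets torus. emeasure \<sigma> (space torus - Z) = 0) \<and>
        (\<forall>A\<in>sets torus. emeasure \<mu> A = emeasure \<nu> A + emeasure \<sigma> A))"
      using sets\<nu> ac Z(1) \<mu>(2) by (intro conjI exI[of _ \<sigma>] bexI[of _ Z]) (auto simp: \<sigma>_def)
  next
    fix \<nu>' assume "sets \<nu>' = sets torus \<and> absolutely_continuous torus \<nu>' \<and>
      (\<exists>\<sigma>. sets \<sigma> = sets torus \<and> (\<exists>Z\<in>null_sets torus. emeasure \<sigma> (space torus - Z) = 0) \<and>
        (\<forall>A\<in>sets torus. emeasure \<mu> A = emeasure \<nu>' A + emeasure \<sigma> A))"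
    then obtain \<sigma> Z' where h: "sets \<nu>' = sets torus" "absolutely_continuous torus \<nu>'"
      "sets \<sigma> = sets torus" "Z' \<in> null_sets torus" "emeasure \<sigma> (space torus - Z') = 0"
      "\<And>A. A \<in> sets torus \<Longrightarrow> emeasure \<mu> A = emeasure \<nu>' A + emeasure \<sigma> A" by blast
    have off: "emeasure \<nu>'' (A - (Z \<union> Z')) = emeasure \<nu>'' A"
      if "absolutely_continuous torus \<nu>''" "sets \<nu>'' = sets torus" "A \<in> sets torus" for \<nu>'' A
    proof (rule emeasure_Diff_null_set)
      show "Z \<union> Z' \<in> null_sets \<nu>''" using that(1) Z(1) h(4) unfolding absolutely_continuous_def by blast
    qed (use that in auto)
    show "\<nu>' = \<nu>"
    proof (rule measure_eqI)
      fix A assume "A \<in> sets \<nu>'"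
      then have A: "A \<in> sets torus" using h by auto
      define D where "D = A - (Z \<union> Z')"
      have D: "D \<in> sets torus" unfolding D_def using A Zs h(4) by auto
      have "emeasure \<sigma> D \<le> emeasure \<sigma> (space torus - Z')"
        using sets.sets_into_space[OF A] h(3) sets.compl_sets[of Z' torus] h(4)
        by (intro emeasure_mono) (auto simp: D_def)
      then have "emeasure \<nu>' D = emeasure \<mu> D" using h(5,6) D by simp
      also have "\<dots> = emeasure \<nu> D"
      proof -
        have "D - Z = D" by (auto simp: D_def)
        then show ?thesis unfolding em[OF D] by simp
      qed
      finally show "emeasure \<nu>' A = emeasure \<nu> A"
        using off[OF h(2,1) A] off[OF ac sets\<nu> A] unfolding D_def by simp
    qed (simp add: h sets\<nu>)
  qed
  then show ?thesis using that[of Z] Z(1) ac \<nu>_def by simp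
qed

lemma ac_density:
  assumes "\<mu> \<in> prob_torus"
  obtains Z where "Z \<in> null_sets torus"
    "AE x in torus. ac_density \<mu> x < \<infinity>"
    "\<And>f. f \<in> borel_measurable torus \<Longrightarrow>
       (\<integral>\<^sup>+ x. indicator (space torus - Z) x * f x \<partial>\<mu>) = (\<integral>\<^sup>+ x. ac_density \<mu> x * f x \<partial>torus)"
proof -
  note \<mu> = prob_torusD[OF assms]
  interpret prob_space \<mu> by fact
  obtain Z where Z: "Z \<in> null_sets torus"
    "ac_part \<mu> = density \<mu> (indicator (space torus - Z))" "absolutely_continuous torus (ac_part \<mu>)"
    using ac_part_eq[OF assms] .
  have meas: "indicator (space torus - Z) \<in> borel_measurable \<mu>"
    using Z(1) \<mu>(2) by (auto intro!: borel_measurable_indicator sets.compl_sets simp del: space_torus)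
  have s: "sets (ac_part \<mu>) = sets torus" by (simp add: Z(2) \<mu>(2))
  have "emeasure (ac_part \<mu>) (space (ac_part \<mu>)) \<le> 1"
  proof -
    have "emeasure (ac_part \<mu>) (space \<mu>) = emeasure \<mu> ((space torus - Z) \<inter> space \<mu>)"
      unfolding Z(2) using Z(1) \<mu>(2)
      by (intro emeasure_restricted) (auto intro!: sets.compl_sets simp del: space_torus)
    also have "\<dots> \<le> 1" by (simp add: emeasure_eq_measure)
    finally show ?thesis by (simp add: Z(2))
  qed
  then have "finite_measure (ac_part \<mu>)"
    by (intro finite_measureI) (auto simp: top_unique)
  then have "sigma_finite_measure (ac_part \<mu>)" by (simp add: finite_measure_def)
  then have fin: "AE x in torus. ac_density \<mu> x < \<infinity>"
    using torus.RN_deriv_finite[OF _ Z(3) s] unfolding ac_density_def by (simp add: top.not_eq_extremum)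
  have "(\<integral>\<^sup>+ x. indicator (space torus - Z) x * f x \<partial>\<mu>) = (\<integral>\<^sup>+ x. ac_density \<mu> x * f x \<partial>torus)"
    if f: "f \<in> borel_measurable torus" for f
  proof -
    have "(\<integral>\<^sup>+ x. ac_density \<mu> x * f x \<partial>torus) = integral\<^sup>N (ac_part \<mu>) f"
      unfolding ac_density_def using torus.RN_deriv_nn_integral[OF Z(3) s f] by simp
    also have "\<dots> = (\<integral>\<^sup>+ x. indicator (space torus - Z) x * f x \<partial>\<mu>)"
      unfolding Z(2) using f meas measurable_cong_sets[OF \<mu>(2) refl]
      by (intro nn_integral_density) auto
    finally show ?thesis by simp
  qed
  then show ?thesis using that Z(1) fin by blast
qed

lemma ac_density_measurable [measurable]: "ac_density \<mu> \<in> borel_measurable torus"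
  by (simp add: ac_density_def)

section \<open>Energies are bounded by the limit functional\<close>

definition energy :: "(real \<Rightarrow> real) \<Rightarrow> (real \<Rightarrow> real) \<Rightarrow> real measure \<Rightarrow> (real \<Rightarrow> real) \<Rightarrow> real" where
  "energy a b \<mu> \<psi> = - (LINT x|\<mu>. b x * \<psi> x + a x * (\<psi> x)\<^sup>2)"

text \<open>If \<open>a m\<close> is the conductivity of a wire and \<open>g\<close> a voltage gradient along it, this is the total
  resistance \<open>R\<close>: the least power \<open>\<integral> a m g\<^sup>2\<close> for a given voltage drop \<open>\<integral> g = G\<close> is \<open>G\<^sup>2 / R\<close>.\<close>

definition resistance :: "(real \<Rightarrow> real) \<Rightarrow> real measure \<Rightarrow> ennreal" where
  "resistance a \<mu> = (\<integral>\<^sup>+ x. 1 / (ennreal (a x) * ac_density \<mu> x) \<partial>torus)"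

lemma integral_le_nn_integral_bound:
  fixes f :: "'a \<Rightarrow> real"
  assumes "(\<integral>\<^sup>+ x. ennreal (f x) \<partial>M) \<le> ennreal q" "0 \<le> q" "integrable M f"
  shows "(LINT x|M. f x) \<le> q"
proof -
  have "(LINT x|M. f x) \<le> enn2real (\<integral>\<^sup>+ x. ennreal (f x) \<partial>M)"
    unfolding real_lebesgue_integral_def[OF assms(3)] by simp
  also have "\<dots> \<le> enn2real (ennreal q)" using assms(1) by (intro enn2real_mono) auto
  finally show ?thesis using assms(2) by simp
qed

text \<open>This is the Cauchy-Schwarz inequality \<open>(\<integral> g)\<^sup>2 \<le> (\<integral> a m g\<^sup>2) (\<integral> 1 / (a m))\<close>, followed by dropping
  the singular part of \<open>\<mu>\<close>.  The case \<open>g = 1\<close> shows that the resistance is not \<open>0\<close>.\<close>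

lemma resistance_lower_bound:
  assumes \<mu>: "\<mu> \<in> prob_torus" and a: "continuous_on UNIV a" "periodic1 a" "\<And>x. a x > 0"
    and g: "g \<in> borel_measurable torus" "\<And>x. \<bar>g x\<bar> \<le> M"
  shows "ennreal ((LINT x|torus. g x)\<^sup>2) / resistance a \<mu> \<le> ennreal (LINT x|\<mu>. a x * (g x)\<^sup>2)"
proof (cases "resistance a \<mu> = \<infinity>")
  case True
  then show ?thesis by simp
next
  case fin: False
  obtain Z where Z: "Z \<in> null_sets torus" "AE x in torus. ac_density \<mu> x < \<infinity>"
    "\<And>f. f \<in> borel_measurable torus \<Longrightarrow>
       (\<integral>\<^sup>+ x. indicator (space torus - Z) x * f x \<partial>\<mu>) = (\<integral>\<^sup>+ x. ac_density \<mu> x * f x \<partial>torus)"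
    using ac_density[OF \<mu>] by metis
  note am[measurable] = continuous_borel_measurable_torus[OF a(1)]
  note [measurable] = g(1)
  define m where "m x = enn2real (ac_density \<mu> x)" for x
  have mm[measurable]: "m \<in> borel_measurable torus" unfolding m_def by measurable
  define w where "w x = 1 / (a x * m x)" for x
  have wm[measurable]: "w \<in> borel_measurable torus" unfolding w_def by measurable
  have inv_eq: "1 / (ennreal (a x) * ac_density \<mu> x) = ennreal (w x) \<and> 0 < m x \<and> ac_density \<mu> x = ennreal (m x)"
    if "ac_density \<mu> x < \<infinity>" "1 / (ennreal (a x) * ac_density \<mu> x) \<noteq> \<infinity>" for x
  proof -
    obtain r where r: "ac_density \<mu> x = ennreal r" "0 \<le> r" using \<open>ac_density \<mu> x < \<infinity>\<close>
      by (cases "ac_density \<mu> x") auto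
    have "r \<noteq> 0" using that(2) r by (auto simp: ennreal_divide_zero)
    then have "r > 0" using r(2) by simp
    then show ?thesis using r a(3)[of x]
      by (simp add: m_def w_def ennreal_mult[symmetric] divide_ennreal flip: ennreal_1)
  qed
  have "AE x in torus. 1 / (ennreal (a x) * ac_density \<mu> x) \<noteq> \<infinity>"
    using fin unfolding resistance_def by (intro nn_integral_PInf_AE) auto
  with Z(2) have ae: "AE x in torus. 1 / (ennreal (a x) * ac_density \<mu> x) = ennreal (w x) \<and> 0 < m x
      \<and> ac_density \<mu> x = ennreal (m x)"
    by eventually_elim (use inv_eq in blast)
  have I: "resistance a \<mu> = (\<integral>\<^sup>+ x. ennreal (w x) \<partial>torus)"
    unfolding resistance_def by (intro nn_integral_cong_AE) (use ae in eventually_elim, blast)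
  have wpos: "AE x in torus. 0 < w x" using ae by eventually_elim (use a(3) in \<open>auto simp: w_def\<close>)
  then have wnn: "AE x in torus. 0 \<le> w x" by eventually_elim simp
  have wint: "integrable torus w"
    using fin wnn by (intro integrableI_nonneg) (auto simp: I top.not_eq_extremum)
  define r where "r = (LINT x|torus. w x)"
  have Ir: "resistance a \<mu> = ennreal r"
    unfolding I r_def using wint wnn by (intro nn_integral_eq_integral)
  have "r \<noteq> 0"
  proof
    assume "r = 0"
    then have "AE x in torus. w x = 0"
      using integral_nonneg_eq_0_iff_AE[OF wint wnn] by (simp add: r_def)
    with wpos have "AE x in torus. False" by eventually_elim simp
    then show False by simp
  qed
  moreover have "r \<ge> 0" unfolding r_def using wnn by (intro integral_nonneg_AE)
  ultimately have r: "r > 0" by simp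
  obtain A where A: "\<And>x. \<bar>a x\<bar> \<le> A" using periodic1_bounded[OF a(2,1)] by metis
  have "\<bar>a x * (g x)\<^sup>2\<bar> \<le> A * M\<^sup>2" for x
  proof -
    have "(g x)\<^sup>2 \<le> M\<^sup>2" using g(2)[of x] abs_le_square_iff[of "g x" M] by linarith
    then show ?thesis unfolding abs_mult using A[of x] by (intro mult_mono) auto
  qed
  then have Qint: "integrable \<mu> (\<lambda>x. a x * (g x)\<^sup>2)"
    by (intro integrable_torus_bounded[OF \<mu>]) auto
  define Q where "Q = (LINT x|\<mu>. a x * (g x)\<^sup>2)"
  have Q0: "Q \<ge> 0" unfolding Q_def using a(3) by (intro Bochner_Integration.integral_nonneg) (simp add: less_imp_le)
  have gint: "integrable torus g" by (rule integrable_torus_bounded[OF torus_in_prob_torus g])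
  define G where "G = (LINT x|torus. g x)"
  define t where "t = G / r"
  have "(\<integral>\<^sup>+ x. ennreal (2 * t * g x - t\<^sup>2 * w x) \<partial>torus)
      \<le> (\<integral>\<^sup>+ x. ac_density \<mu> x * ennreal (a x * (g x)\<^sup>2) \<partial>torus)"
  proof (rule nn_integral_mono_AE, use ae in eventually_elim)
    fix x assume x: "1 / (ennreal (a x) * ac_density \<mu> x) = ennreal (w x) \<and> 0 < m x \<and> ac_density \<mu> x = ennreal (m x)"
    have am: "a x * m x > 0" using x a(3) by simp
    \<comment> \<open>Expanding this square bounds \<open>a m g\<^sup>2\<close> from below by an expression affine in \<open>g\<close> and in the
      resistivity \<open>w\<close>, whose integrals are known.\<close>
    have "0 \<le> (a x * m x * g x - t)\<^sup>2 / (a x * m x)" using am by simp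
    also have "\<dots> = m x * (a x * (g x)\<^sup>2) - (2 * t * g x - t\<^sup>2 * w x)"
    proof -
      have "(p * y - t)\<^sup>2 / p = p * y\<^sup>2 - (2 * t * y - t\<^sup>2 * (1 / p))" if "p > 0" for p y :: real
        using that by (simp add: power2_eq_square field_simps)
      from this[OF am, of "g x"] show ?thesis by (simp add: w_def ac_simps)
    qed
    finally show "ennreal (2 * t * g x - t\<^sup>2 * w x) \<le> ac_density \<mu> x * ennreal (a x * (g x)\<^sup>2)"
      using x a(3)[of x] by (simp add: ennreal_mult[symmetric] ennreal_leI)
  qed
  also have "\<dots> = (\<integral>\<^sup>+ x. indicator (space torus - Z) x * ennreal (a x * (g x)\<^sup>2) \<partial>\<mu>)"
    by (rule Z(3)[symmetric]) simp
  also have "\<dots> \<le> (\<integral>\<^sup>+ x. ennreal (a x * (g x)\<^sup>2) \<partial>\<mu>)"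
    by (intro nn_integral_mono) (simp add: indicator_def)
  also have "\<dots> = ennreal Q"
    unfolding Q_def using Qint a(3) by (intro nn_integral_eq_integral) (simp_all add: less_imp_le)
  finally have "(LINT x|torus. 2 * t * g x - t\<^sup>2 * w x) \<le> Q"
    using Q0 gint wint by (intro integral_le_nn_integral_bound) auto
  also have "(LINT x|torus. 2 * t * g x - t\<^sup>2 * w x) = 2 * t * G - t\<^sup>2 * r"
    using gint wint by (simp add: G_def r_def)
  also have "\<dots> = G\<^sup>2 / r" using r by (simp add: t_def power2_eq_square field_simps)
  finally show ?thesis
    using r Q0 by (simp add: Ir G_def Q_def divide_ennreal ennreal_leI)
qed

lemma J_minus1_resistance:
  "J_minus1 a b \<mu> = ereal (1 / 4 * (LINT x|\<mu>. (b x)\<^sup>2 / a x))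
     - ereal (1 / 4) * enn2ereal (ennreal ((total_drift a b)\<^sup>2) / resistance a \<mu>)"
  by (simp add: J_minus1_def resistance_def)

lemma energy_integrable:
  assumes \<mu>: "\<mu> \<in> prob_torus" and a: "a \<in> C1_torus" and b: "b \<in> C1_torus"
    and \<psi>: "\<psi> \<in> borel_measurable torus" "\<And>x. \<bar>\<psi> x\<bar> \<le> M"
  shows "integrable \<mu> (\<lambda>x. b x * \<psi> x + a x * (\<psi> x)\<^sup>2)"
proof -
  note ac = C1_torus_continuous[OF a(1)] C1_torus_periodic1[OF a(1)]
  note bc = C1_torus_continuous[OF b(1)] C1_torus_periodic1[OF b(1)]
  note [measurable] = \<psi>(1) continuous_borel_measurable_torus[OF ac(1)] continuous_borel_measurable_torus[OF bc(1)]
  obtain A where A: "A > 0" "\<And>x. \<bar>a x\<bar> \<le> A" using periodic1_bounded[OF ac(2,1)] by metis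
  obtain B where B: "B > 0" "\<And>x. \<bar>b x\<bar> \<le> B" using periodic1_bounded[OF bc(2,1)] by metis
  have "\<bar>b x * \<psi> x + a x * (\<psi> x)\<^sup>2\<bar> \<le> B * M + A * M\<^sup>2" for x
  proof -
    have "(\<psi> x)\<^sup>2 \<le> M\<^sup>2" using \<psi>(2)[of x] abs_le_square_iff[of "\<psi> x" M] by linarith
    then have "\<bar>a x * (\<psi> x)\<^sup>2\<bar> \<le> A * M\<^sup>2" unfolding abs_mult using A(2)[of x] by (intro mult_mono) auto
    moreover have "\<bar>b x * \<psi> x\<bar> \<le> B * M" unfolding abs_mult using \<psi>(2)[of x] B by (intro mult_mono) auto
    ultimately show ?thesis by linarith
  qed
  then show "integrable \<mu> (\<lambda>x. b x * \<psi> x + a x * (\<psi> x)\<^sup>2)"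
    by (intro integrable_torus_bounded[OF \<mu>]) auto
qed

lemma energy_complete_square:
  assumes \<mu>: "\<mu> \<in> prob_torus" and a: "a \<in> C1_torus" "\<And>x. a x > 0" and b: "b \<in> C1_torus"
    and \<psi>: "\<psi> \<in> borel_measurable torus" "\<And>x. \<bar>\<psi> x\<bar> \<le> M"
  shows "energy a b \<mu> \<psi> = 1 / 4 * (LINT x|\<mu>. (b x)\<^sup>2 / a x) - (LINT x|\<mu>. a x * (\<psi> x + b x / (2 * a x))\<^sup>2)"
proof -
  note ac = C1_torus_continuous[OF a(1)] C1_torus_periodic1[OF a(1)]
  note bc = C1_torus_continuous[OF b(1)] C1_torus_periodic1[OF b(1)]
  have a0: "a x \<noteq> 0" for x using a(2)[of x] by simp
  have i2: "integrable \<mu> (\<lambda>x. (b x)\<^sup>2 / a x)"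
    using ac bc a0 by (intro continuous_torus_integrable[OF \<mu>] continuous_intros) (auto simp: periodic1_def)
  have eq: "a x * (\<psi> x + b x / (2 * a x))\<^sup>2 = (b x * \<psi> x + a x * (\<psi> x)\<^sup>2) + 1 / 4 * ((b x)\<^sup>2 / a x)" for x
    using a0[of x] by (simp add: power2_eq_square field_simps)
  show ?thesis unfolding energy_def eq
      Bochner_Integration.integral_add[OF energy_integrable[OF \<mu> a(1) b \<psi>] integrable_mult_right[OF i2, of "1 / 4"]]
    by (simp only: integral_mult_right_zero)
qed

lemma total_drift_half:
  "(LINT x|torus. b x / (2 * a x)) = total_drift a b / 2"
proof -
  have "(\<lambda>x. b x / (2 * a x)) = (\<lambda>x. 1 / 2 * (b x / a x))" by auto
  then show ?thesis unfolding total_drift_def by (simp only: integral_mult_right_zero)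
qed

lemma C1_torus_half_quotient:
  assumes a: "a \<in> C1_torus" "\<And>x. a x > 0" and b: "b \<in> C1_torus"
  shows "(\<lambda>x. b x / (2 * a x)) \<in> C1_torus"
proof -
  obtain a' where a': "periodic1 a" "\<And>x. (a has_real_derivative a' x) (at x)" "continuous_on UNIV a'"
    using C1_torusE[OF a(1)] by metis
  obtain b' where b': "periodic1 b" "\<And>x. (b has_real_derivative b' x) (at x)" "continuous_on UNIV b'"
    using C1_torusE[OF b] by metis
  note cont = C1_torus_continuous[OF a(1)] C1_torus_continuous[OF b]
  have a0: "a x \<noteq> 0" for x using a(2)[of x] by simp
  show ?thesis
  proof (rule C1_torusI)
    show "((\<lambda>x. b x / (2 * a x)) has_real_derivative
      (b' x * (2 * a x) - b x * (2 * a' x)) / (2 * a x * (2 * a x))) (at x)" for x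
      using a0[of x] by (auto intro!: derivative_eq_intros a' b')
    show "continuous_on UNIV (\<lambda>x. (b' x * (2 * a x) - b x * (2 * a' x)) / (2 * a x * (2 * a x)))"
      using a0 by (intro continuous_intros cont a' b') auto
  qed (use a'(1) b'(1) in \<open>auto simp: periodic1_def\<close>)
qed

text \<open>Stated for bounded measurable \<open>\<psi>\<close> so that it applies to local averages of test functions.\<close>

lemma energy_le_J_minus1:
  assumes \<mu>: "\<mu> \<in> prob_torus" and a: "a \<in> C1_torus" "\<And>x. a x > 0" and b: "b \<in> C1_torus"
    and \<psi>: "\<psi> \<in> borel_measurable torus" "\<And>x. \<bar>\<psi> x\<bar> \<le> M" "(LINT x|torus. \<psi> x) = 0"
  shows "ereal (energy a b \<mu> \<psi>) \<le> J_minus1 a b \<mu>"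
proof -
  define g where "g x = \<psi> x + b x / (2 * a x)" for x
  have q: "(\<lambda>x. b x / (2 * a x)) \<in> C1_torus" by (rule C1_torus_half_quotient[OF a b])
  obtain K where K: "\<And>x. \<bar>b x / (2 * a x)\<bar> \<le> K"
    using periodic1_bounded[OF C1_torus_periodic1[OF q] C1_torus_continuous[OF q]] by metis
  have gm: "g \<in> borel_measurable torus"
    using \<psi>(1) continuous_borel_measurable_torus[OF C1_torus_continuous[OF q]] unfolding g_def by simp
  have gb: "\<bar>g x\<bar> \<le> M + K" for x unfolding g_def using \<psi>(2)[of x] K[of x] by linarith
  have "(LINT x|torus. g x) = total_drift a b / 2"
    unfolding g_def using integrable_torus_bounded[OF torus_in_prob_torus \<psi>(1,2)]
      continuous_torus_integrable[OF torus_in_prob_torus C1_torus_periodic1[OF q] C1_torus_continuous[OF q]]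
    by (simp add: \<psi>(3) total_drift_half)
  from resistance_lower_bound[OF \<mu> C1_torus_continuous[OF a(1)] C1_torus_periodic1[OF a(1)] a(2) gm gb, unfolded this]
  have "ennreal ((total_drift a b / 2)\<^sup>2) / resistance a \<mu> \<le> ennreal (LINT x|\<mu>. a x * (g x)\<^sup>2)" .
  moreover have "ennreal ((total_drift a b)\<^sup>2) = 4 * ennreal ((total_drift a b / 2)\<^sup>2)"
    by (simp add: power_divide ennreal_mult[symmetric] flip: ennreal_numeral)
  ultimately have "ennreal ((total_drift a b)\<^sup>2) / resistance a \<mu> \<le> 4 * ennreal (LINT x|\<mu>. a x * (g x)\<^sup>2)"
    by (simp add: ennreal_times_divide[symmetric] mult_left_mono)
  also have "\<dots> = ennreal (4 * (LINT x|\<mu>. a x * (g x)\<^sup>2))"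
    by (subst ennreal_mult') simp_all
  finally have "enn2ereal (ennreal ((total_drift a b)\<^sup>2) / resistance a \<mu>) \<le> ereal (4 * (LINT x|\<mu>. a x * (g x)\<^sup>2))"
    using a(2) by (subst (asm) less_eq_ennreal.rep_eq, subst (asm) enn2ereal_ennreal) (auto intro!: Bochner_Integration.integral_nonneg simp: less_imp_le)
  then have "ereal (1 / 4) * enn2ereal (ennreal ((total_drift a b)\<^sup>2) / resistance a \<mu>)
      \<le> ereal (1 / 4) * ereal (4 * (LINT x|\<mu>. a x * (g x)\<^sup>2))"
    by (intro ereal_mult_left_mono) auto
  then have "ereal (1 / 4) * enn2ereal (ennreal ((total_drift a b)\<^sup>2) / resistance a \<mu>)
      \<le> ereal (LINT x|\<mu>. a x * (g x)\<^sup>2)" by simp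
  then have "ereal (1 / 4 * (LINT x|\<mu>. (b x)\<^sup>2 / a x)) - ereal (LINT x|\<mu>. a x * (g x)\<^sup>2) \<le> J_minus1 a b \<mu>"
    unfolding J_minus1_resistance by (intro ereal_minus_mono) auto
  then show ?thesis
    unfolding energy_complete_square[OF \<mu> a b \<psi>(1,2)] g_def by simp
qed

section \<open>Density of smooth functions in \<open>L\<^sup>2\<close>\<close>

text \<open>Approximation holds in two measures at once because in the application the mean of the
  profile is a Lebesgue integral while its energy is an integral for \<open>\<mu>\<close>.\<close>

definition approximable :: "real measure \<Rightarrow> real measure \<Rightarrow> (real \<Rightarrow> real) \<Rightarrow> bool" where
  "approximable \<mu> \<nu> h \<longleftrightarrow> h \<in> borel_measurable torus \<and> (\<exists>M. \<forall>x. \<bar>h x\<bar> \<le> M) \<and>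
     (\<forall>\<delta>>0. \<exists>g\<in>C1_torus. (LINT x|\<mu>. (g x - h x)\<^sup>2) < \<delta> \<and> (LINT x|\<nu>. (g x - h x)\<^sup>2) < \<delta>)"

lemma C1_torus_add:
  assumes "f \<in> C1_torus" "g \<in> C1_torus"
  shows "(\<lambda>x. f x + g x) \<in> C1_torus"
proof -
  obtain f' where f': "periodic1 f" "\<And>x. (f has_real_derivative f' x) (at x)" "continuous_on UNIV f'"
    using C1_torusE[OF assms(1)] by metis
  obtain g' where g': "periodic1 g" "\<And>x. (g has_real_derivative g' x) (at x)" "continuous_on UNIV g'"
    using C1_torusE[OF assms(2)] by metis
  show ?thesis
    by (rule C1_torusI[where f' = "\<lambda>x. f' x + g' x"])
       (use f'(1) g'(1) in \<open>auto simp: periodic1_def intro: DERIV_add f'(2) g'(2) continuous_on_add f'(3) g'(3)\<close>)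
qed

lemma C1_torus_const: "(\<lambda>_. c) \<in> C1_torus"
  by (rule C1_torusI[where f' = "\<lambda>_. 0"]) auto

lemma C1_torus_cmult:
  assumes "f \<in> C1_torus"
  shows "(\<lambda>x. c * f x) \<in> C1_torus"
proof -
  obtain f' where f': "periodic1 f" "\<And>x. (f has_real_derivative f' x) (at x)" "continuous_on UNIV f'"
    using C1_torusE[OF assms(1)] by metis
  show ?thesis
    by (rule C1_torusI[where f' = "\<lambda>x. c * f' x"])
       (use f'(1) in \<open>auto simp: periodic1_def intro: DERIV_cmult f'(2) continuous_on_mult_left f'(3)\<close>)
qed

lemma square_integrable_bounded:
  fixes f :: "real \<Rightarrow> real"
  assumes "\<mu> \<in> prob_torus" "f \<in> borel_measurable torus" "\<And>x. \<bar>f x\<bar> \<le> M"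
  shows "integrable \<mu> (\<lambda>x. (f x)\<^sup>2)"
proof (rule integrable_torus_bounded[OF assms(1)])
  show "\<bar>(f x)\<^sup>2\<bar> \<le> M\<^sup>2" for x using assms(3)[of x] abs_le_square_iff[of "f x" M] by simp
qed (use assms(2) in measurable)

lemma L2_triangle:
  fixes f g :: "real \<Rightarrow> real"
  assumes "\<mu> \<in> prob_torus" "f \<in> borel_measurable torus" "\<And>x. \<bar>f x\<bar> \<le> M"
    "g \<in> borel_measurable torus" "\<And>x. \<bar>g x\<bar> \<le> K"
  shows "(LINT x|\<mu>. (f x + g x)\<^sup>2) \<le> 2 * (LINT x|\<mu>. (f x)\<^sup>2) + 2 * (LINT x|\<mu>. (g x)\<^sup>2)"
proof -
  have i: "integrable \<mu> (\<lambda>x. (f x)\<^sup>2)" "integrable \<mu> (\<lambda>x. (g x)\<^sup>2)"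
    using assms square_integrable_bounded by blast+
  have "\<bar>f x + g x\<bar> \<le> M + K" for x using assms(3)[of x] assms(5)[of x] by linarith
  then have i2: "integrable \<mu> (\<lambda>x. (f x + g x)\<^sup>2)"
    using assms by (intro square_integrable_bounded[where M = "M + K"]) auto
  have "(f x + g x)\<^sup>2 \<le> 2 * (f x)\<^sup>2 + 2 * (g x)\<^sup>2" for x
    using zero_le_power2[of "f x - g x"] by (simp add: power2_eq_square algebra_simps)
  then have "(LINT x|\<mu>. (f x + g x)\<^sup>2) \<le> (LINT x|\<mu>. 2 * (f x)\<^sup>2 + 2 * (g x)\<^sup>2)"
    using i i2 by (intro integral_mono) auto
  then show ?thesis using i by simp
qed

lemma C1_torus_bounded_measurable:
  assumes "g \<in> C1_torus"
  obtains K where "K > 0" "\<And>x. \<bar>g x\<bar> \<le> K" "g \<in> borel_measurable torus"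
  using periodic1_bounded[OF C1_torus_periodic1[OF assms] C1_torus_continuous[OF assms]]
    continuous_borel_measurable_torus[OF C1_torus_continuous[OF assms]] by metis

lemma approximable_closed:
  assumes \<mu>: "\<mu> \<in> prob_torus" and \<nu>: "\<nu> \<in> prob_torus"
    and h: "h \<in> borel_measurable torus" "\<And>x. \<bar>h x\<bar> \<le> M"
    and *: "\<And>\<delta>. \<delta> > 0 \<Longrightarrow> \<exists>k. approximable \<mu> \<nu> k \<and> (LINT x|\<mu>. (k x - h x)\<^sup>2) < \<delta> \<and> (LINT x|\<nu>. (k x - h x)\<^sup>2) < \<delta>"
  shows "approximable \<mu> \<nu> h"
  unfolding approximable_def
proof (intro conjI allI impI)
  fix \<delta> :: real assume "\<delta> > 0"
  then obtain k where k: "approximable \<mu> \<nu> k" "(LINT x|\<mu>. (k x - h x)\<^sup>2) < \<delta> / 4" "(LINT x|\<nu>. (k x - h x)\<^sup>2) < \<delta> / 4"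
    using *[of "\<delta> / 4"] by auto
  then obtain N where km: "k \<in> borel_measurable torus" "\<And>x. \<bar>k x\<bar> \<le> N"
    unfolding approximable_def by blast
  obtain g where g: "g \<in> C1_torus" "(LINT x|\<mu>. (g x - k x)\<^sup>2) < \<delta> / 4" "(LINT x|\<nu>. (g x - k x)\<^sup>2) < \<delta> / 4"
    using k(1) \<open>\<delta> > 0\<close> unfolding approximable_def by (metis divide_pos_pos zero_less_numeral)
  obtain K where gm: "\<And>x. \<bar>g x\<bar> \<le> K" "g \<in> borel_measurable torus"
    using C1_torus_bounded_measurable[OF g(1)] by metis
  have b: "\<bar>g x - k x\<bar> \<le> K + N" "\<bar>k x - h x\<bar> \<le> N + M" for x
    using gm(1)[of x] km(2)[of x] h(2)[of x] by linarith+
  have tri: "(LINT x|\<rho>. (g x - h x)\<^sup>2) \<le> 2 * (LINT x|\<rho>. (g x - k x)\<^sup>2) + 2 * (LINT x|\<rho>. (k x - h x)\<^sup>2)"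
    if "\<rho> \<in> prob_torus" for \<rho>
    using L2_triangle[OF that borel_measurable_diff[OF gm(2) km(1)] b(1) borel_measurable_diff[OF km(1) h(1)] b(2)]
    by simp
  show "\<exists>g\<in>C1_torus. (LINT x|\<mu>. (g x - h x)\<^sup>2) < \<delta> \<and> (LINT x|\<nu>. (g x - h x)\<^sup>2) < \<delta>"
    using g k tri[OF \<mu>] tri[OF \<nu>] by (intro bexI[of _ g] conjI) auto
qed (use h in auto)

text \<open>Bounded pointwise convergence implies convergence in \<open>L\<^sup>2\<close> of any probability measure.  Only the
  points of \<open>{0..<1}\<close> count, so the limit need not be periodic.\<close>

lemma approximable_limit:
  assumes \<mu>: "\<mu> \<in> prob_torus" and \<nu>: "\<nu> \<in> prob_torus"
    and k: "\<And>n. approximable \<mu> \<nu> (k n)" "\<And>n x. \<bar>k n x\<bar> \<le> M"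
    and lim: "\<And>x. x \<in> {0..<1} \<Longrightarrow> (\<lambda>n. k n x) \<longlonglongrightarrow> h x"
    and h: "h \<in> borel_measurable torus" "\<And>x. \<bar>h x\<bar> \<le> M"
  shows "approximable \<mu> \<nu> h"
proof (rule approximable_closed[OF \<mu> \<nu> h])
  fix \<delta> :: real assume "\<delta> > 0"
  have km: "k n \<in> borel_measurable torus" for n using k(1) by (simp add: approximable_def)
  have conv: "(\<lambda>n. LINT x|\<rho>. (k n x - h x)\<^sup>2) \<longlonglongrightarrow> 0" if \<rho>: "\<rho> \<in> prob_torus" for \<rho>
  proof -
    note eq = measurable_cong_sets[OF prob_torusD(2)[OF \<rho>] refl]
    interpret prob_space \<rho> by (rule prob_torusD[OF \<rho>])
    have "(\<lambda>n. LINT x|\<rho>. (k n x - h x)\<^sup>2) \<longlonglongrightarrow> (LINT x|\<rho>. 0)"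
    proof (rule integral_dominated_convergence[where w = "\<lambda>_. (2 * M)\<^sup>2"])
      show "AE x in \<rho>. (\<lambda>n. (k n x - h x)\<^sup>2) \<longlonglongrightarrow> 0"
      proof (rule AE_I2)
        fix x assume "x \<in> space \<rho>"
        then have "(\<lambda>n. (k n x - h x)\<^sup>2) \<longlonglongrightarrow> (h x - h x)\<^sup>2"
          using lim prob_torusD(3)[OF \<rho>] by (intro tendsto_intros) auto
        then show "(\<lambda>n. (k n x - h x)\<^sup>2) \<longlonglongrightarrow> 0" by simp
      qed
      show "AE x in \<rho>. norm ((k n x - h x)\<^sup>2) \<le> (2 * M)\<^sup>2" for n
      proof (rule AE_I2)
        fix x
        have "\<bar>k n x - h x\<bar> \<le> \<bar>2 * M\<bar>" using k(2)[of n x] h(2)[of x] by linarith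
        then show "norm ((k n x - h x)\<^sup>2) \<le> (2 * M)\<^sup>2" by (simp add: abs_le_square_iff)
      qed
    qed (use h(1) km in \<open>auto simp: eq\<close>)
    then show ?thesis by simp
  qed
  have "eventually (\<lambda>n. (LINT x|\<mu>. (k n x - h x)\<^sup>2) < \<delta> \<and> (LINT x|\<nu>. (k n x - h x)\<^sup>2) < \<delta>) sequentially"
    using order_tendstoD(2)[OF conv[OF \<mu>] \<open>\<delta> > 0\<close>] order_tendstoD(2)[OF conv[OF \<nu>] \<open>\<delta> > 0\<close>]
    by eventually_elim simp
  from eventually_happens'[OF sequentially_bot this] k(1)
  show "\<exists>k. approximable \<mu> \<nu> k \<and> (LINT x|\<mu>. (k x - h x)\<^sup>2) < \<delta> \<and> (LINT x|\<nu>. (k x - h x)\<^sup>2) < \<delta>"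
    by auto
qed

lemma approximable_C1: "g \<in> C1_torus \<Longrightarrow> approximable \<mu> \<nu> g"
  unfolding approximable_def by (rule C1_torus_bounded_measurable, assumption) (auto intro!: bexI[of _ g])

lemma approximable_add:
  assumes \<mu>: "\<mu> \<in> prob_torus" and \<nu>: "\<nu> \<in> prob_torus"
    and h: "approximable \<mu> \<nu> h" and k: "approximable \<mu> \<nu> k"
  shows "approximable \<mu> \<nu> (\<lambda>x. h x + k x)"
proof -
  obtain M N where h': "h \<in> borel_measurable torus" "\<And>x. \<bar>h x\<bar> \<le> M"
    and k': "k \<in> borel_measurable torus" "\<And>x. \<bar>k x\<bar> \<le> N" using h k unfolding approximable_def by blast
  show ?thesis unfolding approximable_def
  proof (intro conjI allI impI exI)
    show "\<bar>h x + k x\<bar> \<le> M + N" for x using h'(2)[of x] k'(2)[of x] by linarith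
  next
    fix \<delta> :: real assume "\<delta> > 0"
    then have d: "\<delta> / 4 > 0" by simp
    obtain f where f: "f \<in> C1_torus" "(LINT x|\<mu>. (f x - h x)\<^sup>2) < \<delta> / 4" "(LINT x|\<nu>. (f x - h x)\<^sup>2) < \<delta> / 4"
      using h d unfolding approximable_def by meson
    obtain g where g: "g \<in> C1_torus" "(LINT x|\<mu>. (g x - k x)\<^sup>2) < \<delta> / 4" "(LINT x|\<nu>. (g x - k x)\<^sup>2) < \<delta> / 4"
      using k d unfolding approximable_def by meson
    obtain K where gm: "\<And>x. \<bar>g x\<bar> \<le> K" "g \<in> borel_measurable torus"
      using C1_torus_bounded_measurable[OF g(1)] by metis
    obtain L where fm: "\<And>x. \<bar>f x\<bar> \<le> L" "f \<in> borel_measurable torus"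
      using C1_torus_bounded_measurable[OF f(1)] by metis
    have b: "\<bar>f x - h x\<bar> \<le> L + M" "\<bar>g x - k x\<bar> \<le> K + N" for x
      using gm(1)[of x] fm(1)[of x] k'(2)[of x] h'(2)[of x] by linarith+
    have eq: "f x + g x - (h x + k x) = (f x - h x) + (g x - k x)" for x by simp
    have tri: "(LINT x|\<rho>. (f x + g x - (h x + k x))\<^sup>2) \<le> 2 * (LINT x|\<rho>. (f x - h x)\<^sup>2) + 2 * (LINT x|\<rho>. (g x - k x)\<^sup>2)"
      if "\<rho> \<in> prob_torus" for \<rho>
      unfolding eq by (rule L2_triangle[OF that borel_measurable_diff[OF fm(2) h'(1)] b(1) borel_measurable_diff[OF gm(2) k'(1)] b(2)])
    show "\<exists>g\<in>C1_torus. (LINT x|\<mu>. (g x - (h x + k x))\<^sup>2) < \<delta> \<and> (LINT x|\<nu>. (g x - (h x + k x))\<^sup>2) < \<delta>"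
      using f g tri[OF \<mu>] tri[OF \<nu>] by (intro bexI[OF _ C1_torus_add[OF f(1) g(1)]] conjI) auto
  qed (use h' k' in auto)
qed

lemma approximable_cmult:
  assumes "approximable \<mu> \<nu> h"
  shows "approximable \<mu> \<nu> (\<lambda>x. c * h x)"
proof (cases "c = 0")
  case True
  then show ?thesis using approximable_C1[OF C1_torus_const[of 0]] by simp
next
  case False
  obtain M where h': "h \<in> borel_measurable torus" "\<And>x. \<bar>h x\<bar> \<le> M" using assms unfolding approximable_def by blast
  show ?thesis unfolding approximable_def
  proof (intro conjI allI impI exI)
    show "\<bar>c * h x\<bar> \<le> \<bar>c\<bar> * M" for x unfolding abs_mult using h'(2)[of x] by (intro mult_left_mono) auto
  next
    fix \<delta> :: real assume "\<delta> > 0"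
    then have "\<delta> / c\<^sup>2 > 0" using False by simp
    then obtain f where f: "f \<in> C1_torus" "(LINT x|\<mu>. (f x - h x)\<^sup>2) < \<delta> / c\<^sup>2" "(LINT x|\<nu>. (f x - h x)\<^sup>2) < \<delta> / c\<^sup>2"
      using assms unfolding approximable_def by meson
    have eq: "(c * f x - c * h x)\<^sup>2 = c\<^sup>2 * (f x - h x)\<^sup>2" for x by (simp add: power2_eq_square algebra_simps)
    show "\<exists>g\<in>C1_torus. (LINT x|\<mu>. (g x - c * h x)\<^sup>2) < \<delta> \<and> (LINT x|\<nu>. (g x - c * h x)\<^sup>2) < \<delta>"
      using f False by (intro bexI[OF _ C1_torus_cmult[OF f(1), of c]]) (simp add: eq field_simps)
  qed (use h' in auto)
qed

lemma approximable_cong: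
  assumes "approximable \<mu> \<nu> h" and \<mu>: "\<mu> \<in> prob_torus" and \<nu>: "\<nu> \<in> prob_torus"
    and k: "k \<in> borel_measurable torus" "\<And>x. \<bar>k x\<bar> \<le> M" and eq: "\<And>x. x \<in> {0..<1} \<Longrightarrow> h x = k x"
  shows "approximable \<mu> \<nu> k"
proof -
  have "(LINT x|\<rho>. (h x - k x)\<^sup>2) = 0" if "\<rho> \<in> prob_torus" for \<rho>
    using eq prob_torusD(3)[OF that] by (subst Bochner_Integration.integral_cong[where g = "\<lambda>_. 0", OF refl]) auto
  then show ?thesis using approximable_closed[OF \<mu> \<nu> k] assms by metis
qed

text \<open>The logistic function of \<open>n\<^sup>2 t - n\<close> tends to \<open>1\<close> where \<open>t > 0\<close> and to \<open>0\<close> where \<open>t \<le> 0\<close>;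
  with \<open>t\<close> the product of two sines, of period \<open>1\<close> and positive exactly on \<open>(u, 1)\<close>, this
  approximates the indicator of a half-line by smooth functions of the torus.\<close>

lemma approximable_greaterThan:
  assumes \<mu>: "\<mu> \<in> prob_torus" and \<nu>: "\<nu> \<in> prob_torus"
  shows "approximable \<mu> \<nu> (indicator {u<..})"
proof -
  have ind: "(indicator {u<..} :: real \<Rightarrow> real) \<in> borel_measurable torus"
    by (rule borel_measurable_torusI[OF refl]) simp
  consider "u < 0" | "u \<ge> 1" | "0 \<le> u" "u < 1" by linarith
  then show ?thesis
  proof cases
    case 1
    then show ?thesis using ind
      by (intro approximable_cong[OF approximable_C1[OF C1_torus_const[of 1]] \<mu> \<nu>, where M = 1]) (auto simp: indicator_def)
  next
    case 2
    then show ?thesis using ind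
      by (intro approximable_cong[OF approximable_C1[OF C1_torus_const[of 0]] \<mu> \<nu>, where M = 1]) (auto simp: indicator_def)
  next
    case 3
    define t where "t x = sin (pi * (x - u)) * sin (pi * (1 - x))" for x
    define t' where "t' x = cos (pi * (x - u)) * pi * sin (pi * (1 - x)) - sin (pi * (x - u)) * (cos (pi * (1 - x)) * pi)" for x
    have t': "(t has_real_derivative t' x) (at x)" for x
      unfolding t_def t'_def by (auto intro!: derivative_eq_intros simp: algebra_simps)
    have per: "t (x + 1) = t x" for x
    proof -
      have "pi * (x + 1 - u) = pi * (x - u) + pi" "pi * (1 - (x + 1)) = pi * (1 - x) - pi"
        by (simp_all add: algebra_simps)
      then show ?thesis unfolding t_def by (simp add: sin_diff)
    qed
    have pos: "t x > 0" if "u < x" "x < 1" for x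
    proof -
      have "pi * (x - u) < pi * 1" "pi * (1 - x) < pi * 1" using that 3 by (auto intro!: mult_strict_left_mono)
      then show ?thesis unfolding t_def using that by (intro mult_pos_pos sin_gt_zero) auto
    qed
    have neg: "t x \<le> 0" if "x \<le> u" "0 \<le> x" for x
    proof -
      have "pi * (u - x) \<le> pi * 1" "pi * (1 - x) \<le> pi * 1" using that 3 by (auto intro!: mult_left_mono)
      then have "sin (pi * (u - x)) \<ge> 0" "sin (pi * (1 - x)) \<ge> 0"
        using that 3 by (auto intro!: sin_ge_zero)
      moreover have "sin (pi * (x - u)) = - sin (pi * (u - x))" by (simp flip: sin_minus add: algebra_simps)
      ultimately show ?thesis unfolding t_def by (simp add: mult_nonneg_nonneg)
    qed
    define k where "k n x = 1 / (1 + exp (real n - (real n)\<^sup>2 * t x))" for n :: nat and x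
    have pos1: "1 + exp y > 0" for y :: real by (simp add: add_pos_pos)
    have nz: "1 + exp y \<noteq> 0" for y :: real using pos1[of y] by linarith
    have contt: "continuous_on UNIV t" "continuous_on UNIV t'" unfolding t_def t'_def by (intro continuous_intros)+
    have kC1: "k n \<in> C1_torus" for n
    proof (rule C1_torusI)
      show "k n (x + 1) = k n x" for x by (simp add: k_def per)
      show "(k n has_real_derivative
        (exp (real n - (real n)\<^sup>2 * t x) * ((real n)\<^sup>2 * t' x)) / (1 + exp (real n - (real n)\<^sup>2 * t x))\<^sup>2) (at x)" for x
        unfolding k_def using nz
        by (auto intro!: derivative_eq_intros t' simp: power2_eq_square)
      show "continuous_on UNIV (\<lambda>x. (exp (real n - (real n)\<^sup>2 * t x) * ((real n)\<^sup>2 * t' x)) / (1 + exp (real n - (real n)\<^sup>2 * t x))\<^sup>2)"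
        using nz by (intro continuous_intros contt) auto
    qed
    show ?thesis
    proof (rule approximable_limit[OF \<mu> \<nu>, where k = k and M = 1])
      show "approximable \<mu> \<nu> (k n)" for n by (rule approximable_C1[OF kC1])
      show "\<bar>k n x\<bar> \<le> 1" for n x using pos1 by (simp add: k_def)
      show "(indicator {u<..} :: real \<Rightarrow> real) \<in> borel_measurable torus" by (rule ind)
      show "\<bar>indicator {u<..} x\<bar> \<le> (1::real)" for x by (simp add: indicator_def)
      fix x :: real assume x: "x \<in> {0..<1}"
      show "(\<lambda>n. k n x) \<longlonglongrightarrow> indicator {u<..} x"
      proof (cases "x > u")
        case True
        then have "t x > 0" using pos x by simp
        then have "filterlim (\<lambda>n. real n - (real n)\<^sup>2 * t x) at_bot sequentially" by real_asymp
        then have "(\<lambda>n. exp (real n - (real n)\<^sup>2 * t x)) \<longlonglongrightarrow> 0" by (rule filterlim_compose[OF exp_at_bot])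
        then have "(\<lambda>n. k n x) \<longlonglongrightarrow> 1 / (1 + 0)" unfolding k_def by (intro tendsto_intros) auto
        then show ?thesis using True by simp
      next
        case False
        then have "t x \<le> 0" using neg x by simp
        have "(\<lambda>n. k n x) \<longlonglongrightarrow> 0"
        proof (rule tendsto_sandwich[where f = "\<lambda>_. 0" and h = "\<lambda>n. 1 / (1 + exp (real n))"])
          show "eventually (\<lambda>n. k n x \<le> 1 / (1 + exp (real n))) sequentially"
          proof (rule always_eventually, rule)
            fix n
            have "real n \<le> real n - (real n)\<^sup>2 * t x" using \<open>t x \<le> 0\<close> by (simp add: mult_nonneg_nonpos)
            then show "k n x \<le> 1 / (1 + exp (real n))"
              unfolding k_def using pos1 by (intro divide_left_mono mult_pos_pos) auto
          qed
          show "(\<lambda>n. 1 / (1 + exp (real n))) \<longlonglongrightarrow> 0" by real_asymp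
          show "eventually (\<lambda>n. 0 \<le> k n x) sequentially" using pos1 by (simp add: k_def less_imp_le)
        qed simp
        then show ?thesis using False by simp
      qed
    qed
  qed
qed

text \<open>A Dynkin argument: complements and countable disjoint unions of approximable sets are
  approximable, and the half-lines are stable under intersection.\<close>

lemma approximable_borel_set:
  assumes \<mu>: "\<mu> \<in> prob_torus" and \<nu>: "\<nu> \<in> prob_torus" and "A \<in> sets borel"
  shows "approximable \<mu> \<nu> (indicator A)"
proof -
  have ind: "(indicator B :: real \<Rightarrow> real) \<in> borel_measurable torus" if "B \<in> sets borel" for B
    using that by (intro borel_measurable_torusI[OF refl]) simp
  have sb: "sets borel = sigma_sets UNIV (range (greaterThan :: real \<Rightarrow> real set))"
    by (subst borel_Ioi) simp
  have "Int_stable (range (greaterThan :: real \<Rightarrow> real set))"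
  proof (rule Int_stableI)
    fix A B assume "A \<in> range (greaterThan :: real \<Rightarrow> real set)" "B \<in> range (greaterThan :: real \<Rightarrow> real set)"
    then obtain x y :: real where "A = {x<..}" "B = {y<..}" by auto
    then have "A \<inter> B = {max x y<..}" by auto
    then show "A \<inter> B \<in> range greaterThan" by simp
  qed
  moreover have "range greaterThan \<subseteq> Pow (UNIV :: real set)" by simp
  moreover have "A \<in> sigma_sets UNIV (range greaterThan)" using assms(3) sb by simp
  ultimately show ?thesis
  proof (induction rule: sigma_sets_induct_disjoint)
    case (basic A)
    then show ?case using approximable_greaterThan[OF \<mu> \<nu>] by auto
  next
    case empty
    then show ?case using approximable_C1[OF C1_torus_const[of 0]] by (simp add: indicator_def cong: if_cong)
  next
    case (compl A)
    have "(indicator (UNIV - A) :: real \<Rightarrow> real) = (\<lambda>x. 1 + (-1) * indicator A x)"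
      by (auto simp: indicator_def)
    then show ?case
      using approximable_add[OF \<mu> \<nu> approximable_C1[OF C1_torus_const[of 1]] approximable_cmult[OF compl(2), of "-1"]]
      by simp
  next
    case (union A)
    have sums: "approximable \<mu> \<nu> (indicator (\<Union>i<n. A i))" for n :: nat
    proof (induction n)
      case 0
      then show ?case using approximable_C1[OF C1_torus_const[of 0]] by (simp add: indicator_def cong: if_cong)
    next
      case (Suc n)
      have "A n \<inter> A i = {}" if "i < n" for i using that union(1) by (auto simp: disjoint_family_on_def)
      then have "A n \<inter> (\<Union>i<n. A i) = {}" by blast
      then have "(indicator (\<Union>i<Suc n. A i) :: real \<Rightarrow> real) = (\<lambda>x. indicator (\<Union>i<n. A i) x + indicator (A n) x)"
        by (auto simp: indicator_def lessThan_Suc fun_eq_iff)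
      then show ?case using approximable_add[OF \<mu> \<nu> Suc union(3)] by simp
    qed
    show ?case
    proof (rule approximable_limit[OF \<mu> \<nu> sums, where M = 1])
      show "(\<lambda>n. indicator (\<Union>i<n. A i) x) \<longlonglongrightarrow> (indicator (\<Union> (range A)) x :: real)" for x
        by (rule LIMSEQ_indicator_UN)
      show "(indicator (\<Union> (range A)) :: real \<Rightarrow> real) \<in> borel_measurable torus"
        using union(2) unfolding sb[symmetric] by (intro ind) auto
    qed (auto simp: indicator_def)
  qed
qed

lemma bounded_measurable_approximable:
  assumes \<mu>: "\<mu> \<in> prob_torus" and \<nu>: "\<nu> \<in> prob_torus"
    and h: "h \<in> borel_measurable torus" "\<And>x. 0 \<le> h x" "\<And>x. h x \<le> M"
  shows "approximable \<mu> \<nu> h"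
proof -
  define h' where "h' x = indicator {0..<1} x * h x" for x
  have h': "h' \<in> borel_measurable borel"
    unfolding h'_def using h(1) borel_measurable_restrict_space_iff[of "{0..<1}" borel h]
    unfolding measurable_cong_sets[OF sets_torus refl] by simp
  have h'n: "0 \<le> h' x" "h' x \<le> \<bar>M\<bar>" for x using h(2)[of x] h(3)[of x] by (auto simp: h'_def indicator_def)
  from h' h'n(1) have "(\<exists>K. \<forall>x. h' x \<le> K) \<longrightarrow> approximable \<mu> \<nu> h'"
  proof (induction rule: borel_measurable_induct_real)
    case (set A)
    then show ?case using approximable_borel_set[OF \<mu> \<nu>] by simp
  next
    case (mult u c)
    show ?case
    proof
      assume "\<exists>K. \<forall>x. c * u x \<le> K"
      then obtain K where K: "\<And>x. c * u x \<le> K" by blast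
      show "approximable \<mu> \<nu> (\<lambda>x. c * u x)"
      proof (cases "c = 0")
        case True
        then show ?thesis using approximable_C1[OF C1_torus_const[of 0]] by simp
      next
        case False
        then have "c > 0" using mult(1) by simp
        then have "u x \<le> K / c" for x using K[of x] by (simp add: field_simps)
        then show ?thesis using mult approximable_cmult by blast
      qed
    qed
  next
    case (add u v)
    show ?case
    proof
      assume "\<exists>K. \<forall>x. v x + u x \<le> K"
      then obtain K where K: "\<And>x. v x + u x \<le> K" by blast
      have "u x \<le> K" "v x \<le> K" for x using K[of x] add.hyps(2)[of x] add.hyps(4)[of x] by linarith+
      then show "approximable \<mu> \<nu> (\<lambda>x. v x + u x)" using add approximable_add[OF \<mu> \<nu>] by blast
    qed
  next
    case (seq U)
    show ?case
    proof
      assume "\<exists>K. \<forall>x. h' x \<le> K"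
      then obtain K where K: "\<And>x. h' x \<le> K" by blast
      have conv: "(\<lambda>i. U i x) \<longlonglongrightarrow> h' x" for x using seq.hyps(4) by simp
      have le: "U i x \<le> K" for i x
      proof -
        have "incseq (\<lambda>i. U i x)" using seq.hyps(3) by (auto simp: incseq_def le_fun_def)
        then show ?thesis using incseq_le[OF _ conv[of x], of i] K[of x] by linarith
      qed
      show "approximable \<mu> \<nu> h'"
      proof (rule approximable_limit[OF \<mu> \<nu>, where k = U and M = K])
        show "approximable \<mu> \<nu> (U n)" for n using seq.IH[of n] le by blast
        show "\<bar>U n x\<bar> \<le> K" for n x using le[of n x] seq(2)[of n x] by simp
        show "h' \<in> borel_measurable torus" by (rule borel_measurable_torusI[OF refl h'])
        show "\<bar>h' x\<bar> \<le> K" for x using K[of x] h'n(1)[of x] by simp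
      qed (rule conv)
    qed
  qed
  then have "approximable \<mu> \<nu> h'" using h'n by blast
  moreover have "\<bar>h x\<bar> \<le> \<bar>M\<bar>" for x using h(2)[of x] h(3)[of x] by linarith
  ultimately show ?thesis
    by (rule approximable_cong[OF _ \<mu> \<nu> h(1)]) (simp add: h'_def)
qed

section \<open>Energies close to the limit functional\<close>

text \<open>The mean and the energy are continuous for the \<open>L\<^sup>2\<close> distance, so the profile \<open>h\<close>, of mean \<open>k\<close>
  and of energy at most \<open>k\<close>, can be replaced by a smooth \<open>f\<close>; dividing by the mean of \<open>f\<close> yields an energy
  close to \<open>k / k\<^sup>2\<close>.\<close>

lemma approximate_profile:
  assumes \<mu>: "\<mu> \<in> prob_torus" and a: "continuous_on UNIV a" "periodic1 a" "\<And>x. a x > 0"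
    and h: "h \<in> borel_measurable torus" "\<And>x. 0 \<le> h x" "\<And>x. h x \<le> n"
    and k: "k = (LINT x|torus. h x)" "k > 0" and hk: "(LINT x|\<mu>. a x * (h x)\<^sup>2) \<le> k" and L: "1 / k < L"
  obtains g where "g \<in> C1_torus" "(LINT x|torus. g x) = 1" "(LINT x|\<mu>. a x * (g x)\<^sup>2) < L"
proof -
  have L0: "L > 0" using L k(2) by (meson divide_pos_pos less_trans zero_less_one)
  obtain A where A: "A > 0" "\<And>x. \<bar>a x\<bar> \<le> A" using periodic1_bounded[OF a(2,1)] by metis
  have n0: "n \<ge> 0" using h(2,3)[of 0] by linarith
  have hb: "\<bar>h x\<bar> \<le> n" for x using h(2,3)[of x] by simp
  note [measurable] = h(1) continuous_borel_measurable_torus[OF a(1)]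
  have "((\<lambda>\<eta>. L * (k - \<eta>)\<^sup>2 - (k + A * \<eta>\<^sup>2 + 2 * A * n * \<eta>)) \<longlongrightarrow> L * (k - 0)\<^sup>2 - (k + A * 0\<^sup>2 + 2 * A * n * 0)) (at_right 0)"
    by (intro tendsto_intros)
  moreover have "L * (k - 0)\<^sup>2 - (k + A * 0\<^sup>2 + 2 * A * n * 0) > 0"
    using L k(2) by (simp add: field_simps power2_eq_square)
  ultimately have "eventually (\<lambda>\<eta>. L * (k - \<eta>)\<^sup>2 - (k + A * \<eta>\<^sup>2 + 2 * A * n * \<eta>) > 0) (at_right 0)"
    by (rule order_tendstoD(1))
  moreover have "eventually (\<lambda>\<eta>. \<eta> < k) (at_right 0)" "eventually (\<lambda>\<eta>. \<eta> > 0) (at_right (0::real))"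
    using k(2) by (auto simp: eventually_at_right)
  ultimately have "eventually (\<lambda>\<eta>. L * (k - \<eta>)\<^sup>2 - (k + A * \<eta>\<^sup>2 + 2 * A * n * \<eta>) > 0 \<and> \<eta> < k \<and> \<eta> > 0) (at_right 0)"
    by eventually_elim simp
  then obtain \<eta> where \<eta>: "L * (k - \<eta>)\<^sup>2 > k + A * \<eta>\<^sup>2 + 2 * A * n * \<eta>" "\<eta> < k" "\<eta> > 0"
    using eventually_happens'[of "at_right (0::real)"] trivial_limit_at_right_real by fastforce
  obtain f where f: "f \<in> C1_torus" "(LINT x|\<mu>. (f x - h x)\<^sup>2) < \<eta>\<^sup>2" "(LINT x|torus. (f x - h x)\<^sup>2) < \<eta>\<^sup>2"
    using bounded_measurable_approximable[OF \<mu> torus_in_prob_torus h] \<eta>(3) unfolding approximable_def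
    by (meson zero_less_power)
  obtain F where fm: "\<And>x. \<bar>f x\<bar> \<le> F" "f \<in> borel_measurable torus"
    using C1_torus_bounded_measurable[OF f(1)] by metis
  note [measurable] = fm(2)
  have db: "\<bar>f x - h x\<bar> \<le> F + n" for x using fm(1)[of x] hb[of x] by linarith
  have dsq: "integrable \<rho> (\<lambda>x. (f x - h x)\<^sup>2)" if "\<rho> \<in> prob_torus" for \<rho>
    using db by (intro square_integrable_bounded[OF that]) auto
  have young: "\<bar>y\<bar> \<le> (\<eta> + y\<^sup>2 / \<eta>) / 2" for y
  proof -
    have "0 \<le> (\<bar>y\<bar> - \<eta>)\<^sup>2 / \<eta>" using \<eta>(3) by simp
    also have "\<dots> = \<eta> + y\<^sup>2 / \<eta> - 2 * \<bar>y\<bar>" using \<eta>(3) by (simp add: power2_diff field_simps) (simp add: power2_eq_square)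
    finally show ?thesis by simp
  qed
  define G where "G = (LINT x|torus. f x)"
  have fi: "integrable torus f" and hi: "integrable torus h"
    using integrable_torus_bounded[OF torus_in_prob_torus] fm h(1) hb by blast+
  have "\<bar>G - k\<bar> = \<bar>LINT x|torus. f x - h x\<bar>" unfolding G_def k(1) using fi hi by simp
  also have "\<dots> \<le> (LINT x|torus. \<bar>f x - h x\<bar>)"
    by (rule integral_abs_bound)
  also have "\<dots> \<le> (LINT x|torus. (\<eta> + (f x - h x)\<^sup>2 / \<eta>) / 2)"
    using young fi hi dsq[OF torus_in_prob_torus] by (intro integral_mono) auto
  also have "\<dots> = (\<eta> + (LINT x|torus. (f x - h x)\<^sup>2) / \<eta>) / 2"
    using dsq[OF torus_in_prob_torus] by simp
  also have "\<dots> \<le> (\<eta> + \<eta>\<^sup>2 / \<eta>) / 2"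
    using f(3) \<eta>(3) by (intro divide_right_mono add_left_mono) auto
  also have "\<dots> = \<eta>" using \<eta>(3) by (simp add: power2_eq_square)
  finally have "\<bar>G - k\<bar> \<le> \<eta>" .
  then have G: "G \<ge> k - \<eta>" "G > 0" using \<eta>(2) by linarith+
  interpret \<mu>: prob_space \<mu> by (rule prob_torusD[OF \<mu>])
  have ai: "integrable \<mu> (\<lambda>x. a x * (u x)\<^sup>2)" if "u \<in> borel_measurable torus" "\<And>x. \<bar>u x\<bar> \<le> M" for u :: "real \<Rightarrow> real" and M
  proof (rule integrable_torus_bounded[OF \<mu>, where M = "A * M\<^sup>2"])
    show "\<bar>a x * (u x)\<^sup>2\<bar> \<le> A * M\<^sup>2" for x
    proof -
      have "(u x)\<^sup>2 \<le> M\<^sup>2" using that(2)[of x] abs_le_square_iff[of "u x" M] by linarith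
      then show ?thesis unfolding abs_mult using A(2)[of x] by (intro mult_mono) auto
    qed
  qed (use that(1) in measurable)
  have pt: "a x * (f x)\<^sup>2 \<le> a x * (h x)\<^sup>2 + (A * (f x - h x)\<^sup>2 + A * n * (\<eta> + (f x - h x)\<^sup>2 / \<eta>))" for x
  proof -
    define d where "d = f x - h x"
    have "a x * (f x)\<^sup>2 = a x * (h x)\<^sup>2 + (a x * d\<^sup>2 + 2 * (a x * h x * d))"
      by (simp add: d_def power2_eq_square algebra_simps)
    moreover have "a x * d\<^sup>2 \<le> A * d\<^sup>2" using A(2)[of x] by (intro mult_right_mono) auto
    moreover have "2 * (a x * h x * d) \<le> A * n * (\<eta> + d\<^sup>2 / \<eta>)"
    proof -
      have "a x * h x * d \<le> \<bar>a x * h x * d\<bar>" by simp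
      also have "\<dots> = \<bar>a x\<bar> * \<bar>h x\<bar> * \<bar>d\<bar>" by (simp add: abs_mult)
      also have "\<dots> \<le> (A * n) * ((\<eta> + d\<^sup>2 / \<eta>) / 2)"
        using A n0 hb[of x] young[of d] by (intro mult_mono) auto
      finally have "2 * (a x * h x * d) \<le> 2 * ((A * n) * ((\<eta> + d\<^sup>2 / \<eta>) / 2))" by simp
      then show ?thesis by simp
    qed
    ultimately show ?thesis unfolding d_def[symmetric] by linarith
  qed
  have "(LINT x|\<mu>. a x * (f x)\<^sup>2) \<le> (LINT x|\<mu>. a x * (h x)\<^sup>2 + (A * (f x - h x)\<^sup>2 + A * n * (\<eta> + (f x - h x)\<^sup>2 / \<eta>)))"
    using pt ai[OF fm(2,1)] ai[OF h(1) hb] dsq[OF \<mu>] by (intro integral_mono) auto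
  also have "\<dots> = (LINT x|\<mu>. a x * (h x)\<^sup>2) + (A * (LINT x|\<mu>. (f x - h x)\<^sup>2) + A * n * (\<eta> + (LINT x|\<mu>. (f x - h x)\<^sup>2) / \<eta>))"
    using ai[OF h(1) hb] dsq[OF \<mu>] by (simp add: \<mu>.prob_space)
  also have "\<dots> \<le> k + (A * \<eta>\<^sup>2 + A * n * (\<eta> + \<eta>\<^sup>2 / \<eta>))"
    using hk f(2) A(1) n0 \<eta>(3) by (intro add_mono mult_left_mono divide_right_mono) auto
  also have "\<dots> = k + A * \<eta>\<^sup>2 + 2 * A * n * \<eta>" using \<eta>(3) by (simp add: power2_eq_square)
  also have "\<dots> < L * (k - \<eta>)\<^sup>2" by (rule \<eta>(1))
  also have "\<dots> \<le> L * G\<^sup>2" using L0 G(1) \<eta>(2) by (intro mult_left_mono power_mono) auto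
  finally have fL: "(LINT x|\<mu>. a x * (f x)\<^sup>2) < L * G\<^sup>2" .
  have eq: "a x * (1 / G * f x)\<^sup>2 = 1 / G\<^sup>2 * (a x * (f x)\<^sup>2)" for x
    by (simp add: power_divide power_mult_distrib)
  show thesis
  proof (rule that)
    show "(\<lambda>x. 1 / G * f x) \<in> C1_torus" by (rule C1_torus_cmult[OF f(1)])
    show "(LINT x|torus. 1 / G * f x) = 1"
      using G(2) unfolding integral_mult_right_zero G_def[symmetric] by simp
    show "(LINT x|\<mu>. a x * (1 / G * f x)\<^sup>2) < L"
      unfolding eq integral_mult_right_zero using fL G(2) by (simp add: field_simps)
  qed
qed

text \<open>Truncation of the optimal profile \<open>1 / (a m)\<close> at height \<open>n\<close> makes it square integrable.
  Where \<open>h\<close> is the truncated profile, \<open>a m h \<le> 1\<close>, so its energy is at most its mean, and the mean increases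
  to the resistance with \<open>n\<close>.\<close>

lemma resistance_attained:
  assumes \<mu>: "\<mu> \<in> prob_torus" and a: "continuous_on UNIV a" "periodic1 a" "\<And>x. a x > 0"
    and L: "1 / resistance a \<mu> < ennreal L"
  obtains g where "g \<in> C1_torus" "(LINT x|torus. g x) = 1" "(LINT x|\<mu>. a x * (g x)\<^sup>2) < L"
proof -
  note [measurable] = continuous_borel_measurable_torus[OF a(1)]
  obtain Z where Z: "Z \<in> null_sets torus" "AE x in torus. ac_density \<mu> x < \<infinity>"
    "\<And>f. f \<in> borel_measurable torus \<Longrightarrow>
       (\<integral>\<^sup>+ x. indicator (space torus - Z) x * f x \<partial>\<mu>) = (\<integral>\<^sup>+ x. ac_density \<mu> x * f x \<partial>torus)"
    using ac_density[OF \<mu>] by metis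
  have Zs[measurable]: "Z \<in> sets torus" using Z(1) by auto
  define y where "y x = 1 / (ennreal (a x) * ac_density \<mu> x)" for x
  have ym[measurable]: "y \<in> borel_measurable torus" unfolding y_def by measurable
  \<comment> \<open>The optimal profile \<open>1 / (a m)\<close>, truncated, and set to \<open>0\<close> where the singular part lives.\<close>
  define h where "h n x = indicator (- Z) x * enn2real (inf (y x) (of_nat n))" for n x
  have hm[measurable]: "h n \<in> borel_measurable torus" for n
  proof -
    have "(indicator (- Z) :: real \<Rightarrow> real) \<in> borel_measurable torus \<longleftrightarrow> (indicator (space torus - Z) :: real \<Rightarrow> real) \<in> borel_measurable torus"
      by (rule measurable_cong) (auto simp: indicator_def)
    then have "(indicator (- Z) :: real \<Rightarrow> real) \<in> borel_measurable torus"
      using sets.compl_sets[OF Zs] by simp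
    then show ?thesis unfolding h_def inf_min by measurable
  qed
  have hn: "ennreal (h n x) = indicator (- Z) x * inf (y x) (of_nat n)" for n x
  proof -
    have "inf (y x) (of_nat n) \<le> of_nat n" by simp
    also have "\<dots> < top" by (simp add: of_nat_less_top)
    finally show ?thesis by (simp add: h_def indicator_def)
  qed
  have h0: "0 \<le> h n x" for n x by (simp add: h_def indicator_def)
  have hle: "h n x \<le> real n" for n x
  proof -
    have "ennreal (h n x) \<le> ennreal (real n)" unfolding hn by (simp add: indicator_def ennreal_of_nat_eq_real_of_nat)
    then show ?thesis by (simp add: ennreal_le_iff)
  qed
  have hab: "\<bar>h n x\<bar> \<le> real n" for n x using h0 hle by simp
  have "AE x in torus. x \<notin> Z" by (rule AE_not_in[OF Z(1)])
  then have "resistance a \<mu> = (\<integral>\<^sup>+ x. (SUP n. ennreal (h n x)) \<partial>torus)"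
    unfolding resistance_def y_def[symmetric]
    by (intro nn_integral_cong_AE, eventually_elim)
       (simp add: hn indicator_def inf_SUP[symmetric] ennreal_SUP_of_nat_eq_top)
  also have "\<dots> = (SUP n. \<integral>\<^sup>+ x. ennreal (h n x) \<partial>torus)"
  proof (rule nn_integral_monotone_convergence_SUP)
    show "incseq (\<lambda>n x. ennreal (h n x))"
    proof -
      have "inf (y x) (of_nat i) \<le> inf (y x) (of_nat j)" if "i \<le> j" for x i j
        by (rule inf_mono) (simp_all add: that)
      then show ?thesis unfolding hn by (simp add: incseq_def le_fun_def indicator_def)
    qed
  qed measurable
  finally have R: "resistance a \<mu> = (SUP n. \<integral>\<^sup>+ x. ennreal (h n x) \<partial>torus)" .
  have L0: "L > 0" using L by (metis ennreal_neg not_less not_less_zero)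
  have "ennreal (1 / L) < resistance a \<mu>"
  proof (cases "resistance a \<mu>")
    case (real r)
    have "r \<noteq> 0" using L real by (auto simp: ennreal_divide_zero)
    then have r: "r > 0" using real by simp
    then have "ennreal (1 / r) < ennreal L" using L real by (simp add: divide_ennreal flip: ennreal_1)
    then have "1 / r < L" using r by (simp add: ennreal_less_iff)
    then have "1 / L < r" using r L0 by (simp add: field_simps)
    then show ?thesis using real L0 by (simp add: ennreal_less_iff)
  next
    case top
    then show ?thesis by simp
  qed
  then obtain n where n: "ennreal (1 / L) < (\<integral>\<^sup>+ x. ennreal (h n x) \<partial>torus)"
    unfolding R by (auto simp: less_SUP_iff)
  define k where "k = (LINT x|torus. h n x)"
  have hint: "integrable torus (h n)" by (rule integrable_torus_bounded[OF torus_in_prob_torus hm hab])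
  then have kn: "(\<integral>\<^sup>+ x. ennreal (h n x) \<partial>torus) = ennreal k"
    unfolding k_def using h0 by (intro nn_integral_eq_integral) auto
  have "1 / L < k" using n L0 unfolding kn by (simp add: ennreal_less_iff)
  then have k1: "k > 0" using L0 by (meson divide_pos_pos less_trans zero_less_one)
  then have k2: "1 / k < L" using \<open>1 / L < k\<close> L0 by (simp add: field_simps)
  have "(\<integral>\<^sup>+ x. ennreal (a x * (h n x)\<^sup>2) \<partial>\<mu>) = (\<integral>\<^sup>+ x. indicator (space torus - Z) x * ennreal (a x * (h n x)\<^sup>2) \<partial>\<mu>)"
    using prob_torusD(3)[OF \<mu>] by (intro nn_integral_cong) (auto simp: h_def indicator_def)
  also have "\<dots> = (\<integral>\<^sup>+ x. ac_density \<mu> x * ennreal (a x * (h n x)\<^sup>2) \<partial>torus)"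
    by (rule Z(3)) measurable
  also have "\<dots> \<le> (\<integral>\<^sup>+ x. ennreal (h n x) \<partial>torus)"
  proof (rule nn_integral_mono_AE, use Z(2) in eventually_elim)
    fix x assume fin: "ac_density \<mu> x < \<infinity>"
    then obtain m where m: "ac_density \<mu> x = ennreal m" "m \<ge> 0" by (cases "ac_density \<mu> x") auto
    have "m * (a x * (h n x)\<^sup>2) \<le> h n x"
    proof (cases "m = 0")
      case True then show ?thesis using h0 by simp
    next
      case False
      then have am: "a x * m > 0" using m a(3)[of x] by simp
      have "ennreal (h n x) \<le> y x" unfolding hn by (simp add: indicator_def)
      also have "y x = ennreal (1 / (a x * m))"
        using am a(3)[of x] m by (simp add: y_def ennreal_mult[symmetric] divide_ennreal flip: ennreal_1)
      finally have "h n x \<le> 1 / (a x * m)" using am by (simp add: ennreal_le_iff)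
      then have "a x * m * h n x \<le> 1" using am by (simp add: field_simps)
      then have "h n x * (a x * m * h n x) \<le> h n x * 1" using h0 by (intro mult_left_mono) auto
      then show ?thesis by (simp add: power2_eq_square algebra_simps)
    qed
    then show "ac_density \<mu> x * ennreal (a x * (h n x)\<^sup>2) \<le> ennreal (h n x)"
      using m a(3)[of x] by (simp add: ennreal_mult[symmetric] ennreal_leI)
  qed
  finally have le: "(\<integral>\<^sup>+ x. ennreal (a x * (h n x)\<^sup>2) \<partial>\<mu>) \<le> ennreal k" unfolding kn .
  have "(LINT x|\<mu>. a x * (h n x)\<^sup>2) \<le> k"
  proof (rule integral_le_nn_integral_bound[OF le])
    obtain A where A: "A > 0" "\<And>x. \<bar>a x\<bar> \<le> A" using periodic1_bounded[OF a(2,1)] by metis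
    show "integrable \<mu> (\<lambda>x. a x * (h n x)\<^sup>2)"
    proof (rule integrable_torus_bounded[OF \<mu>, where M = "A * (real n)\<^sup>2"])
      show "\<bar>a x * (h n x)\<^sup>2\<bar> \<le> A * (real n)\<^sup>2" for x
        unfolding abs_mult using A(2)[of x] hle h0 by (intro mult_mono) (auto intro: power_mono)
    qed measurable
  qed (use k1 in simp)
  then show thesis
    using approximate_profile[OF \<mu> a hm h0 hle k_def k1 _ k2] that by blast
qed

text \<open>Take \<open>\<psi> = (B / 2) g - b / (2 a)\<close> with a nearly optimal \<open>g\<close> of mean one.\<close>

lemma J_minus1_approximated:
  assumes \<mu>: "\<mu> \<in> prob_torus" and a: "a \<in> C1_torus" "\<And>x. a x > 0" and b: "b \<in> C1_torus"
    and \<delta>: "\<delta> > 0"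
  obtains \<psi> where "\<psi> \<in> C1_torus" "(LINT x|torus. \<psi> x) = 0" "J_minus1 a b \<mu> \<le> ereal (energy a b \<mu> \<psi> + \<delta>)"
proof -
  define B where "B = total_drift a b"
  note ac = C1_torus_continuous[OF a(1)] C1_torus_periodic1[OF a(1)]
  have q: "(\<lambda>x. b x / (2 * a x)) \<in> C1_torus" by (rule C1_torus_half_quotient[OF a b])
  have "ennreal ((LINT x|torus. 1)\<^sup>2) / resistance a \<mu> \<le> ennreal (LINT x|\<mu>. a x * 1\<^sup>2)"
    by (rule resistance_lower_bound[OF \<mu> ac a(2)]) auto
  then have Rfin: "1 / resistance a \<mu> < top"
    by (auto intro: order_le_less_trans)
  define p where "p = enn2real (1 / resistance a \<mu>)"
  have p: "1 / resistance a \<mu> = ennreal p" "p \<ge> 0" unfolding p_def using Rfin by simp_all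
  have "p < p + 4 * \<delta> / (B\<^sup>2 + 1)" using \<delta> by (simp add: add_pos_nonneg add_nonneg_pos)
  then have "1 / resistance a \<mu> < ennreal (p + 4 * \<delta> / (B\<^sup>2 + 1))" unfolding p(1) using p(2) by (simp add: ennreal_less_iff)
  then obtain g where g: "g \<in> C1_torus" "(LINT x|torus. g x) = 1" "(LINT x|\<mu>. a x * (g x)\<^sup>2) < p + 4 * \<delta> / (B\<^sup>2 + 1)"
    using resistance_attained[OF \<mu> ac a(2)] by metis
  define \<psi> where "\<psi> x = B / 2 * g x + (-1) * (b x / (2 * a x))" for x
  have \<psi>: "\<psi> \<in> C1_torus" unfolding \<psi>_def by (intro C1_torus_add C1_torus_cmult g(1) q)
  obtain M where M: "\<And>x. \<bar>\<psi> x\<bar> \<le> M" "\<psi> \<in> borel_measurable torus"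
    using C1_torus_bounded_measurable[OF \<psi>] by metis
  have ti: "integrable torus u" if "u \<in> C1_torus" for u
    by (rule continuous_torus_integrable[OF torus_in_prob_torus C1_torus_periodic1[OF that] C1_torus_continuous[OF that]])
  have "(LINT x|torus. \<psi> x) = B / 2 * (LINT x|torus. g x) + (-1) * (LINT x|torus. b x / (2 * a x))"
    unfolding \<psi>_def using ti[OF C1_torus_cmult[OF g(1)]] ti[OF C1_torus_cmult[OF q]]
    by (subst Bochner_Integration.integral_add) (simp_all only: integral_mult_right_zero)
  then have zero: "(LINT x|torus. \<psi> x) = 0" by (simp only: g(2) total_drift_half B_def)
  have eq: "a x * (\<psi> x + b x / (2 * a x))\<^sup>2 = B\<^sup>2 / 4 * (a x * (g x)\<^sup>2)" for x
    by (simp add: \<psi>_def power2_eq_square)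
  have en: "energy a b \<mu> \<psi> = 1 / 4 * (LINT x|\<mu>. (b x)\<^sup>2 / a x) - B\<^sup>2 / 4 * (LINT x|\<mu>. a x * (g x)\<^sup>2)"
    unfolding energy_complete_square[OF \<mu> a b M(2,1)] eq by (simp only: integral_mult_right_zero)
  have "B\<^sup>2 / 4 * (LINT x|\<mu>. a x * (g x)\<^sup>2) \<le> B\<^sup>2 / 4 * (p + 4 * \<delta> / (B\<^sup>2 + 1))"
    using g(3) by (intro mult_left_mono) auto
  also have "\<dots> = B\<^sup>2 / 4 * p + \<delta> * (B\<^sup>2 / (B\<^sup>2 + 1))" by (simp add: algebra_simps)
  also have "\<dots> \<le> B\<^sup>2 / 4 * p + \<delta> * 1"
    using \<delta> by (intro add_left_mono mult_left_mono) (auto simp: divide_le_eq_1 add_nonneg_pos)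
  finally have le: "1 / 4 * (LINT x|\<mu>. (b x)\<^sup>2 / a x) - B\<^sup>2 / 4 * p \<le> energy a b \<mu> \<psi> + \<delta>" unfolding en by simp
  have "ennreal (B\<^sup>2) / resistance a \<mu> = ennreal (B\<^sup>2) * (1 / resistance a \<mu>)"
    by (simp add: ennreal_times_divide)
  also have "\<dots> = ennreal (B\<^sup>2 * p)" unfolding p(1) using p(2) by (simp add: ennreal_mult)
  finally have "J_minus1 a b \<mu> = ereal (1 / 4 * (LINT x|\<mu>. (b x)\<^sup>2 / a x) - B\<^sup>2 / 4 * p)"
    unfolding J_minus1_resistance B_def[symmetric] using p(2) by simp
  with le show thesis using that[OF \<psi> zero] by simp
qed

section \<open>The lower bound of the Gamma-convergence\<close>

lemma C1_torus_antiderivative: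
  assumes "\<psi> \<in> C1_torus" "(LINT x|torus. \<psi> x) = 0"
  obtains \<phi> where "periodic1 \<phi>" "\<And>x. (\<phi> has_real_derivative \<psi> x) (at x)"
proof -
  note cont = C1_torus_continuous[OF assms(1)]
  obtain \<phi> where \<phi>: "\<And>x. (\<phi> has_real_derivative \<psi> x) (at x)"
    using continuous_antiderivative[OF cont] by metis
  have "((\<lambda>x. \<phi> (x + 1) - \<phi> x) has_real_derivative 0) (at x)" for x
  proof -
    have "((\<lambda>x. \<phi> (x + 1)) has_real_derivative \<psi> (x + 1)) (at x)" using \<phi>[of "x + 1"] by (simp add: DERIV_shift)
    from DERIV_diff[OF this \<phi>[of x]] show ?thesis using C1_torus_periodic1[OF assms(1)] by (simp add: periodic1_def)
  qed
  then have "\<phi> (x + 1) - \<phi> x = \<phi> (0 + 1) - \<phi> 0" for x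
    using DERIV_isconst_all[of "\<lambda>x. \<phi> (x + 1) - \<phi> x" x 0] by blast
  then have "periodic1 \<phi>" using torus_FTC[OF \<phi> cont] assms(2) by (simp add: periodic1_def)
  then show thesis using that \<phi> by blast
qed

text \<open>The test function is \<open>u = exp (\<phi> / \<epsilon>)\<close>; mean zero of \<open>\<psi>\<close> is what makes its antiderivative \<open>\<phi>\<close>,
  and with it \<open>u\<close>, periodic.\<close>

lemma DV_rate_lower_bound:
  assumes \<mu>: "\<mu> \<in> prob_torus" and \<epsilon>: "\<epsilon> > 0" and a: "a \<in> C1_torus" and b: "b \<in> C1_torus"
    and \<psi>: "\<psi> \<in> C1_torus" "(LINT x|torus. \<psi> x) = 0"
    and \<psi>': "\<And>x. (\<psi> has_real_derivative \<psi>' x) (at x)" "continuous_on UNIV \<psi>'"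
  shows "ereal (energy a b \<mu> \<psi> - \<epsilon> * (LINT x|\<mu>. a x * \<psi>' x)) \<le> ereal \<epsilon> * DV_rate a b \<epsilon> \<mu>"
proof -
  obtain \<phi> where \<phi>: "periodic1 \<phi>" "\<And>x. (\<phi> has_real_derivative \<psi> x) (at x)"
    using C1_torus_antiderivative[OF \<psi>] by metis
  define u where "u x = exp (\<phi> x / \<epsilon>)" for x
  have u': "(u has_real_derivative u x * \<psi> x / \<epsilon>) (at x)" for x
    unfolding u_def using \<epsilon> by (auto intro!: derivative_eq_intros \<phi>(2))
  have u'': "((\<lambda>x. u x * \<psi> x / \<epsilon>) has_real_derivative (u x * \<psi> x / \<epsilon> * \<psi> x + u x * \<psi>' x) / \<epsilon>) (at x)" for x
    using \<epsilon> by (auto intro!: derivative_eq_intros u' \<psi>' simp: field_simps)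
  have cont: "continuous_on UNIV u" "continuous_on UNIV \<psi>" "continuous_on UNIV a" "continuous_on UNIV b"
    using u' \<psi>' C1_torus_continuous a b by (metis DERIV_isCont continuous_at_imp_continuous_on)+
  have per: "periodic1 u" using \<phi>(1) by (simp add: periodic1_def u_def)
  have "continuous_on UNIV (\<lambda>x. (u x * \<psi> x / \<epsilon> * \<psi> x + u x * \<psi>' x) / \<epsilon>)"
    using \<epsilon> by (intro continuous_intros cont \<psi>'(2)) auto
  note C2 = C2_torusI[OF per u' u'' this]
  have pos: "u x > 0" for x by (simp add: u_def)
  have gen: "generator a b \<epsilon> u x / u x = 1 / \<epsilon> * (b x * \<psi> x + a x * (\<psi> x)\<^sup>2) + a x * \<psi>' x" for x
    unfolding generator_def C2(3) unfolding C2(2) using pos[of x] \<epsilon>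
    by (simp add: field_simps power2_eq_square)
  have per': "periodic1 \<psi>'" by (rule periodic1_deriv[OF C1_torus_periodic1[OF \<psi>(1)] \<psi>'(1)])
  note pers = C1_torus_periodic1[OF a] C1_torus_periodic1[OF b] C1_torus_periodic1[OF \<psi>(1)] per'
  have i1: "integrable \<mu> (\<lambda>x. b x * \<psi> x + a x * (\<psi> x)\<^sup>2)" "integrable \<mu> (\<lambda>x. a x * \<psi>' x)"
    using pers by (auto intro!: continuous_torus_integrable[OF \<mu>] continuous_intros cont \<psi>'(2) simp: periodic1_def)
  have "(LINT x|\<mu>. generator a b \<epsilon> u x / u x) = 1 / \<epsilon> * (LINT x|\<mu>. b x * \<psi> x + a x * (\<psi> x)\<^sup>2) + (LINT x|\<mu>. a x * \<psi>' x)"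
    unfolding gen Bochner_Integration.integral_add[OF integrable_mult_right[OF i1(1), of "1 / \<epsilon>"] i1(2)]
    by (simp only: integral_mult_right_zero)
  then have "\<epsilon> * (- (LINT x|\<mu>. generator a b \<epsilon> u x / u x)) = energy a b \<mu> \<psi> - \<epsilon> * (LINT x|\<mu>. a x * \<psi>' x)"
    using \<epsilon> by (simp add: energy_def algebra_simps)
  moreover have "ereal (- (LINT x|\<mu>. generator a b \<epsilon> u x / u x)) \<le> DV_rate a b \<epsilon> \<mu>"
    unfolding DV_rate_def using C2(1) pos by (intro SUP_upper) auto
  then have "ereal \<epsilon> * ereal (- (LINT x|\<mu>. generator a b \<epsilon> u x / u x)) \<le> ereal \<epsilon> * DV_rate a b \<epsilon> \<mu>"
    using \<epsilon> by (intro ereal_mult_left_mono) auto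
  ultimately show ?thesis by simp
qed

lemma DV_rate_nonneg:
  assumes "\<mu> \<in> prob_torus" "\<epsilon> > 0" "a \<in> C1_torus" "b \<in> C1_torus"
  shows "0 \<le> DV_rate a b \<epsilon> \<mu>"
proof -
  have "(\<lambda>_. 1) \<in> C2_torus" "deriv (\<lambda>_::real. 1::real) = (\<lambda>_. 0)" "deriv (deriv (\<lambda>_::real. 1::real)) = (\<lambda>_. 0)"
    by (auto intro!: C2_torusI[where f' = "\<lambda>_. 0" and f'' = "\<lambda>_. 0"] simp: periodic1_def)
  then show ?thesis unfolding DV_rate_def
    by (intro SUP_upper2[of "\<lambda>_. 1"]) (auto simp: generator_def)
qed

text \<open>Fix a smooth \<open>\<psi>\<close> whose energy for \<open>\<mu>\<close> is within \<open>\<delta>\<close> of \<open>J_minus1\<close> and test every \<open>\<mu>s \<epsilon>\<close> with it: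
  the energy is weakly continuous, and \<open>\<epsilon> \<integral> a \<psi>' d\<mu>s\<close> tends to \<open>0\<close>.\<close>

lemma Gamma_liminf:
  assumes \<mu>: "\<mu> \<in> prob_torus" and a: "a \<in> C1_torus" "\<And>x. a x > 0" and b: "b \<in> C1_torus"
    and \<mu>s: "\<And>\<epsilon>. \<epsilon> > 0 \<Longrightarrow> \<mu>s \<epsilon> \<in> prob_torus" "weak_conv_torus \<mu>s (at_right 0) \<mu>"
  shows "J_minus1 a b \<mu> \<le> Liminf (at_right 0) (\<lambda>\<epsilon>. ereal \<epsilon> * DV_rate a b \<epsilon> (\<mu>s \<epsilon>))"
    (is "_ \<le> ?L")
proof (rule ereal_le_epsilon2)
  fix \<delta> :: real assume "\<delta> > 0"
  then obtain \<psi> where \<psi>: "\<psi> \<in> C1_torus" "(LINT x|torus. \<psi> x) = 0" "J_minus1 a b \<mu> \<le> ereal (energy a b \<mu> \<psi> + \<delta>)"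
    using J_minus1_approximated[OF \<mu> a b] by metis
  obtain \<psi>' where \<psi>': "\<And>x. (\<psi> has_real_derivative \<psi>' x) (at x)" "continuous_on UNIV \<psi>'" "periodic1 \<psi>'"
    using C1_torusE[OF \<psi>(1)] by metis
  note cont = C1_torus_continuous[OF a(1)] C1_torus_continuous[OF b] C1_torus_continuous[OF \<psi>(1)]
  note per = C1_torus_periodic1[OF a(1)] C1_torus_periodic1[OF b] C1_torus_periodic1[OF \<psi>(1)]
  have c1: "continuous_on UNIV (\<lambda>x. b x * \<psi> x + a x * (\<psi> x)\<^sup>2)" by (intro continuous_intros cont)
  have p1: "periodic1 (\<lambda>x. b x * \<psi> x + a x * (\<psi> x)\<^sup>2)" using per by (simp add: periodic1_def)
  have c2: "continuous_on UNIV (\<lambda>x. a x * \<psi>' x)" by (intro continuous_intros cont \<psi>')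
  have p2: "periodic1 (\<lambda>x. a x * \<psi>' x)" using per \<psi>'(3) by (simp add: periodic1_def)
  have "((\<lambda>\<epsilon>. energy a b (\<mu>s \<epsilon>) \<psi> - \<epsilon> * (LINT x|\<mu>s \<epsilon>. a x * \<psi>' x)) \<longlongrightarrow> energy a b \<mu> \<psi> - 0 * (LINT x|\<mu>. a x * \<psi>' x)) (at_right 0)"
    using \<mu>s(2) c1 p1 c2 p2 unfolding energy_def weak_conv_torus_def by (intro tendsto_intros) auto
  then have "((\<lambda>\<epsilon>. ereal (energy a b (\<mu>s \<epsilon>) \<psi> - \<epsilon> * (LINT x|\<mu>s \<epsilon>. a x * \<psi>' x))) \<longlongrightarrow> ereal (energy a b \<mu> \<psi>)) (at_right 0)"
    by simp
  then have "ereal (energy a b \<mu> \<psi>) = Liminf (at_right 0) (\<lambda>\<epsilon>. ereal (energy a b (\<mu>s \<epsilon>) \<psi> - \<epsilon> * (LINT x|\<mu>s \<epsilon>. a x * \<psi>' x)))"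
    by (intro lim_imp_Liminf[symmetric]) auto
  also have "\<dots> \<le> ?L"
    using eventually_at_right_less[of "0::real"]
    by (intro Liminf_mono, eventually_elim) (intro DV_rate_lower_bound \<mu>s(1) a(1) b \<psi> \<psi>')
  finally have "ereal (energy a b \<mu> \<psi>) + ereal \<delta> \<le> ?L + ereal \<delta>" by (rule add_right_mono)
  then show "J_minus1 a b \<mu> \<le> ?L + ereal \<delta>" using \<psi>(3) by simp
qed

section \<open>A local energy estimate\<close>

text \<open>A Jensen inequality with errors.  The measure \<open>K\<close> stands for a smoothing kernel concentrated
  near \<open>y\<close>, and \<open>\<eta> \<bar>\<psi>\<bar>\<close> for the cost of the second-order term.  No bound on \<open>\<psi>\<close> may enter, so all the
  errors linear in \<open>\<psi>\<close> are absorbed, by Young's inequality, into a fraction \<open>\<theta>\<close> of \<open>a \<psi>\<^sup>2\<close>; the rest of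
  \<open>a \<psi>\<^sup>2\<close> is bounded from below by \<open>2 t \<psi> - t\<^sup>2 / a\<close>.  The choice \<open>t = a y * p\<close> makes the average of
  this nearly \<open>a y * p\<^sup>2\<close>, using only that \<open>1 / a\<close> is close to \<open>1 / a y\<close> on average.\<close>

lemma local_energy_bound:
  fixes K :: "real measure" and y :: real
  assumes K: "K \<in> prob_torus"
    and a: "continuous_on UNIV a" "periodic1 a" "\<And>x. c \<le> a x" "0 < c" "\<And>x. a x \<le> A"
    and b: "continuous_on UNIV b" "periodic1 b" "\<And>x. \<bar>b x\<bar> \<le> B"
    and \<psi>: "continuous_on UNIV \<psi>" "periodic1 \<psi>"
    and \<theta>: "0 < \<theta>" "\<theta> < 1" and \<eta>: "0 \<le> \<eta>"
    and cb: "(LINT x|K. \<bar>b x - b y\<bar>) \<le> \<eta>" and ca: "(LINT x|K. \<bar>1 / a x - 1 / a y\<bar>) \<le> \<eta>"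
  defines "p \<equiv> (LINT x|K. \<psi> x)"
  shows "- (LINT x|K. b x * \<psi> x + a x * (\<psi> x)\<^sup>2) + \<eta> * (LINT x|K. \<bar>\<psi> x\<bar>)
    \<le> - (b y * p + (1 - \<theta>) * (1 - A * \<eta>) * a y * p\<^sup>2) + (4 * B * \<eta> + 2 * \<eta>\<^sup>2) / (4 * \<theta> * c)"
proof -
  interpret K: prob_space K by (rule prob_torusD[OF K])
  have apos: "a x > 0" for x using a(3)[of x] a(4) by linarith
  have a0: "a x \<noteq> 0" for x using apos[of x] by simp
  have B0: "B \<ge> 0" using b(3)[of 0] by linarith
  have int: "integrable K f" if "continuous_on UNIV f" "\<And>x. f (x + 1) = f x" for f :: "real \<Rightarrow> real"
    using continuous_torus_integrable[OF K] that unfolding periodic1_def by blast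
  note per = a(2)[unfolded periodic1_def, rule_format] b(2)[unfolded periodic1_def, rule_format] \<psi>(2)[unfolded periodic1_def, rule_format]
  note cont = a(1) b(1) \<psi>(1)
  have i1: "integrable K (\<lambda>x. b x * \<psi> x + a x * (\<psi> x)\<^sup>2)" by (intro int continuous_intros cont) (simp_all add: per)
  have i2: "integrable K (\<lambda>x. \<bar>\<psi> x\<bar>)" by (intro int continuous_intros cont) (simp_all add: per)
  have i3: "integrable K \<psi>" by (intro int continuous_intros cont) (simp_all add: per)
  have i4: "integrable K (\<lambda>x. 1 / a x)" using a0 by (intro int continuous_intros cont) (simp_all add: per)
  have i5: "integrable K (\<lambda>x. \<bar>b x - b y\<bar>)" by (intro int continuous_intros cont) (simp_all add: per)
  have i6: "integrable K (\<lambda>x. \<bar>1 / a x - 1 / a y\<bar>)" using a0 by (intro int continuous_intros cont) (simp_all add: per)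
  define t where "t = a y * p"
  define r where "r = 1 / (4 * \<theta> * c)"
  have r: "r > 0" using \<theta>(1) a(4) by (simp add: r_def)
  have pt: "- (b x * \<psi> x + a x * (\<psi> x)\<^sup>2) + \<eta> * \<bar>\<psi> x\<bar>
      \<le> - b y * \<psi> x - (1 - \<theta>) * (2 * t * \<psi> x - t\<^sup>2 * (1 / a x)) + (4 * B * \<bar>b x - b y\<bar> + 2 * \<eta>\<^sup>2) * r" for x
  proof -
    define w where "w = \<bar>b x - b y\<bar> + \<eta>"
    have "- (b x - b y) * \<psi> x \<le> \<bar>b x - b y\<bar> * \<bar>\<psi> x\<bar>" by (metis abs_ge_self abs_minus_cancel abs_mult)
    then have 1: "- b x * \<psi> x + \<eta> * \<bar>\<psi> x\<bar> \<le> - b y * \<psi> x + w * \<bar>\<psi> x\<bar>"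
      unfolding w_def by (simp add: algebra_simps)
    have 2: "w * \<bar>\<psi> x\<bar> \<le> \<theta> * (a x * (\<psi> x)\<^sup>2) + w\<^sup>2 * r"
    proof -
      have "0 \<le> (2 * \<theta> * c * \<bar>\<psi> x\<bar> - w)\<^sup>2 * r" using r by simp
      also have "\<dots> = \<theta> * (c * (\<psi> x)\<^sup>2) + w\<^sup>2 * r - w * \<bar>\<psi> x\<bar>"
      proof -
        have "(2 * q * z - w)\<^sup>2 * (1 / (4 * q)) = q * z\<^sup>2 + w\<^sup>2 * (1 / (4 * q)) - w * z" if "q > 0" for q z :: real
          using that by (simp add: power2_eq_square field_simps)
        from this[of "\<theta> * c" "\<bar>\<psi> x\<bar>"] show ?thesis using \<theta>(1) a(4) by (simp add: r_def mult.assoc)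
      qed
      finally have "w * \<bar>\<psi> x\<bar> \<le> \<theta> * (c * (\<psi> x)\<^sup>2) + w\<^sup>2 * r" by simp
      moreover have "\<theta> * (c * (\<psi> x)\<^sup>2) \<le> \<theta> * (a x * (\<psi> x)\<^sup>2)"
        using \<theta>(1) a(3)[of x] by (intro mult_left_mono mult_right_mono) auto
      ultimately show ?thesis by linarith
    qed
    have 3: "w\<^sup>2 * r \<le> (4 * B * \<bar>b x - b y\<bar> + 2 * \<eta>\<^sup>2) * r"
    proof -
      have "w\<^sup>2 \<le> 2 * \<bar>b x - b y\<bar>\<^sup>2 + 2 * \<eta>\<^sup>2"
        unfolding w_def using zero_le_power2[of "\<bar>b x - b y\<bar> - \<eta>"] by (simp only: power2_sum power2_diff)
      moreover have "\<bar>b x - b y\<bar> * \<bar>b x - b y\<bar> \<le> (2 * B) * \<bar>b x - b y\<bar>"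
        using b(3)[of x] b(3)[of y] by (intro mult_right_mono) auto
      ultimately have "w\<^sup>2 \<le> 4 * B * \<bar>b x - b y\<bar> + 2 * \<eta>\<^sup>2" by (simp add: power2_eq_square)
      then show ?thesis using r by (intro mult_right_mono) auto
    qed
    have 4: "2 * t * \<psi> x - t\<^sup>2 * (1 / a x) \<le> a x * (\<psi> x)\<^sup>2"
    proof -
      have "0 \<le> (a x * \<psi> x - t)\<^sup>2 / a x" using apos[of x] by simp
      also have "\<dots> = a x * (\<psi> x)\<^sup>2 - (2 * t * \<psi> x - t\<^sup>2 * (1 / a x))"
        using apos[of x] by (simp add: power2_eq_square field_simps)
      finally show ?thesis by simp
    qed
    have "(1 - \<theta>) * (2 * t * \<psi> x - t\<^sup>2 * (1 / a x)) \<le> (1 - \<theta>) * (a x * (\<psi> x)\<^sup>2)"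
      using 4 \<theta>(2) by (intro mult_left_mono) auto
    then have "(1 - \<theta>) * (2 * t * \<psi> x - t\<^sup>2 * (1 / a x)) \<le> a x * (\<psi> x)\<^sup>2 - \<theta> * (a x * (\<psi> x)\<^sup>2)"
      by (simp only: left_diff_distrib mult_1)
    with 1 2 3 show ?thesis by linarith
  qed
  have "(LINT x|K. - (b x * \<psi> x + a x * (\<psi> x)\<^sup>2) + \<eta> * \<bar>\<psi> x\<bar>)
    \<le> (LINT x|K. - b y * \<psi> x - (1 - \<theta>) * (2 * t * \<psi> x - t\<^sup>2 * (1 / a x)) + (4 * B * \<bar>b x - b y\<bar> + 2 * \<eta>\<^sup>2) * r)"
    using pt by (intro integral_mono Bochner_Integration.integrable_add Bochner_Integration.integrable_diff
      Bochner_Integration.integrable_minus integrable_mult_right integrable_mult_left i1 i2 i3 i4 i5) auto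
  also have "\<dots> = - b y * p - (1 - \<theta>) * (2 * t * p - t\<^sup>2 * (LINT x|K. 1 / a x)) + (4 * B * (LINT x|K. \<bar>b x - b y\<bar>) + 2 * \<eta>\<^sup>2) * r"
  proof -
    have lin: "(LINT x|K. k * f x - d * (e * f x - q * g x) + (u * h x + l) * r)
        = k * (LINT x|K. f x) - d * (e * (LINT x|K. f x) - q * (LINT x|K. g x)) + (u * (LINT x|K. h x) + l) * r"
      if "integrable K f" "integrable K g" "integrable K h" for f g h :: "real \<Rightarrow> real" and k d e q u l
      using that by (simp add: K.prob_space)
    show ?thesis unfolding p_def by (rule lin[OF i3 i4 i5])
  qed
  also have "\<dots> \<le> - b y * p - (1 - \<theta>) * (2 * t * p - t\<^sup>2 * (1 / a y + \<eta>)) + (4 * B * \<eta> + 2 * \<eta>\<^sup>2) * r"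
  proof -
    have "(LINT x|K. 1 / a x) - 1 / a y = (LINT x|K. 1 / a x - 1 / a y)"
      using i4 by (simp add: K.prob_space)
    also have "\<dots> \<le> (LINT x|K. \<bar>1 / a x - 1 / a y\<bar>)"
      using i4 i6 by (intro integral_mono) auto
    finally have "(LINT x|K. 1 / a x) \<le> 1 / a y + \<eta>" using ca by linarith
    then have "t\<^sup>2 * (LINT x|K. 1 / a x) \<le> t\<^sup>2 * (1 / a y + \<eta>)" by (rule mult_left_mono) simp
    then have "(1 - \<theta>) * (2 * t * p - t\<^sup>2 * (1 / a y + \<eta>)) \<le> (1 - \<theta>) * (2 * t * p - t\<^sup>2 * (LINT x|K. 1 / a x))"
      using \<theta>(2) by (intro mult_left_mono) auto
    moreover have "(4 * B * (LINT x|K. \<bar>b x - b y\<bar>) + 2 * \<eta>\<^sup>2) * r \<le> (4 * B * \<eta> + 2 * \<eta>\<^sup>2) * r"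
      using cb B0 r by (intro mult_right_mono add_right_mono mult_left_mono) auto
    ultimately show ?thesis by linarith
  qed
  also have "2 * t * p - t\<^sup>2 * (1 / a y + \<eta>) = (1 - a y * \<eta>) * (a y * p\<^sup>2)"
    using a0[of y] by (simp add: t_def power2_eq_square field_simps)
  also have "- b y * p - (1 - \<theta>) * ((1 - a y * \<eta>) * (a y * p\<^sup>2)) + (4 * B * \<eta> + 2 * \<eta>\<^sup>2) * r
    \<le> - b y * p - (1 - \<theta>) * ((1 - A * \<eta>) * (a y * p\<^sup>2)) + (4 * B * \<eta> + 2 * \<eta>\<^sup>2) * r"
  proof -
    have "(1 - \<theta>) * ((1 - A * \<eta>) * (a y * p\<^sup>2)) \<le> (1 - \<theta>) * ((1 - a y * \<eta>) * (a y * p\<^sup>2))"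
      using a(5)[of y] \<eta> \<theta>(2) apos[of y] by (intro mult_left_mono mult_right_mono) (auto intro: mult_right_mono)
    then show ?thesis by linarith
  qed
  finally have "(LINT x|K. - (b x * \<psi> x + a x * (\<psi> x)\<^sup>2) + \<eta> * \<bar>\<psi> x\<bar>)
    \<le> - b y * p - (1 - \<theta>) * ((1 - A * \<eta>) * (a y * p\<^sup>2)) + (4 * B * \<eta> + 2 * \<eta>\<^sup>2) * r" .
  moreover have "(LINT x|K. - (b x * \<psi> x + a x * (\<psi> x)\<^sup>2) + \<eta> * \<bar>\<psi> x\<bar>)
    = - (LINT x|K. b x * \<psi> x + a x * (\<psi> x)\<^sup>2) + \<eta> * (LINT x|K. \<bar>\<psi> x\<bar>)"
    using Bochner_Integration.integral_add[OF Bochner_Integration.integrable_minus[OF i1] integrable_mult_right[OF i2, of \<eta>]]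
    by (simp only: integral_mult_right_zero Bochner_Integration.integral_minus)
  ultimately show ?thesis by (simp add: r_def mult.assoc)
qed

section \<open>The smoothing kernel\<close>

text \<open>Near \<open>0\<close> this is comparable to \<open>1 / (\<sigma>\<^sup>2 + z\<^sup>2)\<close>, a Cauchy density up to a factor, made periodic.
  Two properties single it out: its logarithmic derivative is bounded, which fails for compactly
  supported kernels, and \<open>kern \<sigma> z * (1 - cos (2 \<pi> z)) \<le> 1\<close>, which bounds the mass away from \<open>0\<close> without
  any computation.\<close>

definition kern :: "real \<Rightarrow> real \<Rightarrow> real" where
  "kern \<sigma> z = 1 / (\<sigma>\<^sup>2 + (1 - cos (2 * pi * z)))"

definition kern_mass :: "real \<Rightarrow> real" where
  "kern_mass \<sigma> = (LINT z|torus. kern \<sigma> z)"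

definition smoother :: "real \<Rightarrow> real \<Rightarrow> real" where
  "smoother \<sigma> z = kern \<sigma> z / kern_mass \<sigma>"

lemma kern_denom_pos: "\<sigma> > 0 \<Longrightarrow> \<sigma>\<^sup>2 + (1 - cos (2 * pi * z)) > 0"
  by (intro add_pos_nonneg) auto

lemma kern_pos: "\<sigma> > 0 \<Longrightarrow> kern \<sigma> z > 0"
  using kern_denom_pos[of \<sigma> z] by (simp add: kern_def)

lemma kern_le: "\<sigma> > 0 \<Longrightarrow> kern \<sigma> z \<le> 1 / \<sigma>\<^sup>2"
  unfolding kern_def by (intro divide_left_mono mult_pos_pos kern_denom_pos) auto

lemma cos_2pi_period: "cos (2 * pi * (z + 1)) = cos (2 * pi * z)" "sin (2 * pi * (z + 1)) = sin (2 * pi * z)"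
  by (simp_all add: distrib_left)

lemma kern_periodic: "periodic1 (kern \<sigma>)"
  by (simp add: periodic1_def kern_def cos_2pi_period)

lemma kern_even: "kern \<sigma> (- z) = kern \<sigma> z"
  by (simp add: kern_def)

lemma kern_deriv:
  assumes "\<sigma> > 0"
  shows "(kern \<sigma> has_real_derivative - (2 * pi * sin (2 * pi * z)) * (kern \<sigma> z)\<^sup>2) (at z)"
  unfolding kern_def using kern_denom_pos[OF assms, of z]
  by (auto intro!: derivative_eq_intros simp: power2_eq_square)

lemma kern_continuous: "\<sigma> > 0 \<Longrightarrow> continuous_on UNIV (kern \<sigma>)"
  using kern_deriv by (metis DERIV_isCont continuous_at_imp_continuous_on)

lemma kern_log_deriv_bound:
  assumes "\<sigma> > 0"
  shows "\<bar>- (2 * pi * sin (2 * pi * z)) * (kern \<sigma> z)\<^sup>2\<bar> \<le> 2 * pi / \<sigma>\<^sup>2 * kern \<sigma> z"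
proof -
  have "\<bar>- (2 * pi * sin (2 * pi * z)) * (kern \<sigma> z)\<^sup>2\<bar> = (2 * pi * \<bar>sin (2 * pi * z)\<bar>) * (kern \<sigma> z * kern \<sigma> z)"
    by (simp add: abs_mult power2_eq_square)
  also have "\<dots> \<le> (2 * pi * 1) * (1 / \<sigma>\<^sup>2 * kern \<sigma> z)"
    using kern_le[OF assms, of z] kern_pos[OF assms, of z]
    by (intro mult_mono) auto
  finally show ?thesis by simp
qed

text \<open>Comparison with \<open>1 / (\<sigma>\<^sup>2 + z\<^sup>2)\<close>, whose antiderivative is \<open>arctan (z / \<sigma>) / \<sigma>\<close>.  Since the mass blows
  up as \<open>\<sigma> \<rightarrow> 0\<close>, the normalised kernel concentrates at \<open>0\<close>.\<close>

lemma kern_mass_lower_bound: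
  assumes "0 < \<sigma>" "\<sigma> \<le> 1"
  shows "kern_mass \<sigma> \<ge> 1 / (8 * pi * \<sigma>)"
proof -
  have d: "\<sigma>\<^sup>2 + z\<^sup>2 > 0" for z :: real using assms by (intro add_pos_nonneg) auto
  have d0: "\<sigma>\<^sup>2 + z\<^sup>2 \<noteq> 0" for z :: real using d[of z] by (metis less_irrefl)
  have F: "((\<lambda>z. arctan (z / \<sigma>) / (2 * pi\<^sup>2 * \<sigma>)) has_real_derivative 1 / (2 * pi\<^sup>2 * (\<sigma>\<^sup>2 + z\<^sup>2))) (at z)" for z
  proof -
    have "inverse (1 + (z / \<sigma>)\<^sup>2) * (1 / \<sigma>) / (2 * pi\<^sup>2 * \<sigma>) = 1 / (2 * pi\<^sup>2 * (\<sigma>\<^sup>2 + z\<^sup>2))"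
    proof -
      have "1 + (z / \<sigma>)\<^sup>2 = (\<sigma>\<^sup>2 + z\<^sup>2) / \<sigma>\<^sup>2" using assms by (simp add: power_divide add_divide_distrib)
      then have "inverse (1 + (z / \<sigma>)\<^sup>2) = \<sigma>\<^sup>2 / (\<sigma>\<^sup>2 + z\<^sup>2)" by simp
      then show ?thesis using assms by (simp add: power2_eq_square)
    qed
    moreover have "((\<lambda>z. arctan (z / \<sigma>) / (2 * pi\<^sup>2 * \<sigma>)) has_real_derivative
        inverse (1 + (z / \<sigma>)\<^sup>2) * (1 / \<sigma>) / (2 * pi\<^sup>2 * \<sigma>)) (at z)"
      using assms by (auto intro!: derivative_eq_intros)
    ultimately show ?thesis by (simp only:)
  qed
  have c: "continuous_on UNIV (\<lambda>z. 1 / (2 * pi\<^sup>2 * (\<sigma>\<^sup>2 + z\<^sup>2)))" using d0 by (intro continuous_intros) auto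
  have bd: "\<bar>1 / (2 * pi\<^sup>2 * (\<sigma>\<^sup>2 + z\<^sup>2))\<bar> \<le> 1 / (2 * pi\<^sup>2 * \<sigma>\<^sup>2)" for z
    using d[of z] assms by (auto intro!: divide_left_mono mult_left_mono mult_pos_pos simp: abs_mult)
  have le: "1 / (2 * pi\<^sup>2 * (\<sigma>\<^sup>2 + z\<^sup>2)) \<le> kern \<sigma> z" for z
  proof -
    have "1 - cos (2 * pi * z) = 2 * (sin (pi * z))\<^sup>2" using cos_double_sin[of "pi * z"] by (simp add: mult.assoc)
    also have "(sin (pi * z))\<^sup>2 \<le> (pi * z)\<^sup>2"
      using abs_sin_x_le_abs_x[of "pi * z"] by (simp add: abs_le_square_iff)
    finally have "1 - cos (2 * pi * z) \<le> 2 * pi\<^sup>2 * z\<^sup>2" by (simp add: power_mult_distrib)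
    moreover have "1 * \<sigma>\<^sup>2 \<le> 2 * pi\<^sup>2 * \<sigma>\<^sup>2"
    proof (rule mult_right_mono)
      have "1 \<le> pi\<^sup>2" using pi_gt3 by (intro one_le_power) simp
      then show "1 \<le> 2 * pi\<^sup>2" by simp
    qed simp
    ultimately have "\<sigma>\<^sup>2 + (1 - cos (2 * pi * z)) \<le> 2 * pi\<^sup>2 * (\<sigma>\<^sup>2 + z\<^sup>2)" by (simp add: distrib_left)
    then show ?thesis unfolding kern_def using kern_denom_pos[OF assms(1), of z] d[of z]
      by (intro divide_left_mono mult_pos_pos) auto
  qed
  have "pi / 4 \<le> arctan (1 / \<sigma>)"
    using assms unfolding arctan_one[symmetric] by (intro arctan_monotone') simp
  then have "(pi / 4) / (2 * pi\<^sup>2 * \<sigma>) \<le> arctan (1 / \<sigma>) / (2 * pi\<^sup>2 * \<sigma>)"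
    using assms by (intro divide_right_mono) auto
  also have "\<dots> = (LINT z|torus. 1 / (2 * pi\<^sup>2 * (\<sigma>\<^sup>2 + z\<^sup>2)))"
    using torus_FTC[OF F c] by simp
  also have "\<dots> \<le> kern_mass \<sigma>"
    unfolding kern_mass_def
    using le integrable_torus_bounded[OF torus_in_prob_torus continuous_borel_measurable_torus[OF c] bd]
      continuous_torus_integrable[OF torus_in_prob_torus kern_periodic kern_continuous[OF assms(1)]]
    by (intro integral_mono) auto
  finally show ?thesis by (simp add: power2_eq_square)
qed

lemma kern_mass_pos: "\<sigma> > 0 \<Longrightarrow> kern_mass \<sigma> > 0"
proof -
  assume "\<sigma> > 0"
  have "1 / (\<sigma>\<^sup>2 + 2) = (LINT z|torus. 1 / (\<sigma>\<^sup>2 + 2))" by simp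
  also have "\<dots> \<le> kern_mass \<sigma>"
    unfolding kern_mass_def
  proof (rule integral_mono)
    fix z
    have "cos (2 * pi * z) \<ge> -1" by simp
    then show "1 / (\<sigma>\<^sup>2 + 2) \<le> kern \<sigma> z"
      unfolding kern_def using kern_denom_pos[OF \<open>\<sigma> > 0\<close>, of z] by (intro divide_left_mono mult_pos_pos) (auto intro: add_nonneg_pos)
  qed (use continuous_torus_integrable[OF torus_in_prob_torus kern_periodic kern_continuous[OF \<open>\<sigma> > 0\<close>]] in auto)
  finally show ?thesis using add_nonneg_pos[of "\<sigma>\<^sup>2" 2] by (meson less_le_trans zero_le_power2 zero_less_divide_1_iff zero_less_numeral)
qed

text \<open>The integral over a period, as a function of the starting point, has derivative \<open>0\<close>.\<close>

lemma torus_integral_translate: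
  fixes f :: "real \<Rightarrow> real"
  assumes "periodic1 f" "continuous_on UNIV f"
  shows "(LINT x|torus. f (x + c)) = (LINT x|torus. f x)"
proof -
  obtain F where F: "\<And>x. (F has_real_derivative f x) (at x)"
    using continuous_antiderivative[OF assms(2)] by metis
  have sh: "((\<lambda>x. F (x + d)) has_real_derivative f (x + d)) (at x)" for x d
    using F[of "x + d"] by (simp add: DERIV_shift)
  have "(LINT x|torus. f (x + c)) = F (1 + c) - F (0 + c)"
    using assms(2) by (intro torus_FTC sh) (auto intro!: continuous_on_compose2[OF assms(2)] continuous_intros)
  moreover have "(LINT x|torus. f x) = F 1 - F 0" by (rule torus_FTC[OF F assms(2)])
  moreover have "((\<lambda>x. F (x + 1) - F x) has_real_derivative 0) (at x)" for x
    using DERIV_diff[OF sh[of 1 x] F[of x]] assms(1) by (simp add: periodic1_def)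
  then have "F (c + 1) - F c = F (0 + 1) - F 0"
    using DERIV_isconst_all[of "\<lambda>x. F (x + 1) - F x" c 0] by blast
  ultimately show ?thesis by (simp add: add.commute)
qed

lemma smoother_integral:
  assumes "\<sigma> > 0"
  shows "(LINT x|torus. smoother \<sigma> (x - y)) = 1" "(LINT y|torus. smoother \<sigma> (x - y)) = 1"
proof -
  note k = torus_integral_translate[OF kern_periodic kern_continuous[OF assms]]
  show "(LINT x|torus. smoother \<sigma> (x - y)) = 1"
    unfolding smoother_def using k[of "- y"] kern_mass_pos[OF assms] by (simp add: kern_mass_def)
  have "kern \<sigma> (x - y) = kern \<sigma> (y + (- x))" for y using kern_even[of \<sigma> "x - y"] by simp
  then show "(LINT y|torus. smoother \<sigma> (x - y)) = 1"
    unfolding smoother_def using k[of "- x"] kern_mass_pos[OF assms] by (simp add: kern_mass_def)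
qed

section \<open>Smoothing a measure\<close>

lemma smoother_pos: "\<sigma> > 0 \<Longrightarrow> smoother \<sigma> z > 0"
  by (simp add: smoother_def kern_pos kern_mass_pos)

lemma smoother_continuous: "\<sigma> > 0 \<Longrightarrow> continuous_on UNIV (smoother \<sigma>)"
  unfolding smoother_def using kern_mass_pos[of \<sigma>] by (intro continuous_intros kern_continuous) auto

lemma smoother_periodic: "smoother \<sigma> (z + 1) = smoother \<sigma> z"
  using kern_periodic[of \<sigma>] by (simp add: smoother_def periodic1_def)

lemma smoother_le:
  assumes "\<sigma> > 0" shows "\<bar>smoother \<sigma> z\<bar> \<le> 1 / \<sigma>\<^sup>2 / kern_mass \<sigma>"
  unfolding abs_of_pos[OF smoother_pos[OF assms, of z]]
  unfolding smoother_def using kern_le[OF assms, of z] kern_mass_pos[OF assms] by (intro divide_right_mono) auto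

lemma smoother_translate_continuous:
  assumes "\<sigma> > 0" shows "continuous_on UNIV (\<lambda>x. smoother \<sigma> (x - y))"
  using smoother_continuous[OF assms] by (auto intro!: continuous_on_compose2[of UNIV "smoother \<sigma>"] continuous_intros)

lemma density_prob_torus:
  assumes "integrable torus g" "\<And>x. 0 \<le> g x" "(LINT x|torus. g x) = 1"
  shows "density torus (\<lambda>x. ennreal (g x)) \<in> prob_torus"
proof -
  note [measurable] = borel_measurable_integrable[OF assms(1)]
  have "emeasure (density torus (\<lambda>x. ennreal (g x))) (space torus) = (\<integral>\<^sup>+x. ennreal (g x) * indicator (space torus) x \<partial>torus)"
    by (rule emeasure_density) measurable
  also have "\<dots> = (\<integral>\<^sup>+x. ennreal (g x) \<partial>torus)"
    by (intro nn_integral_cong) (simp add: indicator_def)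
  also have "\<dots> = 1"
    using assms by (subst nn_integral_eq_integral) auto
  finally show ?thesis by (auto simp: prob_torus_def intro: prob_spaceI)
qed

definition kernel_at :: "real \<Rightarrow> real \<Rightarrow> real measure" where
  "kernel_at \<sigma> y = density torus (\<lambda>x. ennreal (smoother \<sigma> (x - y)))"

lemma kernel_at_integral:
  fixes f :: "real \<Rightarrow> real"
  assumes "\<sigma> > 0" "f \<in> borel_measurable torus"
  shows "(LINT x|kernel_at \<sigma> y. f x) = (LINT x|torus. smoother \<sigma> (x - y) * f x)"
  unfolding kernel_at_def
  using assms continuous_borel_measurable_torus[OF smoother_translate_continuous[OF assms(1)]]
  by (subst integral_density) (auto simp: smoother_pos less_imp_le)

lemma kernel_at_prob_torus:
  assumes "\<sigma> > 0" shows "kernel_at \<sigma> y \<in> prob_torus"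
proof -
  note [measurable] = continuous_borel_measurable_torus[OF smoother_translate_continuous[OF assms]]
  have i: "integrable torus (\<lambda>x. smoother \<sigma> (x - y))"
    using smoother_le[OF assms] by (intro integrable_torus_bounded[OF torus_in_prob_torus]) auto
  then show ?thesis unfolding kernel_at_def
    using smoother_pos[OF assms] smoother_integral(1)[OF assms] by (intro density_prob_torus) (auto simp: less_imp_le)
qed

definition smoothing :: "real \<Rightarrow> real measure \<Rightarrow> real measure" where
  "smoothing \<sigma> \<mu> = density torus (\<lambda>x. ennreal (LINT y|\<mu>. smoother \<sigma> (x - y)))"

context
  fixes \<mu> :: "real measure" and \<sigma> :: real
  assumes \<mu>: "\<mu> \<in> prob_torus" and \<sigma>: "\<sigma> > 0"
begin

lemma smoother_pair_measurable: "(\<lambda>(x, y). smoother \<sigma> (x - y)) \<in> borel_measurable (torus \<Otimes>\<^sub>M \<mu>)"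
proof -
  have 1: "(\<lambda>x::real. x) \<in> borel_measurable torus" by (rule borel_measurable_torusI) auto
  have 2: "(\<lambda>x::real. x) \<in> borel_measurable \<mu>" by (rule borel_measurable_torusI[OF prob_torusD(2)[OF \<mu>]]) auto
  have [measurable]: "smoother \<sigma> \<in> borel_measurable borel"
    by (rule borel_measurable_continuous_onI[OF smoother_continuous[OF \<sigma>]])
  have [measurable]: "fst \<in> borel_measurable (torus \<Otimes>\<^sub>M \<mu>)" "snd \<in> borel_measurable (torus \<Otimes>\<^sub>M \<mu>)"
    using measurable_compose[OF measurable_fst 1, of \<mu>] measurable_compose[OF measurable_snd 2, of torus] by simp_all
  show ?thesis unfolding case_prod_beta by measurable
qed

lemma smoother_pair_integrable:
  fixes f :: "real \<Rightarrow> real"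
  assumes "f \<in> borel_measurable torus" "\<And>x. \<bar>f x\<bar> \<le> M"
  shows "integrable (torus \<Otimes>\<^sub>M \<mu>) (\<lambda>(x, y). smoother \<sigma> (x - y) * f x)"
proof -
  interpret \<mu>: prob_space \<mu> by (rule prob_torusD[OF \<mu>])
  interpret pair_prob_space torus \<mu> ..
  show ?thesis
  proof (rule finite_measure.integrable_const_bound[where B = "1 / \<sigma>\<^sup>2 / kern_mass \<sigma> * M"])
    show "finite_measure (torus \<Otimes>\<^sub>M \<mu>)" by unfold_locales
    have "\<bar>smoother \<sigma> (x - y) * f x\<bar> \<le> 1 / \<sigma>\<^sup>2 / kern_mass \<sigma> * M" for x y
      unfolding abs_mult using smoother_le[OF \<sigma>, of "x - y"] assms(2)[of x] kern_mass_pos[OF \<sigma>]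
      by (intro mult_mono) auto
    then show "AE p in torus \<Otimes>\<^sub>M \<mu>. norm (case p of (x, y) \<Rightarrow> smoother \<sigma> (x - y) * f x) \<le> 1 / \<sigma>\<^sup>2 / kern_mass \<sigma> * M"
      by (auto simp: case_prod_beta)
    show "(\<lambda>(x, y). smoother \<sigma> (x - y) * f x) \<in> borel_measurable (torus \<Otimes>\<^sub>M \<mu>)"
      using smoother_pair_measurable measurable_compose[OF measurable_fst assms(1), of \<mu>]
      unfolding case_prod_beta by simp
  qed
qed

lemma smoothing_density_measurable: "(\<lambda>x. LINT y|\<mu>. smoother \<sigma> (x - y)) \<in> borel_measurable torus"
proof -
  interpret \<mu>: prob_space \<mu> by (rule prob_torusD[OF \<mu>])
  show ?thesis by (rule \<mu>.borel_measurable_lebesgue_integral[OF smoother_pair_measurable])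
qed

lemma smoothing_density_nonneg: "0 \<le> (LINT y|\<mu>. smoother \<sigma> (x - y))"
  using smoother_pos[OF \<sigma>] by (intro Bochner_Integration.integral_nonneg) (simp add: less_imp_le)

lemma smoothing_Fubini:
  fixes f :: "real \<Rightarrow> real"
  assumes f: "f \<in> borel_measurable torus" "\<And>x. \<bar>f x\<bar> \<le> M"
  shows "(LINT x|torus. (LINT y|\<mu>. smoother \<sigma> (x - y)) * f x) = (LINT y|\<mu>. LINT x|kernel_at \<sigma> y. f x)"
    and "integrable torus (\<lambda>x. (LINT y|\<mu>. smoother \<sigma> (x - y)) * f x)"
    and "(\<lambda>y. LINT x|kernel_at \<sigma> y. f x) \<in> borel_measurable \<mu>"
proof -
  interpret \<mu>: prob_space \<mu> by (rule prob_torusD[OF \<mu>])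
  interpret pair_prob_space torus \<mu> ..
  note i = smoother_pair_integrable[OF f]
  show "(LINT x|torus. (LINT y|\<mu>. smoother \<sigma> (x - y)) * f x) = (LINT y|\<mu>. LINT x|kernel_at \<sigma> y. f x)"
    unfolding kernel_at_integral[OF \<sigma> f(1)] using Fubini_integral[OF i] by simp
  show "integrable torus (\<lambda>x. (LINT y|\<mu>. smoother \<sigma> (x - y)) * f x)"
    using integrable_fst[OF i] by simp
  show "(\<lambda>y. LINT x|kernel_at \<sigma> y. f x) \<in> borel_measurable \<mu>"
    unfolding kernel_at_integral[OF \<sigma> f(1)] using integrable_snd[OF i] by simp
qed

lemma smoothing_integral:
  fixes f :: "real \<Rightarrow> real"
  assumes f: "f \<in> borel_measurable torus" "\<And>x. \<bar>f x\<bar> \<le> M"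
  shows "(LINT x|smoothing \<sigma> \<mu>. f x) = (LINT y|\<mu>. LINT x|kernel_at \<sigma> y. f x)"
  unfolding smoothing_def
  using f(1) smoothing_density_measurable smoothing_density_nonneg smoothing_Fubini(1)[OF f]
  by (subst integral_density) auto

lemma smoothing_prob_torus: "smoothing \<sigma> \<mu> \<in> prob_torus"
proof -
  note [measurable] = smoothing_density_measurable
  interpret \<mu>: prob_space \<mu> by (rule prob_torusD[OF \<mu>])
  have one: "(LINT x|kernel_at \<sigma> y. 1) = (1::real)" for y
  proof -
    interpret K: prob_space "kernel_at \<sigma> y" by (rule prob_torusD[OF kernel_at_prob_torus[OF \<sigma>]])
    show ?thesis by (simp add: K.prob_space)
  qed
  have "(LINT x|torus. LINT y|\<mu>. smoother \<sigma> (x - y)) = 1"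
    using smoothing_Fubini(1)[of "\<lambda>_. 1" 1] unfolding one by (simp add: \<mu>.prob_space)
  then show ?thesis unfolding smoothing_def
    using smoothing_density_nonneg smoothing_Fubini(2)[of "\<lambda>_. 1" 1] by (intro density_prob_torus) auto
qed

end

text \<open>Averaging is symmetric in the two variables of the kernel, and the kernel has mass one in
  either variable.\<close>

lemma kernel_average_mean:
  fixes f :: "real \<Rightarrow> real"
  assumes \<sigma>: "\<sigma> > 0" and f: "f \<in> borel_measurable torus" "\<And>x. \<bar>f x\<bar> \<le> M"
  shows "(LINT y|torus. LINT x|kernel_at \<sigma> y. f x) = (LINT x|torus. f x)"
  using smoothing_Fubini(1)[OF torus_in_prob_torus \<sigma> f] by (simp add: smoother_integral[OF \<sigma>])

lemma kernel_average_bound: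
  fixes f :: "real \<Rightarrow> real"
  assumes \<sigma>: "\<sigma> > 0" and f: "f \<in> borel_measurable torus" "\<And>x. \<bar>f x\<bar> \<le> M"
  shows "\<bar>LINT x|kernel_at \<sigma> y. f x\<bar> \<le> M"
proof -
  note K = kernel_at_prob_torus[OF \<sigma>, of y]
  interpret K: prob_space "kernel_at \<sigma> y" by (rule prob_torusD[OF K])
  have "\<bar>LINT x|kernel_at \<sigma> y. f x\<bar> \<le> (LINT x|kernel_at \<sigma> y. \<bar>f x\<bar>)" by (rule integral_abs_bound)
  also have "\<dots> \<le> (LINT x|kernel_at \<sigma> y. M)"
    using f(2) integrable_torus_bounded[OF K f] by (intro integral_mono) auto
  finally show ?thesis by (simp add: K.prob_space)
qed

text \<open>Uniform continuity in a form adapted to the kernel: where \<open>x - y\<close> is not close to an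
  integer, \<open>1 - cos (2 \<pi> (x - y))\<close> is bounded away from \<open>0\<close>.\<close>

lemma periodic_oscillation:
  assumes f: "periodic1 f" "continuous_on UNIV f" and \<eta>: "\<eta> > 0"
  obtains K where "K \<ge> 0" "\<And>x y. \<bar>f x - f y\<bar> \<le> \<eta> + K * (1 - cos (2 * pi * (x - y)))"
proof -
  obtain M where M: "M > 0" "\<And>x. \<bar>f x\<bar> \<le> M" using periodic1_bounded[OF f] by metis
  have "uniformly_continuous_on {-1..2} f"
    using f(2) by (intro compact_uniformly_continuous) (auto intro: continuous_on_subset)
  then obtain d0 where d0: "d0 > 0" "\<And>x y. x \<in> {-1..2} \<Longrightarrow> y \<in> {-1..2} \<Longrightarrow> \<bar>x - y\<bar> < d0 \<Longrightarrow> \<bar>f x - f y\<bar> < \<eta>"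
    unfolding uniformly_continuous_on_def dist_real_def using \<eta> by (metis abs_minus_commute)
  define d where "d = min d0 (1 / 2)"
  have d: "0 < d" "d \<le> 1 / 2" "d \<le> d0" using d0(1) by (auto simp: d_def)
  have "2 * pi * d \<le> 2 * pi * (1 / 2)" using d by (intro mult_left_mono) auto
  then have "cos (2 * pi * d) < cos 0" using d by (intro cos_monotone_0_pi) auto
  then have k: "1 - cos (2 * pi * d) > 0" by simp
  define K where "K = 2 * M / (1 - cos (2 * pi * d))"
  have K0: "K \<ge> 0" using M k by (simp add: K_def)
  have "\<bar>f x - f y\<bar> \<le> \<eta> + K * (1 - cos (2 * pi * (x - y)))" for x y
  proof -
    define w where "w = (x - y) - of_int (round (x - y))"
    have w: "\<bar>w\<bar> \<le> 1 / 2" unfolding w_def using of_int_round_abs_le[of "x - y"] by (simp add: abs_minus_commute)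
    have fx: "f x = f (frac y + w)"
    proof -
      have "x = (frac y + w) + of_int (\<lfloor>y\<rfloor> + round (x - y))" by (simp add: w_def frac_def)
      then show ?thesis using periodic1_int[OF f(1)] by metis
    qed
    have "cos (2 * pi * (x - y)) = cos (2 * pi * w + 2 * pi * of_int (round (x - y)))"
      by (simp add: w_def algebra_simps)
    also have "\<dots> = cos (2 * pi * w)"
      by (simp add: cos_add cos_int_2pin sin_int_2pin)
    finally have cosw: "cos (2 * pi * (x - y)) = cos (2 * pi * w)" .
    show ?thesis
    proof (cases "\<bar>w\<bar> < d")
      case True
      have "frac y \<in> {-1..2}" "frac y + w \<in> {-1..2}" using w frac_ge_0[of y] frac_lt_1[of y] unfolding atLeastAtMost_iff by linarith+
      then have "\<bar>f (frac y + w) - f (frac y)\<bar> < \<eta>" using True d by (intro d0(2)) auto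
      moreover have "0 \<le> K * (1 - cos (2 * pi * (x - y)))" using K0 by simp
      ultimately show ?thesis using fx periodic1_frac[OF f(1), of y] by linarith
    next
      case False
      have "2 * pi * \<bar>w\<bar> \<le> 2 * pi * (1 / 2)" using w by (intro mult_left_mono) auto
      moreover have "2 * pi * d \<le> 2 * pi * \<bar>w\<bar>" using False by (intro mult_left_mono) auto
      ultimately have "cos (2 * pi * \<bar>w\<bar>) \<le> cos (2 * pi * d)" using d by (intro cos_monotone_0_pi_le) auto
      moreover have "cos (2 * pi * \<bar>w\<bar>) = cos (2 * pi * w)" by (cases "w \<ge> 0") auto
      ultimately have "K * (1 - cos (2 * pi * d)) \<le> K * (1 - cos (2 * pi * (x - y)))"
        using K0 cosw by (intro mult_left_mono) auto
      moreover have "K * (1 - cos (2 * pi * d)) = 2 * M" using k by (simp add: K_def)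
      ultimately show ?thesis using M(2)[of x] M(2)[of y] \<eta> by linarith
    qed
  qed
  then show thesis using that K0 by blast
qed

text \<open>By the oscillation bound it suffices to average \<open>1 - cos (2 \<pi> (x - y))\<close>, and this average is at most
  the inverse of the kernel's mass.  The threshold for \<open>\<sigma>\<close> does not depend on \<open>y\<close>.\<close>

lemma kernel_concentrates:
  assumes f: "periodic1 f" "continuous_on UNIV f" and \<eta>: "\<eta> > 0"
  obtains \<sigma>0 where "\<sigma>0 > 0" "\<And>\<sigma> y. 0 < \<sigma> \<Longrightarrow> \<sigma> < \<sigma>0 \<Longrightarrow> (LINT x|kernel_at \<sigma> y. \<bar>f x - f y\<bar>) \<le> \<eta>"
proof -
  obtain K where K: "K \<ge> 0" "\<And>x y. \<bar>f x - f y\<bar> \<le> \<eta> / 2 + K * (1 - cos (2 * pi * (x - y)))"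
    using periodic_oscillation[OF f, of "\<eta> / 2"] \<eta> by auto
  define \<sigma>0 where "\<sigma>0 = min 1 (\<eta> / (16 * pi * K + 1))"
  have p: "16 * pi * K + 1 > 0" using K(1) by (intro add_nonneg_pos) auto
  have s0: "\<sigma>0 > 0" unfolding \<sigma>0_def using \<eta> p by simp
  have "(LINT x|kernel_at \<sigma> y. \<bar>f x - f y\<bar>) \<le> \<eta>" if \<sigma>: "0 < \<sigma>" "\<sigma> < \<sigma>0" for \<sigma> y
  proof -
    note kp = kernel_at_prob_torus[OF \<sigma>(1), of y]
    interpret K: prob_space "kernel_at \<sigma> y" by (rule prob_torusD[OF kp])
    have s1: "\<sigma> \<le> 1" "\<sigma> \<le> \<eta> / (16 * pi * K + 1)" using \<sigma>(2) by (auto simp: \<sigma>0_def)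
    have cc: "continuous_on UNIV (\<lambda>x. 1 - cos (2 * pi * (x - y)))" by (intro continuous_intros)
    have pc: "periodic1 (\<lambda>x. 1 - cos (2 * pi * (x - y)))"
      using cos_2pi_period(1)[of "x - y" for x] by (simp add: periodic1_def algebra_simps)
    have ci: "integrable (kernel_at \<sigma> y) (\<lambda>x. 1 - cos (2 * pi * (x - y)))" by (rule continuous_torus_integrable[OF kp pc cc])
    have fi: "integrable (kernel_at \<sigma> y) (\<lambda>x. \<bar>f x - f y\<bar>)"
      using f by (intro continuous_torus_integrable[OF kp] continuous_intros) (auto simp: periodic1_def)
    have "(LINT x|kernel_at \<sigma> y. 1 - cos (2 * pi * (x - y))) = (LINT x|torus. smoother \<sigma> (x - y) * (1 - cos (2 * pi * (x - y))))"
      by (rule kernel_at_integral[OF \<sigma>(1) continuous_borel_measurable_torus[OF cc]])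
    also have "\<dots> \<le> (LINT x|torus. 1 / kern_mass \<sigma>)"
    proof (rule integral_mono)
      show "integrable torus (\<lambda>x. smoother \<sigma> (x - y) * (1 - cos (2 * pi * (x - y))))"
      proof (intro continuous_torus_integrable[OF torus_in_prob_torus] continuous_on_mult smoother_translate_continuous[OF \<sigma>(1)] cc)
        have sh: "x + 1 - y = (x - y) + 1" for x by simp
        show "periodic1 (\<lambda>x. smoother \<sigma> (x - y) * (1 - cos (2 * pi * (x - y))))"
          unfolding periodic1_def sh smoother_periodic cos_2pi_period by simp
      qed
      fix x
      have "kern \<sigma> (x - y) * (1 - cos (2 * pi * (x - y))) \<le> 1"
        unfolding kern_def using kern_denom_pos[OF \<sigma>(1), of "x - y"] by simp
      then show "smoother \<sigma> (x - y) * (1 - cos (2 * pi * (x - y))) \<le> 1 / kern_mass \<sigma>"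
        unfolding smoother_def using kern_mass_pos[OF \<sigma>(1)] by (simp add: divide_right_mono)
    qed simp
    also have "\<dots> = 1 / kern_mass \<sigma>" by simp
    also have "\<dots> \<le> 1 / (1 / (8 * pi * \<sigma>))"
      using kern_mass_lower_bound[OF \<sigma>(1) s1(1)] \<sigma>(1) kern_mass_pos[OF \<sigma>(1)] by (intro divide_left_mono) auto
    finally have c: "(LINT x|kernel_at \<sigma> y. 1 - cos (2 * pi * (x - y))) \<le> 8 * pi * \<sigma>" by simp
    have "(LINT x|kernel_at \<sigma> y. \<bar>f x - f y\<bar>) \<le> (LINT x|kernel_at \<sigma> y. \<eta> / 2 + K * (1 - cos (2 * pi * (x - y))))"
      using K(2) fi ci by (intro integral_mono) auto
    also have "\<dots> = \<eta> / 2 + K * (LINT x|kernel_at \<sigma> y. 1 - cos (2 * pi * (x - y)))"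
      using Bochner_Integration.integral_add[OF _ integrable_mult_right[OF ci, of K], of "\<lambda>_. \<eta> / 2"]
      by (simp only: integral_mult_right_zero K.integrable_const lebesgue_integral_const K.prob_space) simp
    also have "\<dots> \<le> \<eta> / 2 + K * (8 * pi * \<sigma>)" using c K(1) by (intro add_left_mono mult_left_mono) auto
    also have "\<dots> \<le> \<eta>"
    proof -
      have "(16 * pi * K + 1) * \<sigma> \<le> \<eta>" using s1(2) p by (simp add: field_simps)
      then show ?thesis using \<sigma>(1) by (simp add: algebra_simps)
    qed
    finally show ?thesis .
  qed
  then show thesis using that s0 by blast
qed

lemma smoothing_weak_conv:
  assumes \<mu>: "\<mu> \<in> prob_torus" and s: "(s \<longlongrightarrow> 0) F" "eventually (\<lambda>i. s i > 0) F"
  shows "weak_conv_torus (\<lambda>i. smoothing (s i) \<mu>) F \<mu>"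
  unfolding weak_conv_torus_def
proof (intro allI impI, elim conjE)
  fix f :: "real \<Rightarrow> real" assume f: "periodic1 f" "continuous_on UNIV f"
  interpret \<mu>: prob_space \<mu> by (rule prob_torusD[OF \<mu>])
  obtain M where M: "\<And>x. \<bar>f x\<bar> \<le> M" using periodic1_bounded[OF f] by metis
  note fm = continuous_borel_measurable_torus[OF f(2)]
  note fi = continuous_torus_integrable[OF _ f]
  show "((\<lambda>i. LINT x|smoothing (s i) \<mu>. f x) \<longlongrightarrow> (LINT x|\<mu>. f x)) F"
  proof (rule tendstoI)
    fix e :: real assume "e > 0"
    obtain \<sigma>0 where \<sigma>0: "\<sigma>0 > 0" "\<And>\<sigma> y. 0 < \<sigma> \<Longrightarrow> \<sigma> < \<sigma>0 \<Longrightarrow> (LINT x|kernel_at \<sigma> y. \<bar>f x - f y\<bar>) \<le> e / 2"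
      using kernel_concentrates[OF f, of "e / 2"] \<open>e > 0\<close> by auto
    show "eventually (\<lambda>i. dist (LINT x|smoothing (s i) \<mu>. f x) (LINT x|\<mu>. f x) < e) F"
      using s(2) order_tendstoD(2)[OF s(1) \<sigma>0(1)]
    proof eventually_elim
      case (elim i)
      define m where "m y = (LINT x|kernel_at (s i) y. f x)" for y
      have mi: "integrable \<mu> m"
      proof (rule \<mu>.integrable_const_bound[where B = M])
        show "m \<in> borel_measurable \<mu>" unfolding m_def by (rule smoothing_Fubini(3)[OF \<mu> elim(1) fm M])
        show "AE y in \<mu>. norm (m y) \<le> M" using kernel_average_bound[OF elim(1) fm M] by (simp add: m_def)
      qed
      have close: "\<bar>m y - f y\<bar> \<le> e / 2" for y
      proof -
        note kp = kernel_at_prob_torus[OF elim(1), of y]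
        interpret K: prob_space "kernel_at (s i) y" by (rule prob_torusD[OF kp])
        have "m y - f y = (LINT x|kernel_at (s i) y. f x - f y)" unfolding m_def using fi[OF kp] by (simp add: K.prob_space)
        then have "\<bar>m y - f y\<bar> \<le> (LINT x|kernel_at (s i) y. \<bar>f x - f y\<bar>)" by (simp only: integral_abs_bound)
        then show ?thesis using \<sigma>0(2)[OF elim] by (meson order_trans)
      qed
      have "\<bar>(LINT x|smoothing (s i) \<mu>. f x) - (LINT x|\<mu>. f x)\<bar> = \<bar>LINT y|\<mu>. m y - f y\<bar>"
        unfolding smoothing_integral[OF \<mu> elim(1) fm M] m_def[symmetric] using mi fi[OF \<mu>] by simp
      also have "\<dots> \<le> (LINT y|\<mu>. \<bar>m y - f y\<bar>)" by (rule integral_abs_bound)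
      also have "\<dots> \<le> (LINT y|\<mu>. e / 2)" using close mi fi[OF \<mu>] by (intro integral_mono) auto
      also have "\<dots> < e" using \<open>e > 0\<close> by (simp add: \<mu>.prob_space)
      finally show ?case by (simp add: dist_real_def)
    qed
  qed
qed

text \<open>The bound involves \<open>\<psi>\<close> but not its derivative, which is transferred to the kernel and to \<open>a\<close>.\<close>

lemma kernel_integration_by_parts:
  assumes \<sigma>: "\<sigma> > 0"
    and a: "periodic1 a" "\<And>x. (a has_real_derivative a' x) (at x)" "continuous_on UNIV a'" "\<And>x. \<bar>a x\<bar> \<le> A" "\<And>x. \<bar>a' x\<bar> \<le> A'"
    and \<psi>: "periodic1 \<psi>" "\<And>x. (\<psi> has_real_derivative \<psi>' x) (at x)" "continuous_on UNIV \<psi>'"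
  shows "\<bar>LINT x|kernel_at \<sigma> y. a x * \<psi>' x\<bar> \<le> (2 * pi / \<sigma>\<^sup>2 * A + A') * (LINT x|kernel_at \<sigma> y. \<bar>\<psi> x\<bar>)"
proof -
  define S where "S x = smoother \<sigma> (x - y)" for x
  define S' where "S' x = - (2 * pi * sin (2 * pi * (x - y))) * (kern \<sigma> (x - y))\<^sup>2 / kern_mass \<sigma>" for x
  have Sp: "S x > 0" for x unfolding S_def by (rule smoother_pos[OF \<sigma>])
  have S: "(S has_real_derivative S' x) (at x)" for x
    unfolding S_def S'_def smoother_def
    by (intro DERIV_cdivide) (use kern_deriv[OF \<sigma>, of "x - y"] DERIV_shift[of "kern \<sigma>" _ x "- y"] in simp)
  have S'b: "\<bar>S' x\<bar> \<le> 2 * pi / \<sigma>\<^sup>2 * S x" for x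
    using divide_right_mono[OF kern_log_deriv_bound[OF \<sigma>, of "x - y"], of "kern_mass \<sigma>"] kern_mass_pos[OF \<sigma>]
    unfolding S'_def S_def smoother_def abs_divide by simp
  have cont: "continuous_on UNIV a" "continuous_on UNIV \<psi>" "continuous_on UNIV S"
    using a(2) \<psi>(2) S by (metis DERIV_isCont continuous_at_imp_continuous_on)+
  have contS': "continuous_on UNIV S'"
    unfolding S'_def using kern_mass_pos[OF \<sigma>]
    by (intro continuous_intros continuous_on_compose2[OF kern_continuous[OF \<sigma>]]) auto
  have perS: "periodic1 S" using smoother_periodic[of \<sigma> "x - y" for x] by (simp add: periodic1_def S_def algebra_simps)
  note per = a(1) \<psi>(1) perS periodic1_deriv[OF a(1,2)] periodic1_deriv[OF \<psi>(1,2)] periodic1_deriv[OF perS S]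
  note per' = per[unfolded periodic1_def, rule_format]
  have int: "integrable torus f" if "continuous_on UNIV f" "\<And>x. f (x + 1) = f x" for f :: "real \<Rightarrow> real"
    using continuous_torus_integrable[OF torus_in_prob_torus] that unfolding periodic1_def by blast
  define R where "R x = S' x * (a x * \<psi> x) + S x * (a' x * \<psi> x)" for x
  have iR: "integrable torus R" unfolding R_def
    by (intro int continuous_intros cont contS' a(3)) (simp_all add: per')
  have iT: "integrable torus (\<lambda>x. S x * (a x * \<psi>' x))"
    by (intro int continuous_intros cont \<psi>(3)) (simp_all add: per')
  have iA: "integrable torus (\<lambda>x. S x * \<bar>\<psi> x\<bar>)"
    by (intro int continuous_intros cont) (simp_all add: per')
  have F: "((\<lambda>x. S x * (a x * \<psi> x)) has_real_derivative R x + S x * (a x * \<psi>' x)) (at x)" for x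
    unfolding R_def by (auto intro!: derivative_eq_intros S a(2) \<psi>(2) simp: algebra_simps)
  have "(LINT x|torus. R x + S x * (a x * \<psi>' x)) = S 1 * (a 1 * \<psi> 1) - S 0 * (a 0 * \<psi> 0)"
    by (rule torus_FTC[OF F]) (unfold R_def, intro continuous_intros cont contS' a(3) \<psi>(3))
  also have "\<dots> = 0" using per'[of 0] by simp
  finally have "(LINT x|torus. S x * (a x * \<psi>' x)) = - (LINT x|torus. R x)"
    using iR iT by simp
  then have "\<bar>LINT x|torus. S x * (a x * \<psi>' x)\<bar> \<le> (LINT x|torus. \<bar>R x\<bar>)"
    using integral_abs_bound[of torus R] by simp
  also have "\<dots> \<le> (LINT x|torus. (2 * pi / \<sigma>\<^sup>2 * A + A') * (S x * \<bar>\<psi> x\<bar>))"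
  proof (rule integral_mono)
    fix x
    have "\<bar>R x\<bar> \<le> \<bar>S' x\<bar> * \<bar>a x\<bar> * \<bar>\<psi> x\<bar> + S x * \<bar>a' x\<bar> * \<bar>\<psi> x\<bar>"
      unfolding R_def using Sp[of x] by (intro order_trans[OF abs_triangle_ineq]) (simp add: abs_mult)
    also have "\<dots> \<le> 2 * pi / \<sigma>\<^sup>2 * S x * A * \<bar>\<psi> x\<bar> + S x * A' * \<bar>\<psi> x\<bar>"
      using S'b[of x] a(4,5)[of x] Sp[of x] by (intro add_mono mult_right_mono mult_mono) auto
    also have "\<dots> = (2 * pi / \<sigma>\<^sup>2 * A + A') * (S x * \<bar>\<psi> x\<bar>)" by (simp add: algebra_simps)
    finally show "\<bar>R x\<bar> \<le> (2 * pi / \<sigma>\<^sup>2 * A + A') * (S x * \<bar>\<psi> x\<bar>)" .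
  qed (use iR iA in auto)
  also have "\<dots> = (2 * pi / \<sigma>\<^sup>2 * A + A') * (LINT x|torus. S x * \<bar>\<psi> x\<bar>)" by (rule integral_mult_right_zero)
  finally show ?thesis
    using kernel_at_integral[OF \<sigma>, of "\<lambda>x. a x * \<psi>' x" y] kernel_at_integral[OF \<sigma>, of "\<lambda>x. \<bar>\<psi> x\<bar>" y]
      continuous_borel_measurable_torus[OF continuous_on_mult[OF cont(1) \<psi>(3)]]
      continuous_borel_measurable_torus[OF continuous_on_rabs[OF cont(2)]]
    unfolding S_def by simp
qed

section \<open>The upper bound of the Gamma-convergence\<close>

text \<open>Given a test function \<open>u\<close>, put \<open>\<psi> = \<epsilon> u' / u\<close>, which has mean zero as a logarithmic derivative.
  Average \<open>\<psi>\<close> with the kernel, apply the local estimate at each \<open>y\<close>, and integrate over \<open>\<mu>\<close>.  The local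
  estimate loses a factor \<open>l < 1\<close> in the quadratic term only; rescaling the averages by \<open>l\<close> restores
  an energy, at the price of the factor \<open>1 / l\<close> in front of it.\<close>

lemma DV_rate_smoothing_bound:
  assumes \<mu>: "\<mu> \<in> prob_torus"
    and a: "periodic1 a" "\<And>x. (a has_real_derivative a' x) (at x)" "continuous_on UNIV a'"
      "\<And>x. c \<le> a x" "0 < c" "\<And>x. \<bar>a x\<bar> \<le> A" "\<And>x. \<bar>a' x\<bar> \<le> A'"
    and b: "b \<in> C1_torus" "\<And>x. \<bar>b x\<bar> \<le> B"
    and \<sigma>: "\<sigma> > 0" and \<epsilon>: "\<epsilon> > 0" and \<theta>: "0 < \<theta>" "\<theta> < 1" and \<eta>: "0 \<le> \<eta>" "A * \<eta> < 1"
    and cb: "\<And>y. (LINT x|kernel_at \<sigma> y. \<bar>b x - b y\<bar>) \<le> \<eta>"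
    and ca: "\<And>y. (LINT x|kernel_at \<sigma> y. \<bar>1 / a x - 1 / a y\<bar>) \<le> \<eta>"
    and small: "\<epsilon> * (2 * pi / \<sigma>\<^sup>2 * A + A') \<le> \<eta>"
    and j: "J_minus1 a b \<mu> = ereal j"
  shows "ereal \<epsilon> * DV_rate a b \<epsilon> (smoothing \<sigma> \<mu>)
    \<le> ereal (j / ((1 - \<theta>) * (1 - A * \<eta>)) + (4 * B * \<eta> + 2 * \<eta>\<^sup>2) / (4 * \<theta> * c))"
proof -
  define l where "l = (1 - \<theta>) * (1 - A * \<eta>)"
  define r where "r = (4 * B * \<eta> + 2 * \<eta>\<^sup>2) / (4 * \<theta> * c)"
  have l: "l > 0" using \<theta> \<eta> by (simp add: l_def)
  have aC1: "a \<in> C1_torus" using a(1-3) unfolding C1_torus_def by blast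
  have apos: "a x > 0" for x using a(4)[of x] a(5) by linarith
  have ale: "a x \<le> A" for x using a(6)[of x] by linarith
  note cont = C1_torus_continuous[OF aC1] C1_torus_continuous[OF b(1)]
  note perb = C1_torus_periodic1[OF b(1)]
  interpret \<mu>: prob_space \<mu> by (rule prob_torusD[OF \<mu>])
  have "ereal (- (LINT x|smoothing \<sigma> \<mu>. generator a b \<epsilon> u x / u x)) \<le> ereal ((j / l + r) / \<epsilon>)"
    if u: "u \<in> C2_torus" "\<And>x. u x > 0" for u
  proof -
    note u' = C2_torusD[OF u(1)]
    have u0: "u x \<noteq> 0" for x using u(2)[of x] by simp
    define \<psi> where "\<psi> x = \<epsilon> * (deriv u x / u x)" for x
    define \<psi>' where "\<psi>' x = \<epsilon> * ((deriv (deriv u) x * u x - deriv u x * deriv u x) / (u x * u x))" for x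
    have \<psi>': "(\<psi> has_real_derivative \<psi>' x) (at x)" for x
      unfolding \<psi>_def \<psi>'_def by (intro DERIV_cmult DERIV_divide u' u0)
    have contu: "continuous_on UNIV u" "continuous_on UNIV (deriv u)"
      using u'(4,5) by (auto intro: C1_torus_continuous)
    have \<psi>'c: "continuous_on UNIV \<psi>'" unfolding \<psi>'_def using u0 by (intro continuous_intros contu u'(3)) auto
    have \<psi>c: "continuous_on UNIV \<psi>" unfolding \<psi>_def using u0 by (intro continuous_intros contu) auto
    have \<psi>p: "periodic1 \<psi>"
      using C1_torus_periodic1[OF u'(4)] C1_torus_periodic1[OF u'(5)] by (simp add: periodic1_def \<psi>_def)
    have \<psi>'p: "periodic1 \<psi>'" by (rule periodic1_deriv[OF \<psi>p \<psi>'])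
    have "((\<lambda>x. \<epsilon> * ln (u x)) has_real_derivative \<psi> x) (at x)" for x
      unfolding \<psi>_def using u(2)[of x] by (auto intro!: derivative_eq_intros u'(1))
    from torus_FTC[OF this \<psi>c] have \<psi>0: "(LINT x|torus. \<psi> x) = 0"
      using C1_torus_periodic1[OF u'(4), unfolded periodic1_def, rule_format, of 0] by simp
    obtain M where M: "\<And>x. \<bar>\<psi> x\<bar> \<le> M" using periodic1_bounded[OF \<psi>p \<psi>c] by metis
    note \<psi>m = continuous_borel_measurable_torus[OF \<psi>c]
    define G where "G x = (b x * \<psi> x + a x * (\<psi> x)\<^sup>2) + \<epsilon> * (a x * \<psi>' x)" for x
    have gen: "generator a b \<epsilon> u x / u x = 1 / \<epsilon> * G x" for x
      unfolding generator_def G_def \<psi>_def \<psi>'_def using u0[of x] \<epsilon> by (simp add: field_simps power2_eq_square)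
    have Gc: "continuous_on UNIV G" unfolding G_def by (intro continuous_intros cont \<psi>c \<psi>'c)
    have Gp: "periodic1 G" using a(1) perb \<psi>p \<psi>'p by (simp add: periodic1_def G_def)
    obtain MG where MG: "\<And>x. \<bar>G x\<bar> \<le> MG" using periodic1_bounded[OF Gp Gc] by metis
    note Gm = continuous_borel_measurable_torus[OF Gc]
    define p where "p y = (LINT x|kernel_at \<sigma> y. \<psi> x)" for y
    define \<xi> where "\<xi> y = l * p y" for y
    have pb: "\<bar>p y\<bar> \<le> M" for y unfolding p_def by (rule kernel_average_bound[OF \<sigma> \<psi>m M])
    have pm: "p \<in> borel_measurable torus"
      unfolding p_def by (rule smoothing_Fubini(3)[OF torus_in_prob_torus \<sigma> \<psi>m M])
    have \<xi>m: "\<xi> \<in> borel_measurable torus" unfolding \<xi>_def using pm by simp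
    have \<xi>b: "\<bar>\<xi> y\<bar> \<le> l * M" for y using pb[of y] l by (simp add: \<xi>_def abs_mult)
    have \<xi>0: "(LINT y|torus. \<xi> y) = 0"
      unfolding \<xi>_def p_def integral_mult_right_zero kernel_average_mean[OF \<sigma> \<psi>m M] \<psi>0 by simp
    have en: "energy a b \<mu> \<xi> \<le> j"
      using energy_le_J_minus1[OF \<mu> aC1 apos b(1) \<xi>m \<xi>b \<xi>0] j by simp
    have local: "- (LINT x|kernel_at \<sigma> y. G x) \<le> - (1 / l * (b y * \<xi> y + a y * (\<xi> y)\<^sup>2)) + r" for y
    proof -
      note kp = kernel_at_prob_torus[OF \<sigma>, of y]
      have i1: "integrable (kernel_at \<sigma> y) (\<lambda>x. b x * \<psi> x + a x * (\<psi> x)\<^sup>2)" "integrable (kernel_at \<sigma> y) (\<lambda>x. a x * \<psi>' x)"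
        using a(1) perb \<psi>p \<psi>'p
        by (auto intro!: continuous_torus_integrable[OF kp] continuous_intros cont \<psi>c \<psi>'c simp: periodic1_def)
      have GI: "(LINT x|kernel_at \<sigma> y. G x) = (LINT x|kernel_at \<sigma> y. b x * \<psi> x + a x * (\<psi> x)\<^sup>2) + \<epsilon> * (LINT x|kernel_at \<sigma> y. a x * \<psi>' x)"
        unfolding G_def Bochner_Integration.integral_add[OF i1(1) integrable_mult_right[OF i1(2), of \<epsilon>]]
        by (simp only: integral_mult_right_zero)
      have E0: "0 \<le> (LINT x|kernel_at \<sigma> y. \<bar>\<psi> x\<bar>)" by simp
      have "- (\<epsilon> * (LINT x|kernel_at \<sigma> y. a x * \<psi>' x)) \<le> \<epsilon> * \<bar>LINT x|kernel_at \<sigma> y. a x * \<psi>' x\<bar>"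
        unfolding mult_minus_right[symmetric] using \<epsilon> by (intro mult_left_mono) auto
      also have "\<dots> \<le> \<epsilon> * ((2 * pi / \<sigma>\<^sup>2 * A + A') * (LINT x|kernel_at \<sigma> y. \<bar>\<psi> x\<bar>))"
        using kernel_integration_by_parts[OF \<sigma> a(1-3,6,7) \<psi>p \<psi>' \<psi>'c] \<epsilon> by (intro mult_left_mono) auto
      also have "\<dots> = (\<epsilon> * (2 * pi / \<sigma>\<^sup>2 * A + A')) * (LINT x|kernel_at \<sigma> y. \<bar>\<psi> x\<bar>)" by (simp only: mult.assoc)
      also have "\<dots> \<le> \<eta> * (LINT x|kernel_at \<sigma> y. \<bar>\<psi> x\<bar>)" using small E0 by (rule mult_right_mono)
      finally have "- (LINT x|kernel_at \<sigma> y. G x)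
          \<le> - (LINT x|kernel_at \<sigma> y. b x * \<psi> x + a x * (\<psi> x)\<^sup>2) + \<eta> * (LINT x|kernel_at \<sigma> y. \<bar>\<psi> x\<bar>)"
        unfolding GI by linarith
      also have "\<dots> \<le> - (b y * p y + (1 - \<theta>) * (1 - A * \<eta>) * a y * (p y)\<^sup>2) + (4 * B * \<eta> + 2 * \<eta>\<^sup>2) / (4 * \<theta> * c)"
        unfolding p_def
        by (rule local_energy_bound[OF kp cont(1) a(1,4,5) ale cont(2) perb b(2) \<psi>c \<psi>p \<theta> \<eta>(1) cb ca])
      also have "\<dots> = - (1 / l * (b y * \<xi> y + a y * (\<xi> y)\<^sup>2)) + r"
      proof -
        have "1 / l * (b y * (l * p y) + a y * (l * p y)\<^sup>2) = b y * p y + l * a y * (p y)\<^sup>2"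
          using l by (simp add: field_simps power2_eq_square)
        then show ?thesis unfolding \<xi>_def l_def[symmetric] r_def by (simp only:)
      qed
      finally show ?thesis .
    qed
    have eI: "integrable \<mu> (\<lambda>y. b y * \<xi> y + a y * (\<xi> y)\<^sup>2)"
      by (rule energy_integrable[OF \<mu> aC1 b(1) \<xi>m \<xi>b])
    have GIi: "integrable \<mu> (\<lambda>y. LINT x|kernel_at \<sigma> y. G x)"
      using smoothing_Fubini(3)[OF \<mu> \<sigma> Gm MG] kernel_average_bound[OF \<sigma> Gm MG]
      by (intro \<mu>.integrable_const_bound[where B = MG]) auto
    have "- (LINT y|\<mu>. LINT x|kernel_at \<sigma> y. G x) = (LINT y|\<mu>. - (LINT x|kernel_at \<sigma> y. G x))"
      by simp
    also have "\<dots> \<le> (LINT y|\<mu>. - (1 / l * (b y * \<xi> y + a y * (\<xi> y)\<^sup>2)) + r)"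
      using local by (intro integral_mono Bochner_Integration.integrable_add Bochner_Integration.integrable_minus integrable_mult_right eI GIi \<mu>.integrable_const)
    also have "\<dots> = 1 / l * energy a b \<mu> \<xi> + r"
    proof -
      have "(LINT y|\<mu>. - (1 / l * f y) + r) = 1 / l * (- (LINT y|\<mu>. f y)) + r" if "integrable \<mu> f" for f :: "real \<Rightarrow> real"
        using that by (simp add: \<mu>.prob_space)
      from this[OF eI] show ?thesis unfolding energy_def .
    qed
    also have "\<dots> \<le> 1 / l * j + r" using en l by (intro add_right_mono mult_left_mono) auto
    finally have "- (LINT x|smoothing \<sigma> \<mu>. G x) \<le> j / l + r"
      unfolding smoothing_integral[OF \<mu> \<sigma> Gm MG] by simp
    then have "1 / \<epsilon> * (- (LINT x|smoothing \<sigma> \<mu>. G x)) \<le> 1 / \<epsilon> * (j / l + r)"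
      using \<epsilon> by (intro mult_left_mono) auto
    then show ?thesis unfolding gen integral_mult_right_zero by simp
  qed
  then have "DV_rate a b \<epsilon> (smoothing \<sigma> \<mu>) \<le> ereal ((j / l + r) / \<epsilon>)"
    unfolding DV_rate_def by (intro SUP_least) auto
  then have "ereal \<epsilon> * DV_rate a b \<epsilon> (smoothing \<sigma> \<mu>) \<le> ereal \<epsilon> * ereal ((j / l + r) / \<epsilon>)"
    using \<epsilon> by (intro ereal_mult_left_mono) auto
  then show ?thesis using \<epsilon> by (simp add: l_def r_def)
qed

text \<open>The order of choices matters: \<open>\<theta>\<close> first, so that \<open>j / (1 - \<theta>) < j + \<delta>\<close>; then \<open>\<eta>\<close>, because the
  error contains \<open>\<eta> / \<theta>\<close>; then \<open>\<epsilon>\<close>.  The width \<open>\<sigma>\<close> is the fourth root of \<open>\<epsilon>\<close>, so that both \<open>\<sigma>\<close> and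
  \<open>\<epsilon> / \<sigma>\<^sup>2 = sqrt \<epsilon>\<close> tend to \<open>0\<close>.\<close>

lemma smoothing_recovery:
  assumes \<mu>: "\<mu> \<in> prob_torus" and a: "a \<in> C1_torus" "\<And>x. c \<le> a x" "0 < c" and b: "b \<in> C1_torus"
    and j: "J_minus1 a b \<mu> = ereal j" and \<delta>: "\<delta> > 0"
  shows "eventually (\<lambda>\<epsilon>. ereal \<epsilon> * DV_rate a b \<epsilon> (smoothing (sqrt (sqrt \<epsilon>)) \<mu>) \<le> ereal (j + \<delta>)) (at_right 0)"
proof -
  obtain a' where a': "periodic1 a" "\<And>x. (a has_real_derivative a' x) (at x)" "continuous_on UNIV a'" "periodic1 a'"
    using C1_torusE[OF a(1)] by metis
  note cont = C1_torus_continuous[OF a(1)] C1_torus_continuous[OF b]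
  note perb = C1_torus_periodic1[OF b]
  obtain A where A: "A > 0" "\<And>x. \<bar>a x\<bar> \<le> A" using periodic1_bounded[OF a'(1) cont(1)] by metis
  obtain A' where A': "A' > 0" "\<And>x. \<bar>a' x\<bar> \<le> A'" using periodic1_bounded[OF a'(4,3)] by metis
  obtain B where B: "B > 0" "\<And>x. \<bar>b x\<bar> \<le> B" using periodic1_bounded[OF perb cont(2)] by metis
  have a0: "a x \<noteq> 0" for x using a(2)[of x] a(3) by linarith
  have "((\<lambda>\<theta>. j / (1 - \<theta>)) \<longlongrightarrow> j / (1 - 0)) (at_right 0)" by (intro tendsto_intros) auto
  then have "eventually (\<lambda>\<theta>. j / (1 - \<theta>) < j + \<delta>) (at_right 0)" using \<delta> by (intro order_tendstoD(2)) auto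
  moreover have "eventually (\<lambda>\<theta>::real. 0 < \<theta> \<and> \<theta> < 1) (at_right 0)"
    using eventually_at_right_real[of 0 "1::real"] by simp
  ultimately have "eventually (\<lambda>\<theta>. j / (1 - \<theta>) < j + \<delta> \<and> 0 < \<theta> \<and> \<theta> < 1) (at_right 0)" by eventually_elim simp
  then obtain \<theta> where \<theta>: "j / (1 - \<theta>) < j + \<delta>" "0 < \<theta>" "\<theta> < 1"
    using eventually_happens'[of "at_right (0::real)"] trivial_limit_at_right_real by fastforce
  have "((\<lambda>\<eta>. j / ((1 - \<theta>) * (1 - A * \<eta>)) + (4 * B * \<eta> + 2 * \<eta>\<^sup>2) / (4 * \<theta> * c))
      \<longlongrightarrow> j / ((1 - \<theta>) * (1 - A * 0)) + (4 * B * 0 + 2 * 0\<^sup>2) / (4 * \<theta> * c)) (at_right 0)"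
    using \<theta> a(3) by (intro tendsto_intros) auto
  then have "eventually (\<lambda>\<eta>. j / ((1 - \<theta>) * (1 - A * \<eta>)) + (4 * B * \<eta> + 2 * \<eta>\<^sup>2) / (4 * \<theta> * c) < j + \<delta>) (at_right 0)"
    using \<theta>(1) by (intro order_tendstoD(2)) auto
  moreover have "eventually (\<lambda>\<eta>::real. 0 < \<eta> \<and> \<eta> < 1 / A) (at_right 0)"
    using eventually_at_right_real[of 0 "1 / A"] A(1) by simp
  ultimately have "eventually (\<lambda>\<eta>. j / ((1 - \<theta>) * (1 - A * \<eta>)) + (4 * B * \<eta> + 2 * \<eta>\<^sup>2) / (4 * \<theta> * c) < j + \<delta> \<and> 0 < \<eta> \<and> \<eta> < 1 / A) (at_right 0)"
    by eventually_elim simp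
  then obtain \<eta> where \<eta>: "j / ((1 - \<theta>) * (1 - A * \<eta>)) + (4 * B * \<eta> + 2 * \<eta>\<^sup>2) / (4 * \<theta> * c) < j + \<delta>" "0 < \<eta>" "\<eta> < 1 / A"
    using eventually_happens'[of "at_right (0::real)"] trivial_limit_at_right_real by fastforce
  have A\<eta>: "A * \<eta> < 1" using \<eta>(3) A(1) by (simp add: field_simps)
  obtain \<sigma>1 where \<sigma>1: "\<sigma>1 > 0" "\<And>\<sigma> y. 0 < \<sigma> \<Longrightarrow> \<sigma> < \<sigma>1 \<Longrightarrow> (LINT x|kernel_at \<sigma> y. \<bar>b x - b y\<bar>) \<le> \<eta>"
    using kernel_concentrates[OF perb cont(2) \<eta>(2)] by metis
  have inva: "periodic1 (\<lambda>x. 1 / a x)" "continuous_on UNIV (\<lambda>x. 1 / a x)"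
    using a'(1) a0 by (auto intro!: continuous_intros cont simp: periodic1_def)
  obtain \<sigma>2 where \<sigma>2: "\<sigma>2 > 0" "\<And>\<sigma> y. 0 < \<sigma> \<Longrightarrow> \<sigma> < \<sigma>2 \<Longrightarrow> (LINT x|kernel_at \<sigma> y. \<bar>1 / a x - 1 / a y\<bar>) \<le> \<eta>"
    using kernel_concentrates[OF inva \<eta>(2)] by metis
  have "((\<lambda>\<epsilon>. sqrt (sqrt \<epsilon>)) \<longlongrightarrow> sqrt (sqrt 0)) (at_right 0)" by (intro tendsto_intros)
  then have s: "((\<lambda>\<epsilon>. sqrt (sqrt \<epsilon>)) \<longlongrightarrow> 0) (at_right 0)" by simp
  have "((\<lambda>\<epsilon>. 2 * pi * A * sqrt \<epsilon> + \<epsilon> * A') \<longlongrightarrow> 2 * pi * A * sqrt 0 + 0 * A') (at_right 0)" by (intro tendsto_intros)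
  then have "((\<lambda>\<epsilon>. 2 * pi * A * sqrt \<epsilon> + \<epsilon> * A') \<longlongrightarrow> 0) (at_right 0)" by simp
  from order_tendstoD(2)[OF this \<eta>(2)] order_tendstoD(2)[OF s \<sigma>1(1)] order_tendstoD(2)[OF s \<sigma>2(1)]
    eventually_at_right_less[of "0::real"]
  show ?thesis
  proof eventually_elim
    case (elim \<epsilon>)
    define \<sigma> where "\<sigma> = sqrt (sqrt \<epsilon>)"
    have \<sigma>: "\<sigma> > 0" "\<sigma>\<^sup>2 = sqrt \<epsilon>" using elim(4) by (auto simp: \<sigma>_def)
    have "\<epsilon> * (2 * pi / \<sigma>\<^sup>2 * A + A') = 2 * pi * A * (\<epsilon> / sqrt \<epsilon>) + \<epsilon> * A'"
      unfolding \<sigma>(2) by (simp add: distrib_left)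
    also have "\<epsilon> / sqrt \<epsilon> = sqrt \<epsilon>" using elim(4) by (simp add: real_div_sqrt)
    finally have small: "\<epsilon> * (2 * pi / \<sigma>\<^sup>2 * A + A') \<le> \<eta>" using elim(1) by simp
    have "ereal \<epsilon> * DV_rate a b \<epsilon> (smoothing \<sigma> \<mu>)
        \<le> ereal (j / ((1 - \<theta>) * (1 - A * \<eta>)) + (4 * B * \<eta> + 2 * \<eta>\<^sup>2) / (4 * \<theta> * c))"
      using elim(2,3) \<sigma>(1) \<eta>(2) unfolding \<sigma>_def[symmetric]
      by (intro DV_rate_smoothing_bound[OF \<mu> a'(1-3) a(2,3) A(2) A'(2) b B(2) \<sigma>(1) elim(4) \<theta>(2,3) _ A\<eta> _ _ small j])
         (auto intro: \<sigma>1(2) \<sigma>2(2))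
    also have "\<dots> \<le> ereal (j + \<delta>)" using \<eta>(1) by simp
    finally show ?case unfolding \<sigma>_def .
  qed
qed

section \<open>The zero level set\<close>

lemma J_minus1_le:
  "J_minus1 a b \<mu> \<le> ereal (1 / 4 * (LINT x|\<mu>. (b x)\<^sup>2 / a x))"
proof -
  have "ereal x - ereal (1 / 4) * enn2ereal y \<le> ereal x" for x y
    using ereal_minus_mono[of "ereal x" "ereal x" 0 "ereal (1 / 4) * enn2ereal y"] by simp
  then show ?thesis unfolding J_minus1_resistance by simp
qed

lemma J_minus1_nonneg_real:
  assumes \<mu>: "\<mu> \<in> prob_torus" and a: "a \<in> C1_torus" "\<And>x. a x > 0" and b: "b \<in> C1_torus"
  obtains j where "J_minus1 a b \<mu> = ereal j" "0 \<le> j"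
proof -
  have "0 \<le> J_minus1 a b \<mu>"
    using energy_le_J_minus1[OF \<mu> a b, of "\<lambda>_. 0" 0] by (simp add: energy_def zero_ereal_def)
  then show thesis using that J_minus1_le[of a b \<mu>] by (cases "J_minus1 a b \<mu>") auto
qed

text \<open>After a translation the point of positivity is \<open>1 / 2\<close>, in the interior of the period.  An
  antiderivative is nondecreasing, so if the integral vanished it would be constant on the period,
  with derivative \<open>0\<close> at \<open>1 / 2\<close>.\<close>

lemma torus_integral_pos:
  assumes f: "periodic1 f" "continuous_on UNIV f" "\<And>x. 0 \<le> f x" and x0: "f x0 > (0::real)"
  shows "(LINT x|torus. f x) > 0"
proof (rule ccontr)
  assume "\<not> ?thesis"
  moreover have "(LINT x|torus. f x) \<ge> 0" using f(3) by (intro Bochner_Integration.integral_nonneg)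
  ultimately have zero: "(LINT x|torus. f x) = 0" by simp
  define g where "g x = f (x + (x0 - 1 / 2))" for x
  have gc: "continuous_on UNIV g"
    unfolding g_def by (auto intro!: continuous_on_compose2[OF f(2)] continuous_intros)
  obtain F where F: "\<And>x. (F has_real_derivative g x) (at x)"
    using continuous_antiderivative[OF gc] by metis
  have mono: "F x \<le> F y" if "x \<le> y" for x y
  proof (rule DERIV_nonneg_imp_nondecreasing[OF that])
    show "\<exists>d. (F has_real_derivative d) (at t) \<and> 0 \<le> d" for t
      using F[of t] f(3) by (intro exI[of _ "g t"]) (simp add: g_def)
  qed
  have "F 1 - F 0 = (LINT x|torus. g x)" using torus_FTC[OF F gc] by simp
  also have "\<dots> = 0" unfolding g_def torus_integral_translate[OF f(1,2)] by (rule zero)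
  finally have "F 1 = F 0" by simp
  then have const: "F y = F 0" if "0 \<le> y" "y \<le> 1" for y
    using mono[OF that(1)] mono[OF that(2)] by simp
  have "g (1 / 2) = 0"
  proof (rule DERIV_local_const[OF F])
    show "\<forall>y. \<bar>1 / 2 - y\<bar> < 1 / 2 \<longrightarrow> F (1 / 2) = F y"
    proof (intro allI impI)
      fix y :: real assume "\<bar>1 / 2 - y\<bar> < 1 / 2"
      then have "0 \<le> y" "y \<le> 1" by linarith+
      from const[OF this] const[of "1 / 2"] show "F (1 / 2) = F y" by linarith
    qed
  qed simp
  then show False using x0 by (simp add: g_def)
qed

lemma simple_zero_signs:
  assumes "(b has_real_derivative d) (at z)" "d \<noteq> 0" "b z = 0"
  shows "\<exists>x. b x > 0" "\<exists>x. b x < 0"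
proof -
  consider "d > 0" | "d < 0" using assms(2) by linarith
  then have "(\<exists>x. b x > 0) \<and> (\<exists>x. b x < 0)"
  proof cases
    case 1
    obtain e1 where e1: "e1 > 0" "\<forall>h>0. h < e1 \<longrightarrow> b z < b (z + h)"
      using DERIV_pos_inc_right[OF assms(1) 1] by blast
    obtain e2 where e2: "e2 > 0" "\<forall>h>0. h < e2 \<longrightarrow> b (z - h) < b z"
      using DERIV_pos_inc_left[OF assms(1) 1] by blast
    show ?thesis using e1(2)[rule_format, of "e1 / 2"] e2(2)[rule_format, of "e2 / 2"] e1(1) e2(1) assms(3) by auto
  next
    case 2
    obtain e1 where e1: "e1 > 0" "\<forall>h>0. h < e1 \<longrightarrow> b (z + h) < b z"
      using DERIV_neg_dec_right[OF assms(1) 2] by blast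
    obtain e2 where e2: "e2 > 0" "\<forall>h>0. h < e2 \<longrightarrow> b z < b (z - h)"
      using DERIV_neg_dec_left[OF assms(1) 2] by blast
    show ?thesis using e1(2)[rule_format, of "e1 / 2"] e2(2)[rule_format, of "e2 / 2"] e1(1) e2(1) assms(3) by auto
  qed
  then show "\<exists>x. b x > 0" "\<exists>x. b x < 0" by auto
qed

text \<open>The function \<open>\<psi> = Q b\<^sup>+ - P b\<^sup>-\<close>, with \<open>P\<close> and \<open>Q\<close> the integrals of \<open>b\<^sup>+\<close> and \<open>b\<^sup>-\<close>, has mean zero
  and the sign of \<open>b\<close>.  The energy of \<open>- s \<psi>\<close> is \<open>s \<integral> b \<psi> d\<mu> - s\<^sup>2 \<integral> a \<psi>\<^sup>2 d\<mu>\<close>, which stays nonpositive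
  for small \<open>s > 0\<close> only if \<open>\<integral> b \<psi> d\<mu> = 0\<close>.\<close>

lemma J_minus1_zero_imp_AE:
  assumes \<mu>: "\<mu> \<in> prob_torus" and a: "a \<in> C1_torus" "\<And>x. a x > 0" and b: "b \<in> C1_torus"
    and signs: "b x1 > 0" "b x2 < 0" and J: "J_minus1 a b \<mu> = 0"
  shows "AE x in \<mu>. b x = 0"
proof -
  define bp where "bp x = max (b x) 0" for x
  define bn where "bn x = max (- b x) 0" for x
  note contab = C1_torus_continuous[OF a(1)] C1_torus_continuous[OF b]
  note perab = C1_torus_periodic1[OF a(1), unfolded periodic1_def, rule_format] C1_torus_periodic1[OF b, unfolded periodic1_def, rule_format]
  have contp: "continuous_on UNIV bp" "continuous_on UNIV bn"
    unfolding bp_def bn_def by (intro continuous_intros contab)+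
  have per: "periodic1 bp" "periodic1 bn" using perab by (simp_all add: periodic1_def bp_def bn_def)
  define P where "P = (LINT x|torus. bp x)"
  define Q where "Q = (LINT x|torus. bn x)"
  have P: "P > 0" unfolding P_def using signs(1) by (intro torus_integral_pos[OF per(1) contp(1), of x1]) (auto simp: bp_def)
  have Q: "Q > 0" unfolding Q_def using signs(2) by (intro torus_integral_pos[OF per(2) contp(2), of x2]) (auto simp: bn_def)
  define \<psi> where "\<psi> x = Q * bp x - P * bn x" for x
  have \<psi>c: "continuous_on UNIV \<psi>" unfolding \<psi>_def by (intro continuous_intros contp)
  have \<psi>p: "periodic1 \<psi>" using per by (simp add: periodic1_def \<psi>_def)
  have ti: "integrable torus bp" "integrable torus bn"
    using continuous_torus_integrable[OF torus_in_prob_torus] per contp by blast+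
  have \<psi>0: "(LINT x|torus. \<psi> x) = 0" unfolding \<psi>_def using ti by (simp add: P_def[symmetric] Q_def[symmetric])
  obtain M where M: "\<And>x. \<bar>\<psi> x\<bar> \<le> M" using periodic1_bounded[OF \<psi>p \<psi>c] by metis
  note \<psi>m = continuous_borel_measurable_torus[OF \<psi>c]
  have b\<psi>: "b x * \<psi> x = Q * (bp x)\<^sup>2 + P * (bn x)\<^sup>2" for x
    by (simp add: \<psi>_def bp_def bn_def max_def power2_eq_square)
  have b\<psi>0: "0 \<le> b x * \<psi> x" for x unfolding b\<psi> using P Q by simp
  have iX: "integrable \<mu> (\<lambda>x. b x * \<psi> x)" and iY: "integrable \<mu> (\<lambda>x. a x * (\<psi> x)\<^sup>2)"
    using \<psi>p perab by (auto intro!: continuous_torus_integrable[OF \<mu>] continuous_intros contab \<psi>c simp: periodic1_def)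
  define X where "X = (LINT x|\<mu>. b x * \<psi> x)"
  define Y where "Y = (LINT x|\<mu>. a x * (\<psi> x)\<^sup>2)"
  have X0: "X \<ge> 0" unfolding X_def using b\<psi>0 by (intro Bochner_Integration.integral_nonneg)
  have Y0: "Y \<ge> 0" unfolding Y_def using a(2) by (intro Bochner_Integration.integral_nonneg) (simp add: less_imp_le)
  have "X \<le> s * Y" if s: "s > 0" for s
  proof -
    have "\<bar>- s * \<psi> x\<bar> \<le> s * M" for x using M[of x] s by (simp add: abs_mult)
    moreover have "(LINT x|torus. - s * \<psi> x) = 0" unfolding integral_mult_right_zero \<psi>0 by simp
    ultimately have "ereal (energy a b \<mu> (\<lambda>x. - s * \<psi> x)) \<le> J_minus1 a b \<mu>"
      using \<psi>m by (intro energy_le_J_minus1[OF \<mu> a b, where M = "s * M"]) auto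
    then have en: "energy a b \<mu> (\<lambda>x. - s * \<psi> x) \<le> 0" unfolding J zero_ereal_def by simp
    have eq: "b x * (- s * \<psi> x) + a x * (- s * \<psi> x)\<^sup>2 = s\<^sup>2 * (a x * (\<psi> x)\<^sup>2) - s * (b x * \<psi> x)" for x
      by (simp add: power2_eq_square)
    have "(LINT x|\<mu>. s\<^sup>2 * (a x * (\<psi> x)\<^sup>2) - s * (b x * \<psi> x)) = s\<^sup>2 * Y - s * X"
      unfolding Bochner_Integration.integral_diff[OF integrable_mult_right[OF iY] integrable_mult_right[OF iX]] X_def Y_def
      by (simp only: integral_mult_right_zero)
    with en have "s * X - s\<^sup>2 * Y \<le> 0" unfolding energy_def eq by simp
    then have "s * X \<le> s * (s * Y)" by (simp add: power2_eq_square)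
    then show ?thesis using s by simp
  qed
  moreover have "((\<lambda>s. s * Y) \<longlongrightarrow> 0 * Y) (at_right 0)" by (intro tendsto_intros)
  ultimately have "X \<le> 0 * Y"
    by (intro tendsto_lowerbound[where F = "at_right (0::real)"])
       (auto intro: eventually_mono[OF eventually_at_right_less])
  with X0 have "X = 0" by simp
  then have "AE x in \<mu>. b x * \<psi> x = 0"
    using integral_nonneg_eq_0_iff_AE[OF iX] b\<psi>0 by (simp add: X_def)
  then show ?thesis
  proof eventually_elim
    case (elim x)
    have "Q * (bp x)\<^sup>2 + P * (bn x)\<^sup>2 = 0" using elim b\<psi>[of x] by simp
    then have "Q * (bp x)\<^sup>2 = 0" "P * (bn x)\<^sup>2 = 0"
      using P Q by (simp_all add: add_nonneg_eq_0_iff)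
    then have "bp x = 0" "bn x = 0" using P Q by simp_all
    then show ?case by (auto simp: bp_def bn_def max_def split: if_splits)
  qed
qed

lemma finite_in_sets_torus:
  assumes "finite C" "C \<subseteq> {0..<1}" shows "C \<in> sets torus"
proof -
  have "{0..<1} \<inter> C \<in> sets torus"
    unfolding sets_torus using assms(1) by (intro sets_restrict_space_iff[THEN iffD2]) (auto intro: sets.Int borel_closed finite_imp_closed)
  then show ?thesis using assms(2) by (simp add: Int_absorb1)
qed

lemma dirac_combination_iff:
  assumes \<mu>: "\<mu> \<in> prob_torus" and C: "finite C" "C \<subseteq> {0..<1}"
  shows "\<mu> \<in> dirac_combinations C \<longleftrightarrow> (AE x in \<mu>. x \<in> C)"
proof -
  interpret prob_space \<mu> by (rule prob_torusD[OF \<mu>])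
  note s = prob_torusD(2)[OF \<mu>]
  have Cs: "C \<in> sets torus" by (rule finite_in_sets_torus[OF C])
  have ret: "measure (return torus x) A = indicator A x" if "A \<in> sets torus" for A x
    using that by (simp add: measure_return)
  show ?thesis
  proof
    assume "\<mu> \<in> dirac_combinations C"
    then obtain w where w: "(\<Sum>x\<in>C. w x) = 1"
      "\<And>A. A \<in> sets torus \<Longrightarrow> measure \<mu> A = (\<Sum>x\<in>C. w x * measure (return torus x) A)"
      unfolding dirac_combinations_def by blast
    have "measure \<mu> C = (\<Sum>x\<in>C. w x)"
      unfolding w(2)[OF Cs] by (intro sum.cong) (simp_all add: ret[OF Cs])
    then show "AE x in \<mu>. x \<in> C" using w(1) Cs s by (subst prob_eq_1[symmetric]) auto
  next
    assume ae: "AE x in \<mu>. x \<in> C"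
    have sing: "{x} \<in> sets \<mu>" if "x \<in> C" for x using that C s by (auto intro!: finite_in_sets_torus)
    have eq: "measure \<mu> A = (\<Sum>x\<in>C. measure \<mu> {x} * measure (return torus x) A)" if A: "A \<in> sets torus" for A
    proof -
      have "measure \<mu> A = measure \<mu> (A \<inter> C)"
        using ae A Cs s by (intro finite_measure_eq_AE) auto
      also have "\<dots> = (\<Sum>x\<in>A \<inter> C. measure \<mu> {x})"
        using C sing by (intro finite_measure_eq_sum_singleton) auto
      also have "\<dots> = (\<Sum>x\<in>C. measure \<mu> {x} * measure (return torus x) A)"
        using C(1) by (intro sum.mono_neutral_cong_left) (auto simp: ret[OF A] indicator_eq_0_iff)
      finally show ?thesis .
    qed
    have "(\<Sum>x\<in>C. measure \<mu> {x}) = measure \<mu> C"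
      using C sing by (intro finite_measure_eq_sum_singleton[symmetric]) auto
    also have "\<dots> = 1" using ae Cs s by (subst prob_eq_1) auto
    finally show "\<mu> \<in> dirac_combinations C"
      unfolding dirac_combinations_def using \<mu> eq by (auto intro!: exI[of _ "\<lambda>x. measure \<mu> {x}"])
  qed
qed

lemma J_minus1_eq_zero_iff:
  assumes \<mu>: "\<mu> \<in> prob_torus" and a: "a \<in> C1_torus" "\<And>x. a x > 0" and b: "b \<in> C1_torus"
    and C: "C = {x \<in> {0..<1}. b x = 0}" "finite C" and signs: "b x1 > 0" "b x2 < 0"
  shows "J_minus1 a b \<mu> = 0 \<longleftrightarrow> \<mu> \<in> dirac_combinations C"
proof -
  have iff: "\<mu> \<in> dirac_combinations C \<longleftrightarrow> (AE x in \<mu>. x \<in> C)"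
    by (rule dirac_combination_iff[OF \<mu> C(2)]) (auto simp: C(1))
  show ?thesis unfolding iff
  proof
    assume "J_minus1 a b \<mu> = 0"
    from J_minus1_zero_imp_AE[OF \<mu> a b signs this] AE_space
    show "AE x in \<mu>. x \<in> C" by eventually_elim (simp add: C(1) prob_torusD(3)[OF \<mu>])
  next
    assume "AE x in \<mu>. x \<in> C"
    then have "AE x in \<mu>. (b x)\<^sup>2 / a x = 0" by eventually_elim (simp add: C(1))
    then have "(LINT x|\<mu>. (b x)\<^sup>2 / a x) = 0" by (rule integral_eq_zero_AE)
    then have "J_minus1 a b \<mu> \<le> 0" using J_minus1_le[of a b \<mu>] by (simp add: zero_ereal_def)
    moreover obtain j where "J_minus1 a b \<mu> = ereal j" "0 \<le> j" using J_minus1_nonneg_real[OF \<mu> a b] .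
    ultimately show "J_minus1 a b \<mu> = 0" by (simp add: zero_ereal_def)
  qed
qed

section \<open>Gamma-convergence\<close>

lemma smoothing_recovery_weak_conv:
  assumes "\<mu> \<in> prob_torus"
  shows "weak_conv_torus (\<lambda>\<epsilon>. smoothing (sqrt (sqrt \<epsilon>)) \<mu>) (at_right 0) \<mu>"
proof (rule smoothing_weak_conv[OF assms])
  have "((\<lambda>\<epsilon>. sqrt (sqrt \<epsilon>)) \<longlongrightarrow> sqrt (sqrt 0)) (at_right 0)" by (intro tendsto_intros)
  then show "((\<lambda>\<epsilon>. sqrt (sqrt \<epsilon>)) \<longlongrightarrow> 0) (at_right 0)" by simp
  show "eventually (\<lambda>\<epsilon>. sqrt (sqrt \<epsilon>) > 0) (at_right 0)"
    by (rule eventually_mono[OF eventually_at_right_less]) simp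
qed

lemma Gamma_converges_J_minus1:
  assumes a: "a \<in> C1_torus" "\<And>x. c \<le> a x" "0 < c" and b: "b \<in> C1_torus"
  shows "Gamma_converges (\<lambda>\<epsilon> \<mu>. ereal \<epsilon> * DV_rate a b \<epsilon> \<mu>) (J_minus1 a b)"
  unfolding Gamma_converges_def
proof (intro ballI conjI allI impI)
  have apos: "a x > 0" for x using a(2)[of x] a(3) by linarith
  fix \<mu> assume \<mu>: "\<mu> \<in> prob_torus"
  show "J_minus1 a b \<mu> \<le> Liminf (at_right 0) (\<lambda>\<epsilon>. ereal \<epsilon> * DV_rate a b \<epsilon> (\<mu>s \<epsilon>))"
    if "(\<forall>\<epsilon>>0. \<mu>s \<epsilon> \<in> prob_torus) \<and> weak_conv_torus \<mu>s (at_right 0) \<mu>" for \<mu>s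
    using that by (intro Gamma_liminf[OF \<mu> a(1) apos b]) auto
  obtain j where j: "J_minus1 a b \<mu> = ereal j" using J_minus1_nonneg_real[OF \<mu> a(1) apos b] by metis
  let ?\<mu>s = "\<lambda>\<epsilon>. smoothing (sqrt (sqrt \<epsilon>)) \<mu>"
  have "Limsup (at_right 0) (\<lambda>\<epsilon>. ereal \<epsilon> * DV_rate a b \<epsilon> (?\<mu>s \<epsilon>)) \<le> J_minus1 a b \<mu>"
  proof (rule ereal_le_epsilon2)
    fix \<delta> :: real assume "\<delta> > 0"
    from Limsup_bounded[OF smoothing_recovery[OF \<mu> a b j this]]
    show "Limsup (at_right 0) (\<lambda>\<epsilon>. ereal \<epsilon> * DV_rate a b \<epsilon> (?\<mu>s \<epsilon>)) \<le> J_minus1 a b \<mu> + ereal \<delta>"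
      by (simp add: j)
  qed
  then show "\<exists>\<mu>s. (\<forall>\<epsilon>>0. \<mu>s \<epsilon> \<in> prob_torus) \<and> weak_conv_torus \<mu>s (at_right 0) \<mu> \<and>
      Limsup (at_right 0) (\<lambda>\<epsilon>. ereal \<epsilon> * DV_rate a b \<epsilon> (\<mu>s \<epsilon>)) \<le> J_minus1 a b \<mu>"
    using smoothing_recovery_weak_conv[OF \<mu>] smoothing_prob_torus[OF \<mu>]
    by (intro exI[of _ ?\<mu>s]) auto
qed

text \<open>The recovery sequence for \<open>J_minus1\<close> keeps \<open>\<epsilon> I\<^sub>\<epsilon>\<close> bounded, and \<open>\<alpha>\<^sub>\<epsilon> I\<^sub>\<epsilon>\<close> is \<open>\<alpha>\<^sub>\<epsilon> / \<epsilon>\<close> times that.\<close>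

lemma Gamma_converges_zero:
  assumes a: "a \<in> C1_torus" "\<And>x. c \<le> a x" "0 < c" and b: "b \<in> C1_torus"
    and \<alpha>: "\<And>\<epsilon>. \<epsilon> > 0 \<Longrightarrow> \<alpha> \<epsilon> > 0" "((\<lambda>\<epsilon>. \<alpha> \<epsilon> / \<epsilon>) \<longlongrightarrow> 0) (at_right 0)"
  shows "Gamma_converges (\<lambda>\<epsilon> \<mu>. ereal (\<alpha> \<epsilon>) * DV_rate a b \<epsilon> \<mu>) (\<lambda>_. 0)"
  unfolding Gamma_converges_def
proof (intro ballI conjI allI impI)
  have apos: "a x > 0" for x using a(2)[of x] a(3) by linarith
  fix \<mu> assume \<mu>: "\<mu> \<in> prob_torus"
  show "0 \<le> Liminf (at_right 0) (\<lambda>\<epsilon>. ereal (\<alpha> \<epsilon>) * DV_rate a b \<epsilon> (\<mu>s \<epsilon>))"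
    if "(\<forall>\<epsilon>>0. \<mu>s \<epsilon> \<in> prob_torus) \<and> weak_conv_torus \<mu>s (at_right 0) \<mu>" for \<mu>s
  proof (rule Liminf_bounded, rule eventually_mono[OF eventually_at_right_less])
    fix \<epsilon> :: real assume "0 < \<epsilon>"
    then show "0 \<le> ereal (\<alpha> \<epsilon>) * DV_rate a b \<epsilon> (\<mu>s \<epsilon>)"
      using that DV_rate_nonneg[OF _ _ a(1) b, of "\<mu>s \<epsilon>" \<epsilon>] \<alpha>(1)[of \<epsilon>]
      by (intro ereal_0_le_mult) (auto simp: less_imp_le)
  qed
  obtain j where j: "J_minus1 a b \<mu> = ereal j" using J_minus1_nonneg_real[OF \<mu> a(1) apos b] by metis
  let ?\<mu>s = "\<lambda>\<epsilon>. smoothing (sqrt (sqrt \<epsilon>)) \<mu>"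
  have "((\<lambda>\<epsilon>. \<alpha> \<epsilon> / \<epsilon> * (j + 1)) \<longlongrightarrow> 0 * (j + 1)) (at_right 0)"
    by (intro tendsto_intros \<alpha>(2))
  then have lim: "((\<lambda>\<epsilon>. ereal (\<alpha> \<epsilon> / \<epsilon> * (j + 1))) \<longlongrightarrow> 0) (at_right 0)" by (simp add: zero_ereal_def)
  have "eventually (\<lambda>\<epsilon>. ereal (\<alpha> \<epsilon>) * DV_rate a b \<epsilon> (?\<mu>s \<epsilon>) \<le> ereal (\<alpha> \<epsilon> / \<epsilon> * (j + 1))) (at_right 0)"
    using smoothing_recovery[OF \<mu> a b j, of 1, OF zero_less_one] eventually_at_right_less[of "0::real"]
  proof eventually_elim
    case (elim \<epsilon>)
    have "ereal (\<alpha> \<epsilon>) * DV_rate a b \<epsilon> (?\<mu>s \<epsilon>) = ereal (\<alpha> \<epsilon> / \<epsilon>) * (ereal \<epsilon> * DV_rate a b \<epsilon> (?\<mu>s \<epsilon>))"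
      using elim(2) by (simp add: mult.assoc[symmetric])
    also have "\<dots> \<le> ereal (\<alpha> \<epsilon> / \<epsilon>) * ereal (j + 1)"
      using elim \<alpha>(1)[of \<epsilon>] by (intro ereal_mult_left_mono) auto
    finally show ?case by simp
  qed
  then have "Limsup (at_right 0) (\<lambda>\<epsilon>. ereal (\<alpha> \<epsilon>) * DV_rate a b \<epsilon> (?\<mu>s \<epsilon>))
      \<le> Limsup (at_right 0) (\<lambda>\<epsilon>. ereal (\<alpha> \<epsilon> / \<epsilon> * (j + 1)))" by (rule Limsup_mono)
  also have "\<dots> = 0" by (rule lim_imp_Limsup[OF _ lim]) simp
  finally show "\<exists>\<mu>s. (\<forall>\<epsilon>>0. \<mu>s \<epsilon> \<in> prob_torus) \<and> weak_conv_torus \<mu>s (at_right 0) \<mu> \<and>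
      Limsup (at_right 0) (\<lambda>\<epsilon>. ereal (\<alpha> \<epsilon>) * DV_rate a b \<epsilon> (\<mu>s \<epsilon>)) \<le> 0"
    using smoothing_recovery_weak_conv[OF \<mu>] smoothing_prob_torus[OF \<mu>]
    by (intro exI[of _ ?\<mu>s]) auto
qed

theorem proposition2p2:
  fixes a b :: "real \<Rightarrow> real" and c0 :: real and N :: nat and C :: "real set"
  defines "C \<equiv> {x \<in> {0..<1}. b x = 0}"
  assumes "a \<in> C2_torus" and "b \<in> C2_torus"
    and "c0 > 0" and "\<And>x. a x \<ge> c0"
    and "N \<ge> 1" and "finite C" and "card C = 2 * N"
    and "\<And>x. x \<in> C \<Longrightarrow> deriv b x \<noteq> 0"
    and "total_drift a b \<ge> 0"
  shows "(\<forall>\<mu>\<in>prob_torus. 0 \<le> J_minus1 a b \<mu> \<and> J_minus1 a b \<mu> < \<infinity>) \<and>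
     Gamma_converges (\<lambda>\<epsilon> \<mu>. ereal \<epsilon> * DV_rate a b \<epsilon> \<mu>) (J_minus1 a b) \<and>
     {\<mu> \<in> prob_torus. J_minus1 a b \<mu> = 0} = dirac_combinations C \<and>
     (\<forall>\<alpha>. (\<forall>\<epsilon>>0. \<alpha> \<epsilon> > 0) \<and> ((\<lambda>\<epsilon>. \<alpha> \<epsilon> / \<epsilon>) \<longlongrightarrow> 0) (at_right 0) \<longrightarrow>
        Gamma_converges (\<lambda>\<epsilon> \<mu>. ereal (\<alpha> \<epsilon>) * DV_rate a b \<epsilon> \<mu>) (\<lambda>_. 0))"
proof -
  note a = C2_torusD(4)[OF assms(2)] and b = C2_torusD(4)[OF assms(3)]
  have apos: "a x > 0" for x using assms(4) assms(5)[of x] by linarith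
  have "C \<noteq> {}" using assms(6,8) by auto
  then obtain z where z: "z \<in> C" by blast
  obtain x1 x2 where signs: "b x1 > 0" "b x2 < 0"
    using simple_zero_signs[OF C2_torusD(1)[OF assms(3)] assms(9)[OF z]] z unfolding C_def by auto
  have J: "0 \<le> J_minus1 a b \<mu> \<and> J_minus1 a b \<mu> < \<infinity>" if \<mu>: "\<mu> \<in> prob_torus" for \<mu>
  proof -
    obtain j where "J_minus1 a b \<mu> = ereal j" "0 \<le> j" using J_minus1_nonneg_real[OF \<mu> a apos b] .
    then show ?thesis by simp
  qed
  have "J_minus1 a b \<mu> = 0 \<longleftrightarrow> \<mu> \<in> dirac_combinations C" if "\<mu> \<in> prob_torus" for \<mu>
    using assms(7) by (intro J_minus1_eq_zero_iff[OF that a apos b _ _ signs]) (simp_all add: C_def)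
  then have zero: "{\<mu> \<in> prob_torus. J_minus1 a b \<mu> = 0} = dirac_combinations C"
    by (auto simp: dirac_combinations_def)
  show ?thesis
    using J zero Gamma_converges_J_minus1[OF a assms(5,4) b]
    by (intro conjI allI impI ballI Gamma_converges_zero[OF a assms(5,4) b]) auto
qed

end
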